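(* Let $p\in\mathbb{N}$, $n\in\mathbb{N}_0$, $\mathbf{a},\mathbf{b}\in\mathbb{C}^p$, $\psi=\sum_{k=1}^p(b_k-a_k)$. Suppose that $u\le s+1$ are nonnegative integers, $\mathbf{c}\in\mathbb{C}^u$, $\mathbf{d}\in\mathbb{C}^s$ with $-\mathbf{d}\notin\mathbb{N}_0$, $\Re(\psi)>-n$ and $\Re(\mathbf{a})>-n$. Then $$\frac{1}{\Gamma(\mathbf{a})}\int_0^1{}_uF_s\!\left(\begin{matrix}\mathbf{c}\\\mathbf{d}\end{matrix}\,\Big|-zt\right)\widehat{G}_n(t)\,dt=\frac{1}{\Gamma(\mathbf{b})}\sum_{j=0}^{\infty}\frac{z^j(\mathbf{c})_j}{(n+j)!\,(\mathbf{d})_j}\,{}_uF_s\!\left(\begin{matrix}\mathbf{c}+j\\\mathbf{d}+j\end{matrix}\,\Big|-z\right){}_{p+1}F_p\!\left(\begin{matrix}-n-j,\mathbf{a}\\\mathbf{b}\end{matrix}\,\Big|\,1\right),$$ where the series on the right converges for all $z\in\mathbb{C}$ if $u\le s$ and in the half-plane $\Re(z)>-1/2$ if $u=s+1$. Therefore, for $u=s+1$ the integral on the left-hand side is an explicit representation of the analytic continuation to the cut plane $\mathbb{C}\setminus(-\infty,-1]$ of the function defined by the right-hand side.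
   Context: $\mathbb{N}_0=\mathbb{N}\cup\{0\}$. For a vector $\mathbf{a}=(a_1,\dots,a_p)$: $\Gamma(\mathbf{a})=\prod_i\Gamma(a_i)$, $(\mathbf{a})_j=\prod_i(a_i)_j$, $\mathbf{a}+\mu=(a_1+\mu,\dots,a_p+\mu)$; conditions such as $\Re(\mathbf{a})>-n$, $-\mathbf{a}\notin\mathbb{N}_0$ are element-wise. For $0<t<1$ and $-\mathbf{a}\notin\mathbb{N}_0$, $$\widehat{G}_n(t)=G^{p,1}_{p+1,p+1}\!\left(t\,\Big|\begin{array}{l}n,\mathbf{b}+n-1\\ \mathbf{a}+n-1,0\end{array}\right)=\frac{1}{2\pi i}\int_{\mathcal{L}}\frac{\Gamma(\mathbf{a}+n-1+s)\,\Gamma(1-n-s)}{\Gamma(\mathbf{b}+n-1+s)\,\Gamma(1-s)}\,t^{-s}\,ds,$$ where $\mathcal{L}$ is a left loop (starting and ending at $-\infty$, traversed counterclockwise) that leaves all the points $1-a_j-n-l$, $l\in\mathbb{N}_0$, on its left and all the points $1-n+k$, $k\in\mathbb{N}_0$, on its right. If some components of $\mathbf{a}$ are non-positive integers, $\widehat{G}_n(t)/\Gamma(\mathbf{a})$ denotes its extension by continuity in $\mathbf{a}$, namely $\frac{t^{n-1}}{(n-1)!}\sum_{j=0}^{n-1}\frac{(1-n)_j(\mathbf{a})_j}{\Gamma(\mathbf{b}+j)\,j!}t^{-j}$ (and $0$ if $n=0$). A terminating series $\frac{1}{\Gamma(\mathbf{b})}{}_{p+1}F_p(-N,\mathbf{a};\mathbf{b};1)$,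 $N\in\mathbb{N}_0$, is understood as $\sum_{i=0}^{N}\frac{(-N)_i(\mathbf{a})_i}{\Gamma(\mathbf{b}+i)\,i!}$. For $u=s+1$, ${}_uF_s(\cdot;\cdot;w)$ denotes the analytic continuation to $w\in\mathbb{C}\setminus[1,\infty)$. *)

theory Defs
  imports "HOL-Complex_Analysis.Complex_Analysis"
begin

text \<open>Parameter vectors are lists of complex numbers.\<close>

definition Gamma_vec :: "complex list \<Rightarrow> complex" where
  "Gamma_vec v = (\<Prod>x\<leftarrow>v. Gamma x)"

text \<open>The entire function \<open>1 / \<Gamma>(v)\<close>, which vanishes at the poles of \<open>\<Gamma>\<close>.\<close>

definition rGamma_vec :: "complex list \<Rightarrow> complex" where
  "rGamma_vec v = (\<Prod>x\<leftarrow>v. rGamma x)"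

definition poch_vec :: "complex list \<Rightarrow> nat \<Rightarrow> complex" where
  "poch_vec v j = (\<Prod>x\<leftarrow>v. pochhammer x j)"

definition shift_vec :: "complex list \<Rightarrow> complex \<Rightarrow> complex list" where
  "shift_vec v \<mu> = map (\<lambda>x. x + \<mu>) v"

definition hyp_series :: "complex list \<Rightarrow> complex list \<Rightarrow> complex \<Rightarrow> complex" where
  "hyp_series c d w = (\<Sum>k. poch_vec c k / (poch_vec d k * fact k) * w ^ k)"

text \<open>
  The generalized hypergeometric function. For \<open>length c = length d + 1\<close> it is the
  analytic continuation of the series from the unit disc to the plane cut along
  \<open>[1, \<infinity>)\<close>; the choice is unique on that domain by the identity theorem. The case
  \<open>length c > length d + 1\<close> is meaningless.
\<close>

definition hypF :: "complex list \<Rightarrow> complex list \<Rightarrow> complex \<Rightarrow> complex" where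
  "hypF c d =
     (if length c \<le> length d then hyp_series c d
      else (SOME f. f holomorphic_on (- complex_of_real ` {1..}) \<and>
                    (\<forall>w. norm w < 1 \<longrightarrow> f w = hyp_series c d w)))"

text \<open>The terminating series \<open>1 / \<Gamma>(b) * F(-N, a; b; 1)\<close>, for arbitrary \<open>b\<close>.\<close>

definition reg_term_hypF :: "nat \<Rightarrow> complex list \<Rightarrow> complex list \<Rightarrow> complex" where
  "reg_term_hypF N a b =
     (\<Sum>i=0..N. pochhammer (- of_nat N) i * poch_vec a i * rGamma_vec (shift_vec b (of_nat i)) / fact i)"

text \<open>
  A loop starting and ending at \<open>-\<infinity>\<close> is represented by a path \<open>\<gamma>\<close>: it comes in along the
  horizontal ray ending in the start point of \<open>\<gamma>\<close>, follows \<open>\<gamma>\<close>, and goes out along the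
  horizontal ray issuing from the end point of \<open>\<gamma>\<close>. Below is its part to the right of the
  line \<open>Re s = X\<close>, for \<open>X\<close> sufficiently negative, and that part closed up by
  a vertical segment.
\<close>

definition loop_part :: "(real \<Rightarrow> complex) \<Rightarrow> real \<Rightarrow> real \<Rightarrow> complex" where
  "loop_part \<gamma> X =
     linepath (Complex X (Im (pathstart \<gamma>))) (pathstart \<gamma>) +++ \<gamma> +++
     linepath (pathfinish \<gamma>) (Complex X (Im (pathfinish \<gamma>)))"

definition closed_loop_part :: "(real \<Rightarrow> complex) \<Rightarrow> real \<Rightarrow> real \<Rightarrow> complex" where
  "closed_loop_part \<gamma> X =
     loop_part \<gamma> X +++
     linepath (Complex X (Im (pathfinish \<gamma>))) (Complex X (Im (pathstart \<gamma>)))"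

text \<open>
  Points on the left of a loop traversed counterclockwise are those of index 1, points on
  its right those of index 0. Self-intersections are not excluded: by Cauchy's theorem
  integrals along the loop depend only on these indices.
\<close>

definition left_loop :: "(real \<Rightarrow> complex) \<Rightarrow> complex set \<Rightarrow> complex set \<Rightarrow> bool" where
  "left_loop \<gamma> A B \<longleftrightarrow>
     valid_path \<gamma> \<and> Im (pathstart \<gamma>) < Im (pathfinish \<gamma>) \<and>
     (\<forall>w\<in>A. \<forall>\<^sub>F X in at_bot.
        w \<notin> path_image (closed_loop_part \<gamma> X) \<and> winding_number (closed_loop_part \<gamma> X) w = 1) \<and>
     (\<forall>w\<in>B. \<forall>\<^sub>F X in at_bot.
        w \<notin> path_image (closed_loop_part \<gamma> X) \<and> winding_number (closed_loop_part \<gamma> X) w = 0)"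

definition loop_integral :: "(real \<Rightarrow> complex) \<Rightarrow> (complex \<Rightarrow> complex) \<Rightarrow> complex" where
  "loop_integral \<gamma> f = Lim at_bot (\<lambda>X. contour_integral (loop_part \<gamma> X) f)"

definition Ghat_integrand ::
  "nat \<Rightarrow> complex list \<Rightarrow> complex list \<Rightarrow> real \<Rightarrow> complex \<Rightarrow> complex" where
  "Ghat_integrand n a b t s =
     Gamma_vec (shift_vec a (of_nat n - 1 + s)) * Gamma (1 - of_nat n - s) *
     rGamma_vec (shift_vec b (of_nat n - 1 + s)) * rGamma (1 - s) * of_real t powr (- s)"

definition Ghat_loop :: "nat \<Rightarrow> complex list \<Rightarrow> real \<Rightarrow> complex" where
  "Ghat_loop n a =
     (SOME \<gamma>. left_loop \<gamma>
        {1 - x - of_nat n - of_nat l |x l. x \<in> set a}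
        (range (\<lambda>k::nat. 1 - of_nat n + of_nat k)))"

definition Ghat :: "nat \<Rightarrow> complex list \<Rightarrow> complex list \<Rightarrow> real \<Rightarrow> complex" where
  "Ghat n a b t = 1 / (2 * of_real pi * \<i>) * loop_integral (Ghat_loop n a) (Ghat_integrand n a b t)"

text \<open>
  \<open>Ghat n a b t / \<Gamma>(a)\<close>, extended by continuity in \<open>a\<close> to non-positive integer components.
\<close>

definition Ghat_div_Gamma :: "nat \<Rightarrow> complex list \<Rightarrow> complex list \<Rightarrow> real \<Rightarrow> complex" where
  "Ghat_div_Gamma n a b t =
     (if \<forall>x\<in>set a. - x \<notin> \<nat> then Ghat n a b t / Gamma_vec a
      else if n = 0 then 0
      else of_real t ^ (n - 1) / fact (n - 1) *
           (\<Sum>j=0..n-1. pochhammer (1 - of_nat n) j * poch_vec a j *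
              rGamma_vec (shift_vec b (of_nat j)) / fact j * inverse (of_real t) ^ j))"

end

theory Submission
  imports Defs "HOL-Real_Asymp.Real_Asymp"
begin

text \<open>
  Write \<open>N = n + j\<close>. Everything rests on the moments
  \<open>\<integral>\<^sub>0\<^sup>1 (1 - t)\<^sup>j Ghat(t) / \<Gamma>(a) dt = j! / N! \<cdot> 1 / \<Gamma>(b) \<cdot> F(-N, a; b; 1)\<close>
  (\<open>Ghat_div_Gamma_moments\<close>). Granted these, expand \<open>w \<mapsto> F(c; d; w)\<close> in its Taylor series about
  \<open>w = -z\<close> and put \<open>w = -z t\<close>, so that \<open>w + z = z (1 - t)\<close> (\<open>hypF_taylor\<close>); integration term by term
  gives the asserted series. If the series for \<open>F\<close> is entire, this works for every \<open>z\<close>. Otherwise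
  the condition \<open>Re z > -1/2\<close> says exactly that \<open>\<bar>z\<bar> < \<bar>1 + z\<bar>\<close>. Under it, \<open>1\<close> is the point of the cut
  \<open>[1, \<infinity>)\<close> nearest to \<open>-z\<close>, so the radius of convergence is at least \<open>\<bar>1 + z\<bar>\<close>, and the convergence
  is uniform on \<open>0 \<le> t \<le> 1\<close>. The integral itself makes sense and is holomorphic for all \<open>z\<close> off the cut because the
  cut plane is star-shaped about \<open>0\<close> and \<open>Ghat\<close> is integrable (\<open>holomorphic_integral_dilate\<close>).

  For the moments, put \<open>\<alpha> = a + n - 1\<close>, \<open>\<beta> = b + n - 1\<close> and \<open>Q(s) = \<Gamma>(\<alpha> + s) / \<Gamma>(\<beta> + s)\<close>. Away from
  the points \<open>1 - n + k\<close> the integrand of \<open>Ghat\<close> is \<open>Q(s) t\<^sup>-\<^sup>s / (1 - n - s)\<^sub>n\<close>. Two left loops differ,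
  as far as integrals are concerned, by the residues at the finitely many poles which they separate
  differently (\<open>loop_integral_change\<close>), so \<open>Ghat\<close> equals the integral along a rectangular loop inside
  \<open>Re s < 1\<close> minus the residues at \<open>0, -1, ..., 1 - n\<close>. On that rectangle
  \<open>\<integral>\<^sub>0\<^sup>1 (1 - t)\<^sup>j t\<^sup>-\<^sup>s dt = j! / (1 - s)\<^bsub>j+1\<^esub>\<close>, and Fubini's theorem applies precisely because
  \<open>Q(s) = O(\<bar>s\<bar>\<^bsup>-Re \<psi>\<^esup>)\<close> with \<open>Re \<psi> + n > 0\<close>; the same
  argument shows that \<open>Ghat\<close> is integrable. This turns the moment into a loop integral of \<open>H(s) = j! Q(s) / (1 - n - s)\<^bsub>N+1\<^esub>\<close>. Since
  \<open>H(s) = O(\<bar>s\<bar>\<^bsup>-1-\<epsilon>\<^esup>)\<close> outside a sector about the negative axis, the rectangle can be blown up to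
  infinity, and the residues at \<open>1 - n + i\<close>, \<open>0 \<le> i \<le> N\<close>, add up to the terminating series.

  Two existence questions have to be settled on the way. A left loop separating the two families of
  points is obtained from a rectangle by detours (\<open>left_loop_exclude_point\<close>). The analytic continuation
  of the hypergeometric series to the cut plane is obtained by adjoining one pair of parameters at a
  time, starting from \<open>(1 - w)\<^sup>-\<^sup>c\<close> (\<open>cut_series_pochhammer_ratio\<close>).
\<close>

section \<open>Growth of quotients of Gamma functions\<close>

lemma norm_add_of_nat_ge:
  fixes s :: complex
  assumes "Re s \<ge> 0"
  shows "(norm (s + of_nat k))\<^sup>2 \<ge> (norm s)\<^sup>2 + real k ^ 2"
  using assms unfolding cmod_power2 by (simp add: power2_sum)

text \<open>
  In the closed right half-plane the arguments of \<open>z\<close> and \<open>z + 1\<close> are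
  close enough for the logarithm of the quotient to split.
\<close>
lemma Ln_add_1_div:
  fixes z :: complex
  assumes "Re z \<ge> 0" "z \<noteq> 0"
  shows "Ln (1 + 1 / z) = Ln (z + 1) - Ln z"
proof -
  have nz: "z + 1 \<noteq> 0" using assms by (auto simp: complex_eq_iff)
  have a: "\<bar>Im (Ln z)\<bar> \<le> pi/2" using Re_Ln_pos_le[OF assms(2)] assms by simp
  have b: "\<bar>Im (Ln (z+1))\<bar> < pi/2" using Re_Ln_pos_lt[OF nz] assms by simp
  have "exp (Ln (z + 1) - Ln z) = 1 + 1/z" using assms nz by (simp add: exp_diff field_simps)
  moreover have "Ln (exp (Ln (z + 1) - Ln z)) = Ln (z + 1) - Ln z"
    by (rule Ln_exp) (use a b in auto)
  ultimately show ?thesis by simp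
qed

text \<open>
  A weak form of Stirling's formula, \<open>\<Gamma>(s + a) / \<Gamma>(s)\<close> being of the exact
  order \<open>s\<^sup>a\<close>, uniformly in the right half-plane. Euler's product represents the
  quotient as the limit of \<open>n\<^sup>a \<Prod>\<^bsub>k\<le>n\<^esub> (1 + a / (s +
  k))\<^sup>-\<^sup>1\<close>. Replacing each factor \<open>1 + a / (s + k)\<close> by \<open>(1 + 1
  / (s + k))\<^sup>a\<close>, for which the product telescopes, changes its logarithm by \<open>O(1
  / \<bar>s + k\<bar>\<^sup>2)\<close>, and these errors have a bounded sum.
\<close>
lemma Gamma_ratio_bounds:
  fixes a :: complex
  shows "\<exists>K>0. \<forall>s. Re s \<ge> 0 \<longrightarrow> norm s \<ge> 2 * norm a + 2 \<longrightarrow>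
     norm (Gamma (s + a)) \<le> K * norm s powr Re a * norm (Gamma s) \<and>
     norm s powr Re a * norm (Gamma s) \<le> K * norm (Gamma (s + a))"
proof -
  define S where "S = (\<Sum>k. 1 / (1 + real k ^ 2))"
  have sS: "summable (\<lambda>k. 1 / (1 + real k ^ 2))"
    by (rule summable_comparison_test[OF _ inverse_power_summable[of 2]])
       (auto intro!: exI[of _ 1] le_imp_inverse_le simp: inverse_eq_divide[symmetric] abs_of_nonneg)
  define c where "c = 2 * ((norm a)\<^sup>2 + norm a)"
  define K where "K = exp (pi * \<bar>Im a\<bar> + c * S)"
  have c0: "c \<ge> 0" by (simp add: c_def)
  show ?thesis
  proof (intro exI[of _ K] conjI allI impI)

    show "K > 0" by (simp add: K_def)
  next
    fix s :: complex
    assume s: "Re s \<ge> 0" "norm s \<ge> 2 * norm a + 2"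
    have ge: "norm (s + of_nat k) \<ge> norm s" for k
      using norm_add_of_nat_ge[OF s(1), of k] by (smt (verit) norm_ge_zero power2_le_imp_le zero_le_power2)
    have s1: "norm s \<ge> 1" using s(2) norm_ge_zero[of a] by linarith
    have nz: "s + of_nat k \<noteq> 0" for k
    proof
      assume "s + of_nat k = 0"
      then show False using ge[of k] s1 by (simp only: norm_zero)
    qed
    have nza: "s + of_nat k + a \<noteq> 0" for k
    proof
      assume "s + of_nat k + a = 0"
      then have "norm (s + of_nat k) = norm a" by (metis add_eq_0_iff norm_minus_cancel)
      then show False using ge[of k] s(2) norm_ge_zero[of a] by linarith
    qed
    have nIs: "s \<notin> \<int>\<^sub>\<le>\<^sub>0" using nz by (force elim!: nonpos_Ints_cases')
    have nIa: "s + a \<notin> \<int>\<^sub>\<le>\<^sub>0"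
    proof
      assume "s + a \<in> \<int>\<^sub>\<le>\<^sub>0"
      then obtain m where m: "s + a = - of_nat m" by (elim nonpos_Ints_cases')
      have "s + of_nat m + a = (s + a) + of_nat m" by (simp add: add_ac)
      then show False using nza[of m] by (simp add: m)
    qed
    have small: "norm (x / (s + of_nat k)) \<le> 1/2" if "norm x \<le> norm a + 1" for x k
      using ge[of k] s(2) that nz[of k] by (simp add: norm_divide divide_simps)
    define d where "d k = Ln (1 + a / (s + of_nat k)) - a * Ln (1 + 1 / (s + of_nat k))" for k
    have d_le: "norm (d k) \<le> c * (1 / (1 + real k ^ 2))" for k
    proof -
      define v where "v = 1 / (s + of_nat k)"
      have L: "norm (Ln (1 + x * v) - x * v) \<le> 2 * (norm x * norm v)\<^sup>2" if "norm x \<le> norm a + 1" for x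
      proof -
        have le: "norm (x * v) \<le> 1/2" using small[OF that, of k] by (simp add: v_def)
        then have "norm (Ln (1 + x * v) - x * v) \<le> (norm (x * v))\<^sup>2 / (1 - norm (x * v))"
          by (intro Ln_approx_linear) auto
        also have "\<dots> \<le> (norm (x * v))\<^sup>2 / (1/2)"
          using le by (intro divide_left_mono) auto
        finally show ?thesis by (simp add: norm_mult)
      qed
      have "d k = (Ln (1 + a * v) - a * v) - a * (Ln (1 + 1 * v) - 1 * v)"
        by (simp add: d_def v_def algebra_simps)
      also have "norm \<dots> \<le> 2 * (norm a * norm v)\<^sup>2 + norm a * (2 * (norm (1::complex) * norm v)\<^sup>2)"
        by (rule order.trans[OF norm_triangle_ineq4], rule add_mono)
           (use L[of a] L[of 1] in \<open>auto simp: norm_mult intro!: mult_left_mono\<close>)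
      also have "\<dots> = c * (norm v)\<^sup>2" by (simp add: c_def power_mult_distrib algebra_simps)
      also have "(norm v)\<^sup>2 \<le> 1 / (1 + real k ^ 2)"
      proof -
        have "1 \<le> norm s" using s(2) norm_ge_zero[of a] by linarith
        then have "1 \<le> (norm s)\<^sup>2" by simp
        then have "1 + real k ^ 2 \<le> (norm (s + of_nat k))\<^sup>2"
          using norm_add_of_nat_ge[OF s(1), of k] by linarith
        then show ?thesis
          by (simp add: v_def norm_divide power_divide) (intro divide_left_mono mult_pos_pos, auto simp: add_pos_nonneg nz)
      qed
      finally show ?thesis using c0 by (simp add: mult_left_mono)
    qed
    \<comment> \<open>The total error of the telescoping approximation.\<close>
    define D where "D n = (\<Sum>k=0..<Suc n. d k)" for n
    have D_le: "norm (D n) \<le> c * S" for n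
    proof -
      have "norm (D n) \<le> (\<Sum>k=0..<Suc n. c * (1 / (1 + real k ^ 2)))"
        unfolding D_def by (rule sum_norm_le) (rule d_le)
      also have "\<dots> = c * (\<Sum>k=0..<Suc n. 1 / (1 + real k ^ 2))" by (simp only: sum_distrib_left)
      also have "\<dots> \<le> c * S" unfolding S_def
        by (intro mult_left_mono c0 sum_le_suminf sS) auto
      finally show ?thesis .
    qed
    have tele: "(\<Sum>k=0..<Suc n. Ln (1 + 1 / (s + of_nat k))) = Ln (s + of_nat (Suc n)) - Ln s" for n
    proof -
      have "(\<Sum>k=0..<Suc n. Ln (1 + 1 / (s + of_nat k))) =
            (\<Sum>k=0..<Suc n. Ln (s + of_nat (Suc k)) - Ln (s + of_nat k))"
        by (intro sum.cong refl) (subst Ln_add_1_div, use s nz in \<open>auto simp: algebra_simps\<close>)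
      also have "\<dots> = Ln (s + of_nat (Suc n)) - Ln s" by (subst sum_Suc_diff') auto
      finally show ?thesis .
    qed
    have prod: "(\<Prod>k=0..<Suc n. 1 + a / (s + of_nat k)) = exp (D n + a * (Ln (s + of_nat (Suc n)) - Ln s))" for n
    proof -
      have nz1: "1 + a / (s + of_nat k) \<noteq> 0" for k
        using nza[of k] nz[of k] by (simp add: field_simps)
      have "(\<Prod>k=0..<Suc n. 1 + a / (s + of_nat k)) = (\<Prod>k=0..<Suc n. exp (Ln (1 + a / (s + of_nat k))))"
        by (intro prod.cong refl) (simp add: nz1)
      also have "\<dots> = exp (\<Sum>k=0..<Suc n. Ln (1 + a / (s + of_nat k)))" by (simp only: exp_sum finite_atLeastLessThan)
      also have "(\<Sum>k=0..<Suc n. Ln (1 + a / (s + of_nat k))) =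
          D n + a * (\<Sum>k=0..<Suc n. Ln (1 + 1 / (s + of_nat k)))"
        unfolding D_def d_def sum_distrib_left sum.distrib[symmetric] by simp
      finally show ?thesis unfolding tele .
    qed
    \<comment> \<open>The last factor compares \<open>n\<^sup>a\<close> with \<open>(s + n + 1)\<^sup>a\<close> and tends to one.\<close>
    define q where "q n = norm (exp (a * (Ln (of_nat n) - Ln (s + of_nat (Suc n)))))" for n
    have ratio: "norm (Gamma_series (s + a) n) / norm (Gamma_series s n) =
        norm (exp (a * Ln s)) * norm (exp (- D n)) * q n" if "n > 0" for n
    proof -
      have "pochhammer (s + a) (n + 1) = pochhammer s (n + 1) * (\<Prod>k=0..<Suc n. 1 + a / (s + of_nat k))"
        unfolding pochhammer_prod prod.distrib[symmetric] Suc_eq_plus1[symmetric]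
        by (intro prod.cong refl) (use nz in \<open>simp add: field_simps\<close>)
      note P = this[unfolded prod]
      have nzp: "pochhammer s (n + 1) \<noteq> 0" using nz by (auto simp: pochhammer_eq_0_iff eq_neg_iff_add_eq_0)
      have "Gamma_series (s + a) n / Gamma_series s n =
          exp (a * Ln (of_nat n)) / exp (D n + a * (Ln (s + of_nat (Suc n)) - Ln s))"
        unfolding Gamma_series_def P using nzp that
        by (simp add: divide_simps ring_distribs exp_add del: pochhammer_Suc)
      also have "\<dots> = exp (a * Ln s) * exp (- D n) * exp (a * (Ln (of_nat n) - Ln (s + of_nat (Suc n))))"
        unfolding exp_diff[symmetric] exp_add[symmetric] by (simp add: algebra_simps)
      finally show ?thesis by (metis norm_divide norm_mult q_def)
    qed
    have q_lim: "q \<longlonglongrightarrow> 1"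
    proof -
      have "(\<lambda>n. - Ln (1 + (s + 1) / of_nat n)) \<longlonglongrightarrow> - Ln (1 + 0)"
        by (intro tendsto_intros tendsto_divide_0[OF tendsto_const] tendsto_of_nat) auto
      moreover have "eventually (\<lambda>n. - Ln (1 + (s + 1) / of_nat n) = Ln (of_nat n) - Ln (s + of_nat (Suc n))) sequentially"
        using eventually_gt_at_top[of 0]
      proof eventually_elim
        case (elim n)
        have "s + of_nat (Suc n) = of_real (real n) * (1 + (s + 1) / of_nat n)" using elim by (simp add: field_simps)
        also have "Ln \<dots> = of_real (ln (real n)) + Ln (1 + (s + 1) / of_nat n)"
          by (subst Ln_times_of_real) (use elim nz[of "Suc n"] in \<open>auto simp: field_simps\<close>)
        finally show ?case using elim by (simp add: Ln_of_nat)
      qed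
      ultimately have "(\<lambda>n. Ln (of_nat n) - Ln (s + of_nat (Suc n))) \<longlonglongrightarrow> 0"
        using Lim_transform_eventually by fastforce
      then have "(\<lambda>n. norm (exp (a * (Ln (of_nat n) - Ln (s + of_nat (Suc n)))))) \<longlonglongrightarrow> norm (exp (a * 0))"
        by (intro tendsto_intros)
      then show ?thesis by (simp add: q_def[abs_def])
    qed
    have lim: "(\<lambda>n. norm (Gamma_series (s + a) n) / norm (Gamma_series s n)) \<longlonglongrightarrow> norm (Gamma (s + a)) / norm (Gamma s)"
      by (intro tendsto_intros) (use nIs in \<open>auto simp: Gamma_eq_zero_iff\<close>)
    have Gs: "norm (Gamma s) > 0" using nIs by (simp add: Gamma_eq_zero_iff)
    have Ls: "norm (exp (a * Ln s)) = norm s powr Re a * exp (- Im a * Im (Ln s))"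
      using nz[of 0] by (simp add: powr_def exp_diff[symmetric] exp_add[symmetric] exp_minus[symmetric])
    have "\<bar>Im a * Im (Ln s)\<bar> \<le> \<bar>Im a\<bar> * pi"
      unfolding abs_mult using mpi_less_Im_Ln[of s] Im_Ln_le_pi[of s] nz[of 0] by (intro mult_left_mono) auto
    then have ImLn: "- (pi * \<bar>Im a\<bar>) \<le> - Im a * Im (Ln s)" "- Im a * Im (Ln s) \<le> pi * \<bar>Im a\<bar>"
      by (auto simp: mult.commute)
    have eD: "- (c * S) \<le> Re (- D n)" "Re (- D n) \<le> c * S" for n
      using D_le[of n] abs_Re_le_cmod[of "D n"] by auto
    have up: "norm (exp (a * Ln s)) * norm (exp (- D n)) \<le> K * norm s powr Re a" for n
    proof -
      have "exp (- Im a * Im (Ln s)) * exp (Re (- D n)) \<le> K"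
        unfolding K_def exp_add[symmetric] using ImLn eD[of n] by simp
      then show ?thesis unfolding Ls by (simp add: mult_left_mono mult.assoc mult.commute[of K])
    qed
    have low: "norm s powr Re a \<le> K * (norm (exp (a * Ln s)) * norm (exp (- D n)))" for n
    proof -
      have "1 \<le> K * (exp (- Im a * Im (Ln s)) * exp (Re (- D n)))"
        unfolding K_def exp_add[symmetric] using ImLn eD[of n] by simp
      from mult_left_mono[OF this, of "norm s powr Re a"] show ?thesis unfolding Ls by (simp add: mult_ac)
    qed
    have "norm (Gamma (s + a)) / norm (Gamma s) \<le> (K * norm s powr Re a) * 1"
    proof (rule LIMSEQ_le[OF lim tendsto_mult[OF tendsto_const q_lim]])
      show "\<exists>N. \<forall>n\<ge>N. cmod (Gamma_series (s + a) n) / cmod (Gamma_series s n) \<le> K * cmod s powr Re a * q n"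
        by (rule exI[of _ 1]) (auto simp: ratio q_def intro!: mult_right_mono up simp del: norm_exp_eq_Re)
    qed
    then show "norm (Gamma (s + a)) \<le> K * norm s powr Re a * norm (Gamma s)"
      using Gs by (simp add: divide_simps)
    have "norm s powr Re a * 1 \<le> K * (norm (Gamma (s + a)) / norm (Gamma s))"
    proof (rule LIMSEQ_le[OF tendsto_mult[OF tendsto_const q_lim] tendsto_mult[OF tendsto_const lim]])
      have "norm s powr Re a * q n \<le> K * (cmod (Gamma_series (s + a) n) / cmod (Gamma_series s n))" if "n \<ge> 1" for n
        using mult_right_mono[OF low[of n], of "q n"] ratio[of n] that by (simp add: q_def mult_ac del: norm_exp_eq_Re)
      then show "\<exists>N. \<forall>n\<ge>N. norm s powr Re a * q n \<le> K * (cmod (Gamma_series (s + a) n) / cmod (Gamma_series s n))"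
        by blast
    qed
    then show "norm s powr Re a * norm (Gamma s) \<le> K * norm (Gamma (s + a))"
      using Gs by (simp add: divide_simps)
  qed
qed

text \<open>
  The denominator enters as the entire function \<open>1 / \<Gamma>(\<beta> + s)\<close>, so the
  only singularities come from \<open>\<alpha>\<close>.
\<close>
definition Gamma_quot :: "complex list \<Rightarrow> complex list \<Rightarrow> complex \<Rightarrow> complex" where
  "Gamma_quot \<alpha> \<beta> s = Gamma_vec (shift_vec \<alpha> s) * rGamma_vec (shift_vec \<beta> s)"

text \<open>
  The factor by which the reflection formula changes \<open>\<Gamma>(\<alpha> + s) /
  \<Gamma>(\<beta> + s)\<close> into \<open>\<Gamma>(1 - \<beta> - s) / \<Gamma>(1 - \<alpha> -
  s)\<close>.
\<close>
definition sin_quot :: "complex list \<Rightarrow> complex list \<Rightarrow> complex \<Rightarrow> complex" where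
  "sin_quot \<alpha> \<beta> s = (\<Prod>y\<leftarrow>\<beta>. sin (of_real pi * (y + s))) / (\<Prod>x\<leftarrow>\<alpha>. sin (of_real pi * (x + s)))"

lemma Gamma_quot_Nil [simp]: "Gamma_quot [] [] s = 1"
  by (simp add: Gamma_quot_def Gamma_vec_def rGamma_vec_def shift_vec_def)

lemma Gamma_quot_Cons [simp]:
  "Gamma_quot (x # \<alpha>) (y # \<beta>) s = (Gamma (x + s) * rGamma (y + s)) * Gamma_quot \<alpha> \<beta> s"
  by (simp add: Gamma_quot_def Gamma_vec_def rGamma_vec_def shift_vec_def)

lemma sin_quot_Nil [simp]: "sin_quot [] [] s = 1"
  by (simp add: sin_quot_def)

lemma sin_quot_Cons [simp]:
  "sin_quot (x # \<alpha>) (y # \<beta>) s = (sin (of_real pi * (y + s)) / sin (of_real pi * (x + s))) * sin_quot \<alpha> \<beta> s"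
  by (simp add: sin_quot_def)

lemma Gamma_pair_bound_right:
  fixes x y :: complex
  shows "\<exists>C R. C > 0 \<and> R > 0 \<and> (\<forall>s. Re s \<ge> 0 \<longrightarrow> norm s \<ge> R \<longrightarrow>
     Gamma (x + s) \<noteq> 0 \<and> Gamma (y + s) \<noteq> 0 \<and>
     norm (Gamma (x + s) * rGamma (y + s)) \<le> C * norm s powr Re (x - y))"
proof -
  obtain K where K: "K > 0" "\<And>s. Re s \<ge> 0 \<Longrightarrow> norm s \<ge> 2 * norm x + 2 \<Longrightarrow>
     norm (Gamma (s + x)) \<le> K * norm s powr Re x * norm (Gamma s) \<and>
     norm s powr Re x * norm (Gamma s) \<le> K * norm (Gamma (s + x))"
    using Gamma_ratio_bounds[of x] by blast
  obtain L where L: "L > 0" "\<And>s. Re s \<ge> 0 \<Longrightarrow> norm s \<ge> 2 * norm y + 2 \<Longrightarrow>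
     norm (Gamma (s + y)) \<le> L * norm s powr Re y * norm (Gamma s) \<and>
     norm s powr Re y * norm (Gamma s) \<le> L * norm (Gamma (s + y))"
    using Gamma_ratio_bounds[of y] by blast
  show ?thesis
  proof (rule exI[of _ "K * L"], rule exI[of _ "2 * norm x + 2 * norm y + 2"], intro conjI allI impI)
    fix s :: complex assume s: "Re s \<ge> 0" "norm s \<ge> 2 * norm x + 2 * norm y + 2"
    have s0: "norm s > 0" using s(2) norm_ge_zero[of x] norm_ge_zero[of y] by linarith
    have "s \<notin> \<int>\<^sub>\<le>\<^sub>0"
    proof
      assume "s \<in> \<int>\<^sub>\<le>\<^sub>0"
      then show False using s(1) s0 by (auto elim!: nonpos_Ints_cases')
    qed
    then have G: "norm (Gamma s) > 0" by (simp add: Gamma_eq_zero_iff)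
    have k: "norm (Gamma (s + x)) \<le> K * norm s powr Re x * norm (Gamma s)"
      "norm s powr Re x * norm (Gamma s) \<le> K * norm (Gamma (s + x))"
      using K(2)[of s] s norm_ge_zero[of y] by auto
    have l: "norm s powr Re y * norm (Gamma s) \<le> L * norm (Gamma (s + y))"
      using L(2)[of s] s norm_ge_zero[of x] by auto
    have "0 < norm s powr Re x * norm (Gamma s)" using G s0 by simp
    then have "0 < K * norm (Gamma (s + x))" using k by linarith
    then show "Gamma (x + s) \<noteq> 0" using K(1) by (auto simp: add.commute)
    have "0 < norm s powr Re y * norm (Gamma s)" using G s0 by simp
    then have "0 < L * norm (Gamma (s + y))" using l by linarith
    then have Gy: "0 < norm (Gamma (s + y))" using L(1) by (simp add: zero_less_mult_iff)
    then show "Gamma (y + s) \<noteq> 0" by (auto simp: add.commute)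
    have "norm (Gamma (x + s) * rGamma (y + s)) = norm (Gamma (s + x)) / norm (Gamma (s + y))"
      by (simp add: rGamma_inverse_Gamma norm_mult norm_inverse divide_inverse add.commute)
    also have "\<dots> \<le> K * norm s powr Re x * norm (Gamma s) / (norm s powr Re y * norm (Gamma s) / L)"
      using k(1) l L(1) K(1) G s0 by (intro frac_le mult_nonneg_nonneg) (auto simp: field_simps)
    also have "\<dots> = K * L * norm s powr Re (x - y)"
      using G s0 by (simp add: powr_diff)
    finally show "norm (Gamma (x + s) * rGamma (y + s)) \<le> K * L * norm s powr Re (x - y)" .
  qed (use K L in \<open>auto simp: add_nonneg_pos\<close>)
qed

text \<open>
  The reflection formula exchanges the half-planes: \<open>-s\<close> lies in the right half-plane,
  and \<open>(1 - y) - (1 - x) = x - y\<close>.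
\<close>
lemma Gamma_pair_bound_left:
  fixes x y :: complex
  shows "\<exists>C R. C > 0 \<and> R > 0 \<and> (\<forall>s. Re s \<le> 0 \<longrightarrow> norm s \<ge> R \<longrightarrow>
     norm (Gamma (x + s) * rGamma (y + s)) \<le>
       C * norm s powr Re (x - y) * norm (sin (of_real pi * (y + s)) / sin (of_real pi * (x + s))))"
proof -
  obtain C R where CR: "C > 0" "R > 0" "\<And>s. Re s \<ge> 0 \<Longrightarrow> norm s \<ge> R \<Longrightarrow>
     Gamma (1 - y + s) \<noteq> 0 \<and> Gamma (1 - x + s) \<noteq> 0 \<and>
     norm (Gamma (1 - y + s) * rGamma (1 - x + s)) \<le> C * norm s powr Re ((1 - y) - (1 - x))"
    using Gamma_pair_bound_right[of "1 - y" "1 - x"] by blast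
  show ?thesis
  proof (rule exI[of _ C], rule exI[of _ R], intro conjI allI impI CR(1,2))
    fix s :: complex assume s: "Re s \<le> 0" "norm s \<ge> R"
    have B: "Gamma (1 - (y + s)) \<noteq> 0" "Gamma (1 - (x + s)) \<noteq> 0"
      "norm (Gamma (1 - (y + s)) * rGamma (1 - (x + s))) \<le> C * norm s powr Re (x - y)"
      using CR(3)[of "-s"] s by (auto simp: algebra_simps)
    have A: "G * H = X \<Longrightarrow> H \<noteq> 0 \<Longrightarrow> G = X * inverse H" for G H X :: complex by (simp add: field_simps)
    have B': "G * inverse H = X \<Longrightarrow> H \<noteq> 0 \<Longrightarrow> G = X * H" for G H X :: complex by (auto simp: field_simps)
    have "Gamma (x + s) = of_real pi / sin (of_real pi * (x + s)) * rGamma (1 - (x + s))"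
      using A[OF Gamma_reflection_complex[of "x + s"] B(2)] by (simp only: rGamma_inverse_Gamma)
    moreover have "rGamma (y + s) = sin (of_real pi * (y + s)) / of_real pi * Gamma (1 - (y + s))"
      using B'[OF _ B(1)] rGamma_reflection_complex[of "y + s"] by (simp only: rGamma_inverse_Gamma)
    ultimately have "Gamma (x + s) * rGamma (y + s) =
      (Gamma (1 - (y + s)) * rGamma (1 - (x + s))) * (sin (of_real pi * (y + s)) / sin (of_real pi * (x + s)))"
      by simp
    then show "norm (Gamma (x + s) * rGamma (y + s)) \<le>
       C * norm s powr Re (x - y) * norm (sin (of_real pi * (y + s)) / sin (of_real pi * (x + s)))"
      using B(3) by (simp only: norm_mult mult_right_mono norm_ge_zero)
  qed
qed

lemma Gamma_quot_bound_right:
  assumes "length \<alpha> = length \<beta>"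
  shows "\<exists>C R. C > 0 \<and> R > 0 \<and> (\<forall>s. Re s \<ge> 0 \<longrightarrow> norm s \<ge> R \<longrightarrow>
     norm (Gamma_quot \<alpha> \<beta> s) \<le> C * norm s powr Re (sum_list \<alpha> - sum_list \<beta>))"
  using assms
proof (induction \<alpha> \<beta> rule: list_induct2)
  case Nil
  show ?case by (intro exI[of _ 1]) (auto simp: powr_def)
next
  case (Cons x \<alpha> y \<beta>)
  obtain C R where 1: "C > 0" "R > 0" "\<And>s. Re s \<ge> 0 \<Longrightarrow> norm s \<ge> R \<Longrightarrow>
     norm (Gamma_quot \<alpha> \<beta> s) \<le> C * norm s powr Re (sum_list \<alpha> - sum_list \<beta>)"
    using Cons.IH by blast
  obtain C' R' where 2: "C' > 0" "R' > 0" "\<And>s. Re s \<ge> 0 \<Longrightarrow> norm s \<ge> R' \<Longrightarrow>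
     norm (Gamma (x + s) * rGamma (y + s)) \<le> C' * norm s powr Re (x - y)"
    using Gamma_pair_bound_right[of x y] by blast
  show ?case
  proof (rule exI[of _ "C' * C"], rule exI[of _ "R + R'"], intro conjI allI impI)
    fix s :: complex assume s: "Re s \<ge> 0" "norm s \<ge> R + R'"
    have "norm (Gamma_quot (x # \<alpha>) (y # \<beta>) s) \<le>
        (C' * norm s powr Re (x - y)) * (C * norm s powr Re (sum_list \<alpha> - sum_list \<beta>))"
      unfolding Gamma_quot_Cons norm_mult[of "Gamma (x + s) * rGamma (y + s)"]
      by (intro mult_mono 1(3) 2(3)) (use s 1(1,2) 2(1,2) in auto)
    also have "\<dots> = C' * C * norm s powr Re (sum_list (x # \<alpha>) - sum_list (y # \<beta>))"
      by (simp add: powr_add[symmetric] algebra_simps)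
    finally show "norm (Gamma_quot (x # \<alpha>) (y # \<beta>) s) \<le> \<dots>" .
  qed (use 1 2 in auto)
qed

lemma Gamma_quot_bound_left:
  assumes "length \<alpha> = length \<beta>"
  shows "\<exists>C R. C > 0 \<and> R > 0 \<and> (\<forall>s. Re s \<le> 0 \<longrightarrow> norm s \<ge> R \<longrightarrow>
     norm (Gamma_quot \<alpha> \<beta> s) \<le> C * norm s powr Re (sum_list \<alpha> - sum_list \<beta>) * norm (sin_quot \<alpha> \<beta> s))"
  using assms
proof (induction \<alpha> \<beta> rule: list_induct2)
  case Nil
  show ?case by (intro exI[of _ 1]) (auto simp: powr_def)
next
  case (Cons x \<alpha> y \<beta>)
  obtain C R where 1: "C > 0" "R > 0" "\<And>s. Re s \<le> 0 \<Longrightarrow> norm s \<ge> R \<Longrightarrow>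
     norm (Gamma_quot \<alpha> \<beta> s) \<le> C * norm s powr Re (sum_list \<alpha> - sum_list \<beta>) * norm (sin_quot \<alpha> \<beta> s)"
    using Cons.IH by blast
  obtain C' R' where 2: "C' > 0" "R' > 0" "\<And>s. Re s \<le> 0 \<Longrightarrow> norm s \<ge> R' \<Longrightarrow>
     norm (Gamma (x + s) * rGamma (y + s)) \<le>
       C' * norm s powr Re (x - y) * norm (sin (of_real pi * (y + s)) / sin (of_real pi * (x + s)))"
    using Gamma_pair_bound_left[of x y] by blast
  show ?case
  proof (rule exI[of _ "C' * C"], rule exI[of _ "R + R'"], intro conjI allI impI)
    fix s :: complex assume s: "Re s \<le> 0" "norm s \<ge> R + R'"
    have "norm (Gamma_quot (x # \<alpha>) (y # \<beta>) s) \<le>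
        (C' * norm s powr Re (x - y) * norm (sin (of_real pi * (y + s)) / sin (of_real pi * (x + s)))) *
        (C * norm s powr Re (sum_list \<alpha> - sum_list \<beta>) * norm (sin_quot \<alpha> \<beta> s))"
      unfolding Gamma_quot_Cons norm_mult[of "Gamma (x + s) * rGamma (y + s)"]
      by (intro mult_mono 1(3) 2(3)) (use s 1(1,2) 2(1,2) in auto)
    also have "\<dots> = C' * C * (norm s powr Re (x - y) * norm s powr Re (sum_list \<alpha> - sum_list \<beta>)) *
       norm (sin_quot (x # \<alpha>) (y # \<beta>) s)"
      unfolding sin_quot_Cons norm_mult by (simp only: mult_ac)
    also have "\<dots> = C' * C * norm s powr Re (sum_list (x # \<alpha>) - sum_list (y # \<beta>)) *
       norm (sin_quot (x # \<alpha>) (y # \<beta>) s)"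
      by (simp add: powr_add[symmetric] algebra_simps)
    finally show "norm (Gamma_quot (x # \<alpha>) (y # \<beta>) s) \<le> \<dots>" .
  qed (use 1 2 in auto)
qed

lemma norm_sin_le: "norm (sin z) \<le> exp \<bar>Im z\<bar>" for z :: complex
proof -
  have "norm (sin z) = norm (exp (\<i> * z) - exp (- (\<i> * z))) / 2"
    by (simp add: sin_exp_eq norm_divide norm_mult)
  also have "\<dots> \<le> (norm (exp (\<i> * z)) + norm (exp (- (\<i> * z)))) / 2"
    by (intro divide_right_mono norm_triangle_ineq4) auto
  also have "\<dots> = (exp (- Im z) + exp (Im z)) / 2" by simp
  also have "\<dots> \<le> (exp \<bar>Im z\<bar> + exp \<bar>Im z\<bar>) / 2" by (intro divide_right_mono add_mono) auto
  finally show ?thesis by simp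
qed

lemma norm_sin_ge: "norm (sin z) \<ge> (exp \<bar>Im z\<bar> - exp (- \<bar>Im z\<bar>)) / 2" for z :: complex
proof -
  have "norm (sin z) = norm (exp (\<i> * z) - exp (- (\<i> * z))) / 2"
    by (simp add: sin_exp_eq norm_divide norm_mult)
  moreover have "exp \<bar>Im z\<bar> - exp (- \<bar>Im z\<bar>) \<le> norm (exp (\<i> * z) - exp (- (\<i> * z)))"
    using norm_triangle_ineq2[of "exp (\<i> * z)" "exp (- (\<i> * z))"]
      norm_triangle_ineq2[of "exp (- (\<i> * z))" "exp (\<i> * z)"]
    by (cases "Im z \<ge> 0") (auto simp: norm_minus_commute)
  ultimately show ?thesis by simp
qed

text \<open>
  Both sines grow like \<open>exp (\<pi> \<bar>Im s\<bar>)\<close>, so their quotient is bounded as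
  long as \<open>x + s\<close> keeps a distance from the real axis.
\<close>
lemma sin_pair_bound:
  fixes x y s :: complex
  assumes "\<bar>Im s\<bar> \<ge> \<bar>Im x\<bar> + 1"
  shows "norm (sin (of_real pi * (y + s)) / sin (of_real pi * (x + s))) \<le> 4 * exp (pi * \<bar>Im (y - x)\<bar>)"
proof -
  define u where "u = pi * \<bar>Im (x + s)\<bar>"
  have "1 \<le> \<bar>Im (x + s)\<bar>" using assms by auto
  then have u: "u \<ge> pi" by (simp add: u_def)
  then have u1: "u \<ge> 1" using pi_gt3 by linarith
  \<comment> \<open>The lower bound \<open>u \<ge> 1\<close> keeps \<open>exp (-u)\<close> below half of \<open>exp u\<close>.\<close>
  have "exp (2 * u) \<ge> 1 + 2 * u" using exp_ge_add_one_self[of "2 * u"] by simp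
  then have "2 \<le> exp (2 * u)" using u1 by linarith
  then have "2 * exp (- u) \<le> exp (2 * u) * exp (- u)" by (intro mult_right_mono) auto
  also have "\<dots> = exp u" by (simp add: exp_add[symmetric])
  finally have e: "exp u / 4 \<le> (exp u - exp (- u)) / 2" by simp
  have low: "norm (sin (of_real pi * (x + s))) \<ge> exp u / 4"
    using norm_sin_ge[of "of_real pi * (x + s)"] e by (simp add: u_def abs_mult)
  have "norm (sin (of_real pi * (y + s))) \<le> exp (pi * \<bar>Im (y + s)\<bar>)"
    using norm_sin_le[of "of_real pi * (y + s)"] by (simp add: abs_mult)
  also have "\<dots> \<le> exp (pi * \<bar>Im (y - x)\<bar> + u)"
    unfolding u_def distrib_left[symmetric] by (simp add: mult_left_mono)
  finally have up: "norm (sin (of_real pi * (y + s))) \<le> exp (pi * \<bar>Im (y - x)\<bar>) * exp u" by (simp only: exp_add)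
  have "norm (sin (of_real pi * (y + s)) / sin (of_real pi * (x + s))) \<le> exp (pi * \<bar>Im (y - x)\<bar>) * exp u / (exp u / 4)"
    unfolding norm_divide by (intro frac_le up low) auto
  then show ?thesis by simp
qed

lemma sin_quot_bounded_far:
  assumes "length \<alpha> = length \<beta>"
  shows "\<exists>C Y. C > 0 \<and> Y > 0 \<and> (\<forall>s. \<bar>Im s\<bar> \<ge> Y \<longrightarrow> norm (sin_quot \<alpha> \<beta> s) \<le> C)"
  using assms
proof (induction \<alpha> \<beta> rule: list_induct2)
  case Nil
  show ?case by (intro exI[of _ 1]) auto
next
  case (Cons x \<alpha> y \<beta>)
  obtain C Y where 1: "C > 0" "Y > 0" "\<And>s. \<bar>Im s\<bar> \<ge> Y \<Longrightarrow> norm (sin_quot \<alpha> \<beta> s) \<le> C"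
    using Cons.IH by blast
  show ?case
  proof (rule exI[of _ "(4 * exp (pi * \<bar>Im (y - x)\<bar>)) * C"], rule exI[of _ "Y + \<bar>Im x\<bar> + 1"], intro conjI allI impI)
    fix s :: complex assume s: "\<bar>Im s\<bar> \<ge> Y + \<bar>Im x\<bar> + 1"
    show "norm (sin_quot (x # \<alpha>) (y # \<beta>) s) \<le> (4 * exp (pi * \<bar>Im (y - x)\<bar>)) * C"
      unfolding sin_quot_Cons norm_mult[of "sin _ / sin _"]
      by (intro mult_mono 1(3) sin_pair_bound) (use s 1(2) in auto)
  qed (use 1 in auto)
qed

lemma sin_quot_shift:
  assumes "length \<alpha> = length \<beta>"
  shows "norm (sin_quot \<alpha> \<beta> (s - of_nat m)) = norm (sin_quot \<alpha> \<beta> s)"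
proof -
  have *: "norm (sin (of_real pi * (x + (s - of_nat m)))) = norm (sin (of_real pi * (x + s)))" for x s :: complex
  proof (induction m)
    case (Suc m)
    have "of_real pi * (x + (s - of_nat (Suc m))) = of_real pi * (x + (s - of_nat m)) - of_real pi"
      by (simp add: algebra_simps)
    then have "sin (of_real pi * (x + (s - of_nat (Suc m)))) = - sin (of_real pi * (x + (s - of_nat m)))"
      by (simp only: sin_diff) simp
    then show ?case using Suc by (simp only: norm_minus_cancel)
  qed auto
  show ?thesis using assms
    by (induction \<alpha> \<beta> rule: list_induct2) (simp_all add: norm_mult norm_divide *)
qed

lemma Gamma_quot_bound_far:
  assumes "length \<alpha> = length \<beta>"
  shows "\<exists>C R Y. C > 0 \<and> R > 0 \<and> Y > 0 \<and> (\<forall>s. norm s \<ge> R \<longrightarrow> Re s \<ge> 0 \<or> \<bar>Im s\<bar> \<ge> Y \<longrightarrow>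
     norm (Gamma_quot \<alpha> \<beta> s) \<le> C * norm s powr Re (sum_list \<alpha> - sum_list \<beta>))"
proof -
  obtain C R where 1: "C > 0" "R > 0" "\<And>s. Re s \<ge> 0 \<Longrightarrow> norm s \<ge> R \<Longrightarrow>
     norm (Gamma_quot \<alpha> \<beta> s) \<le> C * norm s powr Re (sum_list \<alpha> - sum_list \<beta>)"
    using Gamma_quot_bound_right[OF assms] by blast
  obtain C' R' where 2: "C' > 0" "R' > 0" "\<And>s. Re s \<le> 0 \<Longrightarrow> norm s \<ge> R' \<Longrightarrow>
     norm (Gamma_quot \<alpha> \<beta> s) \<le> C' * norm s powr Re (sum_list \<alpha> - sum_list \<beta>) * norm (sin_quot \<alpha> \<beta> s)"
    using Gamma_quot_bound_left[OF assms] by blast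
  obtain D Y where 3: "D > 0" "Y > 0" "\<And>s. \<bar>Im s\<bar> \<ge> Y \<Longrightarrow> norm (sin_quot \<alpha> \<beta> s) \<le> D"
    using sin_quot_bounded_far[OF assms] by blast
  show ?thesis
  proof (rule exI[of _ "C + C' * D"], rule exI[of _ "R + R'"], rule exI[of _ Y], intro conjI allI impI)
    fix s assume s: "norm s \<ge> R + R'" "Re s \<ge> 0 \<or> \<bar>Im s\<bar> \<ge> Y"
    let ?p = "norm s powr Re (sum_list \<alpha> - sum_list \<beta>)"
    show "norm (Gamma_quot \<alpha> \<beta> s) \<le> (C + C' * D) * ?p"
    proof (cases "Re s \<ge> 0")
      case True
      have "norm (Gamma_quot \<alpha> \<beta> s) \<le> C * ?p" using 1(3)[OF True] s(1) 2(2) by simp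
      also have "\<dots> \<le> (C + C' * D) * ?p" using 2(1) 3(1) by (intro mult_right_mono) auto
      finally show ?thesis .
    next
      case False
      have "norm (Gamma_quot \<alpha> \<beta> s) \<le> C' * ?p * norm (sin_quot \<alpha> \<beta> s)" using 2(3)[of s] False s(1) 1(2) by simp
      also have "\<dots> \<le> C' * ?p * D" using False s(2) 2(1) by (intro mult_left_mono 3(3)) auto
      also have "\<dots> = (C' * D) * ?p" by simp
      also have "\<dots> \<le> (C + C' * D) * ?p" using 1(1) by (intro mult_right_mono) auto
      finally show ?thesis .
    qed
  qed (use 1(1,2) 2(1,2) 3(1,2) in \<open>auto simp: add_pos_pos\<close>)
qed

text \<open>
  Powers with a fixed exponent of either sign do not distinguish quantities that agree up to a
  factor of two.
\<close>
lemma powr_comparable: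
  fixes x y D :: real
  assumes "0 < x" "x \<le> 2 * y" "y \<le> 2 * x"
  shows "x powr D \<le> 2 powr \<bar>D\<bar> * y powr D"
proof -
  have "ln x \<le> ln (2 * y)" "ln y \<le> ln (2 * x)" using assms by simp_all
  then have l: "\<bar>ln x - ln y\<bar> \<le> ln 2" using assms by (simp add: ln_mult)
  have "D * (ln x - ln y) \<le> \<bar>D\<bar> * \<bar>ln x - ln y\<bar>" by (metis abs_ge_self abs_mult)
  also have "\<dots> \<le> \<bar>D\<bar> * ln 2" by (intro mult_left_mono l) auto
  finally have "exp (D * ln x) \<le> exp (\<bar>D\<bar> * ln 2 + D * ln y)" by (simp add: algebra_simps)
  then show ?thesis using assms by (simp add: powr_def exp_add)
qed

text \<open>
  Bounds that come closer to the poles: \<open>K\<close> may be a horizontal segment of length one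
  or a vertical segment. Its translates by \<open>-m\<close> then cover a left-going ray, or give a
  sequence of vertical segments going left between the poles. The quotient of sines has period one
  up to sign, so its bound on \<open>K\<close> holds on all translates.
\<close>
lemma Gamma_quot_bound_left_compact:
  assumes len: "length \<alpha> = length \<beta>" and K: "compact K"
    and avoid: "\<And>s x. s \<in> K \<Longrightarrow> x \<in> set \<alpha> \<Longrightarrow> x + s \<notin> \<int>"
  shows "\<exists>C M. C > 0 \<and> (\<forall>s\<in>K. \<forall>m\<ge>M. m > 0 \<and> norm (Gamma_quot \<alpha> \<beta> (s - of_nat m)) \<le>
           C * real m powr Re (sum_list \<alpha> - sum_list \<beta>))"
proof -
  obtain C R where 2: "C > 0" "R > 0" "\<And>s. Re s \<le> 0 \<Longrightarrow> norm s \<ge> R \<Longrightarrow>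
     norm (Gamma_quot \<alpha> \<beta> s) \<le> C * norm s powr Re (sum_list \<alpha> - sum_list \<beta>) * norm (sin_quot \<alpha> \<beta> s)"
    using Gamma_quot_bound_left[OF len] by blast
  have prod_cont: "continuous_on K (\<lambda>s. \<Prod>x\<leftarrow>xs. sin (of_real pi * (x + s)))" for xs :: "complex list"
    by (induction xs) (auto intro!: continuous_intros)
  have "sin (of_real pi * (x + s)) \<noteq> 0" if "s \<in> K" "x \<in> set \<alpha>" for x s
  proof
    assume "sin (of_real pi * (x + s)) = 0"
    then obtain m :: int where "of_real pi * (x + s) = of_real (of_int m * pi)" unfolding Complex_Transcendental.sin_eq_0 by auto
    then have "of_real pi * (x + s) = of_real pi * of_int m" by (simp add: mult.commute)
    then have "x + s = of_int m" by (subst (asm) mult_cancel_left) simp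
    with avoid[OF that] show False by (metis Ints_of_int)
  qed
  then have nz: "(\<Prod>x\<leftarrow>\<alpha>. sin (of_real pi * (x + s))) \<noteq> 0" if "s \<in> K" for s
    using that by (auto simp: prod_list_zero_iff)
  have "continuous_on K (\<lambda>s. sin_quot \<alpha> \<beta> s)"
    unfolding sin_quot_def by (intro continuous_on_divide prod_cont ballI nz)
  then have "bounded (sin_quot \<alpha> \<beta> ` K)" using K compact_continuous_image compact_imp_bounded by blast
  then obtain D where D: "D > 0" "\<And>s. s \<in> K \<Longrightarrow> norm (sin_quot \<alpha> \<beta> s) \<le> D"
    unfolding bounded_pos by auto
  obtain B where B: "B > 0" "\<And>s. s \<in> K \<Longrightarrow> norm s \<le> B"
    using compact_imp_bounded[OF K] unfolding bounded_pos by blast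
  define E where "E = Re (sum_list \<alpha> - sum_list \<beta>)"
  obtain M where M: "real M \<ge> 2 * B + 2 * R" using real_arch_simple by blast
  show ?thesis
  proof (rule exI[of _ "C * 2 powr \<bar>E\<bar> * D"], rule exI[of _ M], intro conjI ballI allI impI)
    fix s m assume s: "s \<in> K" and m: "m \<ge> M"
    have mr: "real m \<ge> 2 * B + 2 * R" using M m by linarith
    then show "m > 0" using B(1) 2(2) by (cases m) auto
    have n1: "norm (s - of_nat m) \<le> norm s + real m" using norm_triangle_ineq4[of s "of_nat m"] by simp
    have n2: "norm (s - of_nat m) \<ge> real m - norm s" using norm_triangle_ineq2[of "of_nat m" s] by (simp add: norm_minus_commute)
    have r: "Re s \<le> norm s" by (rule complex_Re_le_cmod)
    have "norm (Gamma_quot \<alpha> \<beta> (s - of_nat m)) \<le> C * norm (s - of_nat m) powr E * norm (sin_quot \<alpha> \<beta> (s - of_nat m))"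
      unfolding E_def by (rule 2(3)) (use mr n2 r B(2)[OF s] B(1) 2(2) in auto)
    also have "norm (sin_quot \<alpha> \<beta> (s - of_nat m)) \<le> D" using D(2)[OF s] sin_quot_shift[OF len] by simp
    also have "norm (s - of_nat m) powr E \<le> 2 powr \<bar>E\<bar> * real m powr E"
      by (rule powr_comparable) (use mr n1 n2 B(2)[OF s] B(1) 2(2) in linarith)+
    finally show "norm (Gamma_quot \<alpha> \<beta> (s - of_nat m)) \<le>
        C * 2 powr \<bar>E\<bar> * D * real m powr Re (sum_list \<alpha> - sum_list \<beta>)"
      unfolding E_def[symmetric]
      using 2(1) D(1) by (simp add: mult_left_mono mult_right_mono mult_ac)
  qed (use 2 D in auto)
qed

section \<open>Integrals along left loops\<close>

lemma contour_integral_horizontal: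
  assumes "x1 \<le> x2" and "continuous_on {x1..x2} (\<lambda>x. f (Complex x y))"
  shows "contour_integral (linepath (Complex x1 y) (Complex x2 y)) f = (LINT x:{x1..x2}|lborel. f (Complex x y))"
proof (cases "x1 = x2")
  case True
  then show ?thesis
    using set_borel_integral_eq_integral(2)[OF borel_integrable_atLeastAtMost'[OF assms(2)]] by simp
next
  case False
  with assms have less: "x1 < x2" by simp
  let ?I = "LINT x:{x1..x2}|lborel. f (Complex x y)"
  have int: "set_integrable lborel {x1..x2} (\<lambda>x. f (Complex x y))"
    by (rule borel_integrable_atLeastAtMost') (rule assms)
  have "((\<lambda>x. f (Complex x y)) has_integral ?I) {x1..x2}"
    using set_borel_integral_eq_integral[OF int] by (simp add: has_integral_integral)
  then have "((\<lambda>x. (\<lambda>z. f (z + \<i> * of_real y)) (of_real x)) has_integral ?I) {Re (of_real x1)..Re (of_real x2)}"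
    by (simp add: Complex_eq)
  then have "((\<lambda>z. f (z + \<i> * of_real y)) has_contour_integral ?I) (linepath (of_real x1) (of_real x2))"
    by (subst has_contour_integral_linepath_Reals_iff) (use less in auto)
  then have "(f has_contour_integral ?I) (linepath (Complex x1 y) (Complex x2 y))"
    unfolding has_contour_integral_linepath
    by (rule has_integral_eq[rotated]) (auto simp: linepath_def Complex_eq scaleR_conv_of_real algebra_simps intro!: arg_cong[of _ _ f])
  then show ?thesis by (rule contour_integral_unique)
qed

lemma contour_integral_vertical:
  assumes "y1 < y2" and "continuous_on {y1..y2} (\<lambda>y. f (Complex x y))"
  shows "contour_integral (linepath (Complex x y1) (Complex x y2)) f = \<i> * (LINT y:{y1..y2}|lborel. f (Complex x y))"
proof -
  let ?I = "LINT y:{y1..y2}|lborel. f (Complex x y)"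
  have int: "set_integrable lborel {y1..y2} (\<lambda>y. f (Complex x y))"
    by (rule borel_integrable_atLeastAtMost') (rule assms)
  have "((\<lambda>y. f (Complex x y)) has_integral ?I) {y1..y2}"
    using set_borel_integral_eq_integral[OF int] by (simp add: has_integral_integral)
  then have "(f has_contour_integral (\<i> * ?I)) (linepath (Complex x y1) (Complex x y2))"
    by (subst has_contour_integral_linepath_same_Re_iff[of _ x _ y1 y2]) (use assms(1) in auto)
  then show ?thesis by (rule contour_integral_unique)
qed

lemma path_image_loop_part:
  "path_image (loop_part \<gamma> X) =
     closed_segment (Complex X (Im (pathstart \<gamma>))) (pathstart \<gamma>) \<union> path_image \<gamma> \<union>
     closed_segment (pathfinish \<gamma>) (Complex X (Im (pathfinish \<gamma>)))"
  unfolding loop_part_def by (simp add: path_image_join Un_assoc)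

lemma valid_path_loop_part [simp]: "valid_path \<gamma> \<Longrightarrow> valid_path (loop_part \<gamma> X)"
  unfolding loop_part_def by (intro valid_path_join) auto

lemma pathstart_loop_part [simp]: "pathstart (loop_part \<gamma> X) = Complex X (Im (pathstart \<gamma>))"
  and pathfinish_loop_part [simp]: "pathfinish (loop_part \<gamma> X) = Complex X (Im (pathfinish \<gamma>))"
  unfolding loop_part_def by simp_all

lemma path_image_closed_loop_part:
  "path_image (closed_loop_part \<gamma> X) =
     path_image (loop_part \<gamma> X) \<union> closed_segment (Complex X (Im (pathfinish \<gamma>))) (Complex X (Im (pathstart \<gamma>)))"
  unfolding closed_loop_part_def by (simp add: path_image_join)

lemma valid_path_closed_loop_part [simp]: "valid_path \<gamma> \<Longrightarrow> valid_path (closed_loop_part \<gamma> X)"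
  unfolding closed_loop_part_def by (intro valid_path_join) auto

lemma pathstart_closed_loop_part [simp]: "pathstart (closed_loop_part \<gamma> X) = Complex X (Im (pathstart \<gamma>))"
  and pathfinish_closed_loop_part [simp]: "pathfinish (closed_loop_part \<gamma> X) = Complex X (Im (pathstart \<gamma>))"
  unfolding closed_loop_part_def by simp_all

lemma contour_integral_loop_part:
  assumes "valid_path \<gamma>" "open S" "f holomorphic_on S" "path_image (loop_part \<gamma> X) \<subseteq> S"
  shows "contour_integral (loop_part \<gamma> X) f =
      contour_integral (linepath (Complex X (Im (pathstart \<gamma>))) (pathstart \<gamma>)) f + contour_integral \<gamma> f +
      contour_integral (linepath (pathfinish \<gamma>) (Complex X (Im (pathfinish \<gamma>)))) f"
proof -
  have I: "f contour_integrable_on g" if "valid_path g" "path_image g \<subseteq> S" for g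
    using that assms(2,3) by (intro contour_integrable_holomorphic_simple)
  show ?thesis using assms(1,4) unfolding loop_part_def path_image_loop_part[unfolded loop_part_def]
    by (simp add: I)
qed

lemma contour_integral_closed_loop_part:
  assumes "valid_path \<gamma>" "open S" "f holomorphic_on S" "path_image (closed_loop_part \<gamma> X) \<subseteq> S"
  shows "contour_integral (closed_loop_part \<gamma> X) f =
      contour_integral (loop_part \<gamma> X) f +
      contour_integral (linepath (Complex X (Im (pathfinish \<gamma>))) (Complex X (Im (pathstart \<gamma>)))) f"
proof -
  have I: "f contour_integrable_on g" if "valid_path g" "path_image g \<subseteq> S" for g
    using that assms(2,3) by (intro contour_integrable_holomorphic_simple)
  show ?thesis using assms(1,4) unfolding closed_loop_part_def path_image_closed_loop_part[unfolded closed_loop_part_def]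
    by (subst contour_integral_join) (auto intro!: I)
qed

lemma segment_to_left:
  "X \<le> Re z \<Longrightarrow> closed_segment (Complex X (Im z)) z = {w. Im w = Im z \<and> X \<le> Re w \<and> Re w \<le> Re z}"
  by (subst closed_segment_same_Im) (auto simp: closed_segment_eq_real_ivl)

lemma path_image_loop_part_mono:
  assumes "X' \<le> X" "X \<le> Re (pathstart \<gamma>)" "X \<le> Re (pathfinish \<gamma>)"
  shows "path_image (loop_part \<gamma> X) \<subseteq> path_image (loop_part \<gamma> X')"
proof -
  have c: "closed_segment (pathfinish \<gamma>) w = closed_segment w (pathfinish \<gamma>)" for w
    by (rule closed_segment_commute)
  show ?thesis unfolding path_image_loop_part c using assms by (auto simp: segment_to_left)
qed

text \<open>
  The two closed paths differ by a rectangle inside the half-plane \<open>Re s \<le> X\<close>,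
  where Cauchy's theorem applies.
\<close>
lemma contour_integral_closed_loop_part_extend:
  assumes v: "valid_path \<gamma>" and S: "open S" "f holomorphic_on S"
    and sub: "path_image (closed_loop_part \<gamma> X') \<subseteq> S" "{s. Re s \<le> X} \<subseteq> S"
    and X: "X' \<le> X" "X \<le> Re (pathstart \<gamma>)" "X \<le> Re (pathfinish \<gamma>)"
  shows "contour_integral (closed_loop_part \<gamma> X') f = contour_integral (closed_loop_part \<gamma> X) f"
proof -
  define y0 y1 where "y0 = Im (pathstart \<gamma>)" and "y1 = Im (pathfinish \<gamma>)"
  let ?ci = "\<lambda>a b. contour_integral (linepath a b) f"
  have cont: "continuous_on A f" if "A \<subseteq> S" for A
    using that S holomorphic_on_imp_continuous_on holomorphic_on_subset by blast
  have sub': "path_image (loop_part \<gamma> X') \<subseteq> S" using sub(1) by (simp add: path_image_closed_loop_part)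
  have half: "closed_segment a b \<subseteq> S" if "Re a \<le> X" "Re b \<le> X" for a b
  proof -
    have "closed_segment a b \<subseteq> {s. Re s \<le> X}"
      by (rule closed_segment_subset) (use that in \<open>auto simp: convex_halfspace_Re_le\<close>)
    with sub(2) show ?thesis by blast
  qed
  have subX: "path_image (loop_part \<gamma> X) \<subseteq> S"
    using path_image_loop_part_mono[OF X] sub' by blast
  have subXc: "path_image (closed_loop_part \<gamma> X) \<subseteq> S"
    unfolding path_image_closed_loop_part using subX half[of "Complex X (Im (pathfinish \<gamma>))" "Complex X (Im (pathstart \<gamma>))"] by simp
  have s0: "closed_segment (Complex X' y0) (pathstart \<gamma>) \<subseteq> S" "closed_segment (pathfinish \<gamma>) (Complex X' y1) \<subseteq> S"
    using sub' by (auto simp: path_image_loop_part y0_def y1_def)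
  have sp0: "?ci (Complex X' y0) (pathstart \<gamma>) = ?ci (Complex X' y0) (Complex X y0) + ?ci (Complex X y0) (pathstart \<gamma>)"
    by (rule contour_integral_split_linepath)
       (use X s0 in \<open>auto intro!: cont simp: y0_def segment_to_left\<close>)
  have sp1: "?ci (pathfinish \<gamma>) (Complex X' y1) = ?ci (pathfinish \<gamma>) (Complex X y1) + ?ci (Complex X y1) (Complex X' y1)"
    by (rule contour_integral_split_linepath)
       (use X s0 in \<open>auto intro!: cont simp: y1_def segment_to_left closed_segment_commute[of "pathfinish \<gamma>"]\<close>)
  have half': "closed_segment a b \<subseteq> {s. Re s \<le> X}" if "Re a \<le> X" "Re b \<le> X" for a b
    by (rule closed_segment_subset) (use that in \<open>auto simp: convex_halfspace_Re_le\<close>)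
  have "(f has_contour_integral 0) (linepath (Complex X' y0) (Complex X y0) +++ linepath (Complex X y0) (Complex X y1) +++
      linepath (Complex X y1) (Complex X' y1) +++ linepath (Complex X' y1) (Complex X' y0))"
  proof (rule Cauchy_theorem_convex_simple[of f "{s. Re s \<le> X}"])
    show "f holomorphic_on {s. Re s \<le> X}" by (rule holomorphic_on_subset[OF S(2) sub(2)])
  qed (use X(1) in \<open>auto simp: convex_halfspace_Re_le path_image_join half' simp del: mem_Collect_eq intro!: subsetD[OF half']\<close>)
  then have "contour_integral (linepath (Complex X' y0) (Complex X y0) +++ linepath (Complex X y0) (Complex X y1) +++
      linepath (Complex X y1) (Complex X' y1) +++ linepath (Complex X' y1) (Complex X' y0)) f = 0"
    by (rule contour_integral_unique)
  moreover have "f contour_integrable_on linepath a b" if "Re a \<le> X" "Re b \<le> X" for a b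
    by (intro contour_integrable_continuous_linepath cont half that)
  ultimately have rect: "?ci (Complex X' y0) (Complex X y0) + ?ci (Complex X y0) (Complex X y1) +
      ?ci (Complex X y1) (Complex X' y1) + ?ci (Complex X' y1) (Complex X' y0) = 0"
    using X(1) by (simp add: add_ac)
  have rev: "?ci (Complex X y1) (Complex X y0) = - ?ci (Complex X y0) (Complex X y1)"
    by (intro contour_integral_reverse_linepath cont half) auto
  show ?thesis
    unfolding contour_integral_closed_loop_part[OF v S sub(1)] contour_integral_closed_loop_part[OF v S subXc]
      contour_integral_loop_part[OF v S sub'] contour_integral_loop_part[OF v S subX]
      y0_def[symmetric] y1_def[symmetric] sp0 sp1 rev
    using rect by (simp add: algebra_simps)
qed

text \<open>
  Moving the closing segment further left does not change the index of a point on its right. Hence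
  the conditions in the definition of a left loop, which hold for all sufficiently negative
  \<open>X\<close> depending on the point, may be used for one \<open>X\<close> and all points at
  once.
\<close>
lemma winding_number_closed_loop_part_extend:
  assumes v: "valid_path \<gamma>" and w: "w \<notin> path_image (closed_loop_part \<gamma> X')" "X < Re w"
    and X: "X' \<le> X" "X \<le> Re (pathstart \<gamma>)" "X \<le> Re (pathfinish \<gamma>)"
  shows "w \<notin> path_image (closed_loop_part \<gamma> X)"
    and "winding_number (closed_loop_part \<gamma> X) w = winding_number (closed_loop_part \<gamma> X') w"
proof -
  show n: "w \<notin> path_image (closed_loop_part \<gamma> X)"
    using w path_image_loop_part_mono[OF X] by (auto simp: path_image_closed_loop_part closed_segment_same_Re)
  have "contour_integral (closed_loop_part \<gamma> X') (\<lambda>s. 1 / (s - w)) = contour_integral (closed_loop_part \<gamma> X) (\<lambda>s. 1 / (s - w))"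
    by (rule contour_integral_closed_loop_part_extend[OF v, of "- {w}"])
       (use w X in \<open>auto intro!: holomorphic_intros\<close>)
  then show "winding_number (closed_loop_part \<gamma> X) w = winding_number (closed_loop_part \<gamma> X') w"
    using n w(1) v by (simp add: winding_number_valid_path)
qed

lemma left_loop_right_of:
  assumes L: "left_loop \<gamma> P Q" and X: "X \<le> Re (pathstart \<gamma>)" "X \<le> Re (pathfinish \<gamma>)"
  shows "w \<in> P \<union> Q \<Longrightarrow> w \<notin> path_image (loop_part \<gamma> X)"
    and "w \<in> P \<Longrightarrow> X < Re w \<Longrightarrow> winding_number (closed_loop_part \<gamma> X) w = 1"
    and "w \<in> Q \<Longrightarrow> X < Re w \<Longrightarrow> winding_number (closed_loop_part \<gamma> X) w = 0"
proof -
  have v: "valid_path \<gamma>" using L by (simp add: left_loop_def)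
  have evP: "\<exists>X'\<le>X. w \<notin> path_image (closed_loop_part \<gamma> X') \<and> winding_number (closed_loop_part \<gamma> X') w = 1" if "w \<in> P" for w
  proof -
    from L that have "\<forall>\<^sub>F X' in at_bot. w \<notin> path_image (closed_loop_part \<gamma> X') \<and> winding_number (closed_loop_part \<gamma> X') w = 1"
      by (simp add: left_loop_def)
    from eventually_conj[OF this eventually_le_at_bot[of X]] show ?thesis
      using eventually_happens' trivial_limit_at_bot_linorder by blast
  qed
  have evQ: "\<exists>X'\<le>X. w \<notin> path_image (closed_loop_part \<gamma> X') \<and> winding_number (closed_loop_part \<gamma> X') w = 0" if "w \<in> Q" for w
  proof -
    from L that have "\<forall>\<^sub>F X' in at_bot. w \<notin> path_image (closed_loop_part \<gamma> X') \<and> winding_number (closed_loop_part \<gamma> X') w = 0"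
      by (simp add: left_loop_def)
    from eventually_conj[OF this eventually_le_at_bot[of X]] show ?thesis
      using eventually_happens' trivial_limit_at_bot_linorder by blast
  qed
  show "w \<notin> path_image (loop_part \<gamma> X)" if "w \<in> P \<union> Q"
    using evP[of w] evQ[of w] that path_image_loop_part_mono[OF _ X] by (auto simp: path_image_closed_loop_part)
  show "winding_number (closed_loop_part \<gamma> X) w = 1" if "w \<in> P" "X < Re w"
    using evP[OF that(1)] winding_number_closed_loop_part_extend(2)[OF v _ that(2) _ X] by metis
  show "winding_number (closed_loop_part \<gamma> X) w = 0" if "w \<in> Q" "X < Re w"
    using evQ[OF that(1)] winding_number_closed_loop_part_extend(2)[OF v _ that(2) _ X] by metis
qed

lemma closed_locally_finite:
  fixes Z :: "'a::real_normed_vector set"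
  assumes "\<And>r. finite (Z \<inter> cball 0 r)" "A \<subseteq> Z"
  shows "closed A"
proof -
  have "\<not> x islimpt A" for x
  proof
    assume "x islimpt A"
    then have "infinite (A \<inter> ball x 1)" by (simp add: islimpt_eq_infinite_ball)
    moreover have "A \<inter> ball x 1 \<subseteq> Z \<inter> cball 0 (norm x + 1)"
    proof
      fix y assume "y \<in> A \<inter> ball x 1"
      then show "y \<in> Z \<inter> cball 0 (norm x + 1)"
        using assms(2) norm_triangle_ineq2[of y x] by (auto simp: dist_norm norm_minus_commute)
    qed
    ultimately show False using assms(1) finite_subset by blast
  qed
  then show ?thesis by (simp add: closed_limpt)
qed

lemma countable_locally_finite:
  fixes Z :: "'a::real_normed_vector set"
  assumes "\<And>r. finite (Z \<inter> cball 0 r)"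
  shows "countable Z"
proof -
  have "Z \<subseteq> (\<Union>n::nat. Z \<inter> cball 0 (real n))"
  proof
    fix z assume "z \<in> Z"
    moreover obtain n where "norm z \<le> real n" using real_arch_simple by blast
    ultimately show "z \<in> (\<Union>n::nat. Z \<inter> cball 0 (real n))" by (intro UN_I[of n]) auto
  qed
  moreover have "countable (\<Union>n::nat. Z \<inter> cball 0 (real n))"
    by (rule countable_UN) (auto intro: countable_finite assms)
  ultimately show ?thesis by (rule countable_subset)
qed

text \<open>
  The residue theorem in a disc so large that it contains the path and all points of index one; it
  meets the discrete singular set in finitely many points. Points left of the closing segment have
  index zero since the path stays in a half-plane.
\<close>
lemma contour_integral_closed_loop_part_residues:
  assumes L: "left_loop \<gamma> P Q" and lf: "\<And>r. finite ((P \<union> Q) \<inter> cball 0 r)"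
    and F: "F holomorphic_on - (P \<union> Q)"
    and finP: "finite {w \<in> P. X < Re w}"
    and left: "\<And>s. s \<in> path_image \<gamma> \<Longrightarrow> X \<le> Re s"
    and vert: "\<And>y. Complex X y \<notin> P \<union> Q"
  shows "contour_integral (closed_loop_part \<gamma> X) F = 2 * pi * \<i> * (\<Sum>w\<in>{w \<in> P. X < Re w}. residue F w)"
proof -
  have v: "valid_path \<gamma>" using L by (simp add: left_loop_def)
  have X: "X \<le> Re (pathstart \<gamma>)" "X \<le> Re (pathfinish \<gamma>)" using left by auto
  let ?c = "closed_loop_part \<gamma> X"
  have "bounded (path_image ?c \<union> {w \<in> P. X < Re w})"
    using v finP by (simp add: bounded_path_image valid_path_imp_path finite_imp_bounded)
  then obtain r where r: "path_image ?c \<union> {w \<in> P. X < Re w} \<subseteq> ball 0 r"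
    using bounded_subset_ballD by blast
  define pts where "pts = (P \<union> Q) \<inter> ball 0 r"
  have fin: "finite pts" unfolding pts_def by (rule finite_subset[OF _ lf[of r]]) auto
  have avoid: "w \<notin> path_image ?c" if "w \<in> P \<union> Q" for w
  proof -
    have "w \<notin> path_image (loop_part \<gamma> X)" by (rule left_loop_right_of(1)[OF L X that])
    moreover have "w \<noteq> Complex X y" for y using vert[of y] that by metis
    then have "Re w \<noteq> X" by (metis complex.exhaust_sel)
    ultimately show ?thesis by (auto simp: path_image_closed_loop_part closed_segment_same_Re)
  qed
  have half: "path_image ?c \<subseteq> {s. X \<le> Re s}"
    using left X by (auto simp: path_image_closed_loop_part path_image_loop_part segment_to_left closed_segment_same_Re
         closed_segment_commute[of "pathfinish \<gamma>"])
  have "contour_integral ?c F = 2 * pi * \<i> * (\<Sum>p\<in>pts. winding_number ?c p * residue F p)"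
  proof (rule Residue_theorem[of "ball 0 r"])
    show "F holomorphic_on ball 0 r - pts"
      by (rule holomorphic_on_subset[OF F]) (auto simp: pts_def)
    show "path_image ?c \<subseteq> ball 0 r - pts" using r avoid by (auto simp: pts_def)
    show "\<forall>z. z \<notin> ball 0 r \<longrightarrow> winding_number ?c z = 0"
      using r v by (auto intro!: winding_number_zero_outside[of _ "ball 0 r"] simp: valid_path_imp_path)
  qed (use fin v in auto)
  also have "(\<Sum>p\<in>pts. winding_number ?c p * residue F p) = (\<Sum>w\<in>{w \<in> P. X < Re w}. residue F w)"
  proof (rule sum.mono_neutral_cong_right[OF fin])
    show "{w \<in> P. X < Re w} \<subseteq> pts" using r by (auto simp: pts_def)
    show "\<forall>i\<in>pts - {w \<in> P. X < Re w}. winding_number ?c i * residue F i = 0"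
    proof
      fix i assume i: "i \<in> pts - {w \<in> P. X < Re w}"
      have "winding_number ?c i = 0"
      proof (cases "X < Re i")
        case True
        then show ?thesis using i left_loop_right_of(3)[OF L X] by (auto simp: pts_def)
      next
        case False
        have "i \<noteq> Complex X y" for y using vert[of y] i by (auto simp: pts_def)
        then have "Re i \<noteq> X" by (metis complex.exhaust_sel)
        then have "i \<notin> {s. X \<le> Re s}" using False by auto
        then show ?thesis
          by (intro winding_number_zero_outside[of _ "{s. X \<le> Re s}"])
             (use half v in \<open>auto simp: valid_path_imp_path convex_halfspace_Re_ge\<close>)
      qed
      then show "winding_number ?c i * residue F i = 0" by simp
    qed
  qed (use left_loop_right_of(2)[OF L X] in auto)
  finally show ?thesis .
qed

text \<open>
  What is needed of an integrand with singular set \<open>Z\<close> for its integral over a left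
  loop to exist and to be a limit of sums of residues: it is integrable on left-going horizontal
  rays off \<open>Z\<close>, and there are vertical lines going off to the left, between the points
  of \<open>Z\<close>, on whose segments of bounded height the integral tends to zero.
\<close>
definition loop_decaying :: "(complex \<Rightarrow> complex) \<Rightarrow> complex set \<Rightarrow> bool" where
  "loop_decaying F Z \<longleftrightarrow>
     F holomorphic_on - Z \<and>
     (\<forall>y x0. (\<forall>x\<le>x0. Complex x y \<notin> Z) \<longrightarrow> set_integrable lborel {..x0} (\<lambda>x. F (Complex x y))) \<and>
     (\<exists>\<xi>. filterlim \<xi> at_bot sequentially \<and> (\<forall>m y. Complex (\<xi> m) y \<notin> Z) \<and>
        (\<forall>y0 y1. (\<lambda>m. contour_integral (linepath (Complex (\<xi> m) y0) (Complex (\<xi> m) y1)) F) \<longlonglongrightarrow> 0))"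

lemma contour_integral_ray_tendsto:
  assumes "set_integrable lborel {..x0} (\<lambda>x. F (Complex x y))"
    and "continuous_on {..x0} (\<lambda>x. F (Complex x y))"
  shows "((\<lambda>X. contour_integral (linepath (Complex X y) (Complex x0 y)) F) \<longlongrightarrow>
            (LINT x:{..x0}|lborel. F (Complex x y))) at_bot"
proof (rule Lim_transform_eventually)
  show "((\<lambda>X. LINT x:{X..x0}|lborel. F (Complex x y)) \<longlongrightarrow> (LINT x:{..x0}|lborel. F (Complex x y))) at_bot"
    by (rule tendsto_set_lebesgue_integral_at_bot) (use assms(1) in auto)
  show "\<forall>\<^sub>F X in at_bot. (LINT x:{X..x0}|lborel. F (Complex x y)) =
      contour_integral (linepath (Complex X y) (Complex x0 y)) F"
    using eventually_le_at_bot[of x0]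
    by eventually_elim
       (auto intro!: contour_integral_horizontal[symmetric] continuous_on_subset[OF assms(2)])
qed

lemma continuous_on_horizontal:
  assumes "F holomorphic_on S" "\<And>x. x \<in> A \<Longrightarrow> Complex x y \<in> S"
  shows "continuous_on A (\<lambda>x. F (Complex x y))"
proof -
  have "continuous_on A (\<lambda>x. F (of_real x + \<i> * of_real y))"
    by (rule continuous_on_compose2[OF holomorphic_on_imp_continuous_on[OF assms(1)]])
       (use assms(2) in \<open>auto intro!: continuous_intros simp: Complex_eq[symmetric]\<close>)
  then show ?thesis by (simp add: Complex_eq)
qed

lemma continuous_on_vertical:
  assumes "F holomorphic_on S" "\<And>y. y \<in> A \<Longrightarrow> Complex x y \<in> S"
  shows "continuous_on A (\<lambda>y. F (Complex x y))"
proof -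
  have "continuous_on A (\<lambda>y. F (of_real x + \<i> * of_real y))"
    by (rule continuous_on_compose2[OF holomorphic_on_imp_continuous_on[OF assms(1)]])
       (use assms(2) in \<open>auto intro!: continuous_intros simp: Complex_eq[symmetric]\<close>)
  then show ?thesis by (simp add: Complex_eq)
qed

lemma left_loop_bounded_left:
  assumes "left_loop \<gamma> P Q"
  shows "\<exists>X. \<forall>s\<in>path_image \<gamma>. X \<le> Re s"
proof -
  have "bounded (path_image \<gamma>)" using assms by (simp add: left_loop_def bounded_path_image valid_path_imp_path)
  then obtain B where "\<And>s. s \<in> path_image \<gamma> \<Longrightarrow> norm s \<le> B" by (auto simp: bounded_iff)
  then have "\<forall>s\<in>path_image \<gamma>. - B \<le> Re s" by (metis abs_Re_le_cmod abs_le_D2 minus_le_iff order_trans)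
  then show ?thesis by blast
qed

lemma loop_part_tendsto:
  assumes L: "left_loop \<gamma> P Q" and cl: "closed (P \<union> Q)" and D: "loop_decaying F (P \<union> Q)"
  shows "((\<lambda>X. contour_integral (loop_part \<gamma> X) F) \<longlongrightarrow>
           (LINT x:{..Re (pathstart \<gamma>)}|lborel. F (Complex x (Im (pathstart \<gamma>)))) + contour_integral \<gamma> F -
           (LINT x:{..Re (pathfinish \<gamma>)}|lborel. F (Complex x (Im (pathfinish \<gamma>))))) at_bot"
    (is "(_ \<longlongrightarrow> ?L) at_bot")
    and "loop_integral \<gamma> F =
           (LINT x:{..Re (pathstart \<gamma>)}|lborel. F (Complex x (Im (pathstart \<gamma>)))) + contour_integral \<gamma> F -
           (LINT x:{..Re (pathfinish \<gamma>)}|lborel. F (Complex x (Im (pathfinish \<gamma>))))"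
proof -
  have v: "valid_path \<gamma>" using L by (simp add: left_loop_def)
  define X0 where "X0 = min (Re (pathstart \<gamma>)) (Re (pathfinish \<gamma>))"
  have hol: "F holomorphic_on - (P \<union> Q)" using D by (simp add: loop_decaying_def)
  have avoid: "w \<notin> path_image (loop_part \<gamma> X)" if "w \<in> P \<union> Q" "X \<le> X0" for w X
    by (rule left_loop_right_of(1)[OF L _ _ that(1)]) (use that(2) in \<open>auto simp: X0_def\<close>)
  have ray0: "Complex x (Im (pathstart \<gamma>)) \<notin> P \<union> Q" if "x \<le> Re (pathstart \<gamma>)" for x
    using avoid[of "Complex x (Im (pathstart \<gamma>))" "min x X0"] that
    by (auto simp: path_image_loop_part segment_to_left X0_def min_le_iff_disj)
  have ray1: "Complex x (Im (pathfinish \<gamma>)) \<notin> P \<union> Q" if "x \<le> Re (pathfinish \<gamma>)" for x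
    using avoid[of "Complex x (Im (pathfinish \<gamma>))" "min x X0"] that
    by (auto simp: path_image_loop_part segment_to_left X0_def min_le_iff_disj closed_segment_commute[of "pathfinish \<gamma>"])
  have c0: "continuous_on {..Re (pathstart \<gamma>)} (\<lambda>x. F (Complex x (Im (pathstart \<gamma>))))"
    by (rule continuous_on_horizontal[OF hol]) (use ray0 in auto)
  have c1: "continuous_on {..Re (pathfinish \<gamma>)} (\<lambda>x. F (Complex x (Im (pathfinish \<gamma>))))"
    by (rule continuous_on_horizontal[OF hol]) (use ray1 in auto)
  have lim0: "((\<lambda>X. contour_integral (linepath (Complex X (Im (pathstart \<gamma>))) (pathstart \<gamma>)) F) \<longlongrightarrow>
            (LINT x:{..Re (pathstart \<gamma>)}|lborel. F (Complex x (Im (pathstart \<gamma>))))) at_bot"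
    using contour_integral_ray_tendsto[OF _ c0] D ray0 unfolding loop_decaying_def by simp
  have lim1: "((\<lambda>X. contour_integral (linepath (Complex X (Im (pathfinish \<gamma>))) (pathfinish \<gamma>)) F) \<longlongrightarrow>
            (LINT x:{..Re (pathfinish \<gamma>)}|lborel. F (Complex x (Im (pathfinish \<gamma>))))) at_bot"
    using contour_integral_ray_tendsto[OF _ c1] D ray1 unfolding loop_decaying_def by simp
  show lim: "((\<lambda>X. contour_integral (loop_part \<gamma> X) F) \<longlongrightarrow> ?L) at_bot"
  proof (rule Lim_transform_eventually)
    show "((\<lambda>X. contour_integral (linepath (Complex X (Im (pathstart \<gamma>))) (pathstart \<gamma>)) F + contour_integral \<gamma> F -
            contour_integral (linepath (Complex X (Im (pathfinish \<gamma>))) (pathfinish \<gamma>)) F) \<longlongrightarrow> ?L) at_bot"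
      by (intro tendsto_intros lim0 lim1)
    show "\<forall>\<^sub>F X in at_bot. contour_integral (linepath (Complex X (Im (pathstart \<gamma>))) (pathstart \<gamma>)) F + contour_integral \<gamma> F -
            contour_integral (linepath (Complex X (Im (pathfinish \<gamma>))) (pathfinish \<gamma>)) F = contour_integral (loop_part \<gamma> X) F"
      using eventually_le_at_bot[of X0]
    proof eventually_elim
      case (elim X)
      have sub: "path_image (loop_part \<gamma> X) \<subseteq> - (P \<union> Q)" using avoid[OF _ elim] by blast
      have "contour_integral (linepath (pathfinish \<gamma>) (Complex X (Im (pathfinish \<gamma>)))) F =
          - contour_integral (linepath (Complex X (Im (pathfinish \<gamma>))) (pathfinish \<gamma>)) F"
        by (rule contour_integral_reverse_linepath)
           (use sub in \<open>auto simp: path_image_loop_part intro!: holomorphic_on_imp_continuous_on holomorphic_on_subset[OF hol]\<close>)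
      then show ?case
        by (subst contour_integral_loop_part[OF v open_Compl[OF cl] hol sub]) simp
    qed
  qed
  show "loop_integral \<gamma> F = ?L"
    unfolding loop_integral_def by (rule tendsto_Lim[OF _ lim]) (rule trivial_limit_at_bot_linorder)
qed

text \<open>Close the loop by the vertical segments on which the integral tends to zero.\<close>
lemma loop_integral_residue_limit:
  assumes L: "left_loop \<gamma> P Q" and lf: "\<And>r. finite ((P \<union> Q) \<inter> cball 0 r)"
    and D: "loop_decaying F (P \<union> Q)" and finP: "\<And>X. finite {w \<in> P. X < Re w}"
    and \<xi>: "filterlim \<xi> at_bot sequentially" "\<And>m y. Complex (\<xi> m) y \<notin> P \<union> Q"
      "\<And>y0 y1. (\<lambda>m. contour_integral (linepath (Complex (\<xi> m) y0) (Complex (\<xi> m) y1)) F) \<longlonglongrightarrow> 0"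
  shows "(\<lambda>m. 2 * pi * \<i> * (\<Sum>w\<in>{w \<in> P. \<xi> m < Re w}. residue F w)) \<longlonglongrightarrow> loop_integral \<gamma> F"
proof -
  have v: "valid_path \<gamma>" using L by (simp add: left_loop_def)
  have cl: "closed (P \<union> Q)" by (rule closed_locally_finite[OF lf order_refl])
  have hol: "F holomorphic_on - (P \<union> Q)" using D by (simp add: loop_decaying_def)
  obtain X0 where X0: "\<And>s. s \<in> path_image \<gamma> \<Longrightarrow> X0 \<le> Re s" using left_loop_bounded_left[OF L] by blast
  have "((\<lambda>X. contour_integral (loop_part \<gamma> X) F) \<longlongrightarrow> loop_integral \<gamma> F) at_bot"
    using loop_part_tendsto[OF L cl D] by simp
  then have "(\<lambda>m. contour_integral (loop_part \<gamma> (\<xi> m)) F) \<longlonglongrightarrow> loop_integral \<gamma> F"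
    by (rule filterlim_compose[OF _ \<xi>(1)])
  from tendsto_add[OF this \<xi>(3)[of "Im (pathfinish \<gamma>)" "Im (pathstart \<gamma>)"]]
  have "(\<lambda>m. contour_integral (loop_part \<gamma> (\<xi> m)) F +
      contour_integral (linepath (Complex (\<xi> m) (Im (pathfinish \<gamma>))) (Complex (\<xi> m) (Im (pathstart \<gamma>)))) F) \<longlonglongrightarrow> loop_integral \<gamma> F"
    by simp
  moreover have "\<forall>\<^sub>F m in sequentially. \<xi> m \<le> X0"
    by (rule eventually_compose_filterlim[OF eventually_le_at_bot \<xi>(1)])
  then have "\<forall>\<^sub>F m in sequentially. contour_integral (loop_part \<gamma> (\<xi> m)) F +
      contour_integral (linepath (Complex (\<xi> m) (Im (pathfinish \<gamma>))) (Complex (\<xi> m) (Im (pathstart \<gamma>)))) F =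
      2 * pi * \<i> * (\<Sum>w\<in>{w \<in> P. \<xi> m < Re w}. residue F w)"
  proof eventually_elim
    case (elim m)
    have left: "\<xi> m \<le> Re s" if "s \<in> path_image \<gamma>" for s using X0[OF that] elim by simp
    have st: "\<xi> m \<le> Re (pathstart \<gamma>)" "\<xi> m \<le> Re (pathfinish \<gamma>)" using left by auto
    have "path_image (closed_loop_part \<gamma> (\<xi> m)) \<subseteq> - (P \<union> Q)"
    proof
      fix w assume w: "w \<in> path_image (closed_loop_part \<gamma> (\<xi> m))"
      show "w \<in> - (P \<union> Q)"
      proof (cases "Re w = \<xi> m")
        case True
        then show ?thesis using \<xi>(2)[of m "Im w"] by (metis ComplI complex.exhaust_sel)
      next
        case False
        then have "w \<in> path_image (loop_part \<gamma> (\<xi> m))" using w by (auto simp: path_image_closed_loop_part closed_segment_same_Re)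
        then show ?thesis using left_loop_right_of(1)[OF L st] by blast
      qed
    qed
    then have "contour_integral (closed_loop_part \<gamma> (\<xi> m)) F = contour_integral (loop_part \<gamma> (\<xi> m)) F +
      contour_integral (linepath (Complex (\<xi> m) (Im (pathfinish \<gamma>))) (Complex (\<xi> m) (Im (pathstart \<gamma>)))) F"
      by (intro contour_integral_closed_loop_part[OF v open_Compl[OF cl] hol])
    then show ?case
      using contour_integral_closed_loop_part_residues[OF L lf hol finP left \<xi>(2)] by simp
  qed
  ultimately show ?thesis by (rule Lim_transform_eventually)
qed

text \<open>
  Both loop integrals are limits of sums of residues along the same sequence of vertical lines. The
  infinitely many residues at the points of \<open>A\<close> occur in both and cancel; what remains
  are the residues at \<open>D\<close>.
\<close>
lemma loop_integral_change:
  assumes L: "left_loop \<gamma> A B" and L': "left_loop \<gamma>' (A \<union> D) B'" and Z: "A \<union> B = A \<union> D \<union> B'"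
    and D: "finite D" "A \<inter> D = {}"
    and lf: "\<And>r. finite ((A \<union> B) \<inter> cball 0 r)"
    and F: "loop_decaying F (A \<union> B)" and finA: "\<And>X. finite {w \<in> A. X < Re w}"
  shows "loop_integral \<gamma>' F = loop_integral \<gamma> F + 2 * pi * \<i> * (\<Sum>w\<in>D. residue F w)"
proof -
  obtain \<xi> where \<xi>: "filterlim \<xi> at_bot sequentially" "\<And>m y. Complex (\<xi> m) y \<notin> A \<union> B"
      "\<And>y0 y1. (\<lambda>m. contour_integral (linepath (Complex (\<xi> m) y0) (Complex (\<xi> m) y1)) F) \<longlonglongrightarrow> 0"
    using F unfolding loop_decaying_def by blast
  have finAD: "finite {w \<in> A \<union> D. X < Re w}" for X
    by (rule finite_subset[of _ "{w \<in> A. X < Re w} \<union> D"]) (use finA D in auto)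
  have 1: "(\<lambda>m. 2 * pi * \<i> * (\<Sum>w\<in>{w \<in> A. \<xi> m < Re w}. residue F w)) \<longlonglongrightarrow> loop_integral \<gamma> F"
    by (rule loop_integral_residue_limit[OF L lf F finA \<xi>])
  have 2: "(\<lambda>m. 2 * pi * \<i> * (\<Sum>w\<in>{w \<in> A \<union> D. \<xi> m < Re w}. residue F w)) \<longlonglongrightarrow> loop_integral \<gamma>' F"
    by (rule loop_integral_residue_limit[OF L' lf[unfolded Z] F[unfolded Z] finAD \<xi>[unfolded Z]])
  have "\<forall>\<^sub>F m in sequentially. \<forall>w\<in>D. \<xi> m < Re w"
  proof (rule eventually_ball_finite[OF D(1)], rule ballI)
    fix w assume "w \<in> D"
    show "\<forall>\<^sub>F m in sequentially. \<xi> m < Re w"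
      by (rule eventually_compose_filterlim[OF eventually_gt_at_bot \<xi>(1)])
  qed
  then have "\<forall>\<^sub>F m in sequentially. 2 * pi * \<i> * (\<Sum>w\<in>{w \<in> A. \<xi> m < Re w}. residue F w) +
      2 * pi * \<i> * (\<Sum>w\<in>D. residue F w) = 2 * pi * \<i> * (\<Sum>w\<in>{w \<in> A \<union> D. \<xi> m < Re w}. residue F w)"
  proof eventually_elim
    case (elim m)
    have "{w \<in> A \<union> D. \<xi> m < Re w} = {w \<in> A. \<xi> m < Re w} \<union> D" using elim by auto
    then have "(\<Sum>w\<in>{w \<in> A \<union> D. \<xi> m < Re w}. residue F w) =
      (\<Sum>w\<in>{w \<in> A. \<xi> m < Re w}. residue F w) + (\<Sum>w\<in>D. residue F w)"
      using D finA[of "\<xi> m"] by (simp only:) (rule sum.union_disjoint, auto)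
    then show ?case by (simp add: distrib_left)
  qed
  with tendsto_add[OF 1 tendsto_const]
  have "(\<lambda>m. 2 * pi * \<i> * (\<Sum>w\<in>{w \<in> A \<union> D. \<xi> m < Re w}. residue F w)) \<longlonglongrightarrow>
     loop_integral \<gamma> F + 2 * pi * \<i> * (\<Sum>w\<in>D. residue F w)"
    by (rule Lim_transform_eventually)
  with 2 show ?thesis using LIMSEQ_unique by blast
qed

definition rect_loop :: "real \<Rightarrow> real \<Rightarrow> real \<Rightarrow> complex" where
  "rect_loop R Y = linepath (Complex R (- Y)) (Complex R Y)"

lemma rect_loop_simps [simp]:
  "valid_path (rect_loop R Y)" "pathstart (rect_loop R Y) = Complex R (- Y)" "pathfinish (rect_loop R Y) = Complex R Y"
  by (simp_all add: rect_loop_def)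

lemma closed_loop_part_rect:
  assumes "X \<le> R" "0 \<le> Y"
  shows "path_image (closed_loop_part (rect_loop R Y) X) = path_image (rectpath (Complex X (- Y)) (Complex R Y))"
    and "w \<notin> path_image (rectpath (Complex X (- Y)) (Complex R Y)) \<Longrightarrow>
      winding_number (closed_loop_part (rect_loop R Y) X) w = winding_number (rectpath (Complex X (- Y)) (Complex R Y)) w"
  unfolding closed_loop_part_def loop_part_def rect_loop_def rectpath_def
  by (auto simp: path_image_join winding_number_join Let_def)

lemma left_loop_rect:
  assumes Y: "Y > 0" and P: "\<And>w. w \<in> P \<Longrightarrow> Re w < R \<and> \<bar>Im w\<bar> < Y" and Q: "\<And>w. w \<in> Q \<Longrightarrow> R < Re w"
  shows "left_loop (rect_loop R Y) P Q"
  unfolding left_loop_def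
proof (intro conjI ballI)
  fix w assume w: "w \<in> P"
  show "\<forall>\<^sub>F X in at_bot. w \<notin> path_image (closed_loop_part (rect_loop R Y) X) \<and>
             winding_number (closed_loop_part (rect_loop R Y) X) w = 1"
    using eventually_gt_at_bot[of "Re w"]
  proof eventually_elim
    case (elim X)
    have XR: "X < R" using elim P[OF w] by simp
    have b: "w \<in> box (Complex X (- Y)) (Complex R Y)" using P[OF w] elim by (auto simp: in_box_complex_iff)
    then have n: "w \<notin> path_image (rectpath (Complex X (- Y)) (Complex R Y))"
      using XR Y by (subst path_image_rectpath_cbox_minus_box) auto
    show ?case using closed_loop_part_rect[of X R Y] n winding_number_rectpath[OF b] XR Y by simp
  qed
next
  fix w assume w: "w \<in> Q"
  show "\<forall>\<^sub>F X in at_bot. w \<notin> path_image (closed_loop_part (rect_loop R Y) X) \<and>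
             winding_number (closed_loop_part (rect_loop R Y) X) w = 0"
    using eventually_gt_at_bot[of R]
  proof eventually_elim
    case (elim X)
    have o: "w \<notin> cbox (Complex X (- Y)) (Complex R Y)" using Q[OF w] elim by (auto simp: in_cbox_complex_iff)
    then have n: "w \<notin> path_image (rectpath (Complex X (- Y)) (Complex R Y))"
      using path_image_rectpath_subset_cbox[of "Complex X (- Y)" "Complex R Y"] elim Y by auto
    show ?case using closed_loop_part_rect[of X R Y] n winding_number_rectpath_outside[OF _ _ o] elim Y by simp
  qed
qed (use Y in auto)

text \<open>
  A detour at the end of the loop: go from its end point to a small circle about \<open>w\<close>,
  run round the circle clockwise, and return the same way. The connecting path contributes nothing
  to any index, and the circle changes the index of \<open>w\<close> only. The connecting path
  exists since the complement of a closed discrete set in the plane is open and connected.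
\<close>
lemma left_loop_exclude_point:
  assumes L: "left_loop \<gamma> P Q" and w: "w \<in> P" and lf: "\<And>r. finite ((P \<union> Q) \<inter> cball 0 r)"
  shows "\<exists>\<gamma>'. left_loop \<gamma>' (P - {w}) (insert w Q)"
proof -
  define Z where "Z = P \<union> Q"
  have v: "valid_path \<gamma>" using L by (simp add: left_loop_def)
  have opZ: "open (- Z)" unfolding Z_def by (intro open_Compl closed_locally_finite[OF lf order_refl])
  have conZ: "connected (- Z)" unfolding Z_def
    by (intro path_connected_imp_connected path_connected_complement_countable countable_locally_finite lf) auto
  have "closed (Z - {w})" unfolding Z_def by (rule closed_locally_finite[OF lf]) auto
  then have "open (- (Z - {w}))" by (rule open_Compl)
  then obtain e where e: "e > 0" "cball w e \<subseteq> - (Z - {w})"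
    by (metis ComplI Diff_iff open_contains_cball singletonI)
  have avoid: "u \<notin> path_image \<gamma>" if "u \<in> Z" for u
  proof -
    obtain X0 where X0: "\<And>s. s \<in> path_image \<gamma> \<Longrightarrow> X0 \<le> Re s" using left_loop_bounded_left[OF L] by blast
    have "u \<notin> path_image (loop_part \<gamma> X0)"
      by (rule left_loop_right_of(1)[OF L]) (use X0 that in \<open>auto simp: Z_def\<close>)
    then show ?thesis by (simp add: path_image_loop_part)
  qed
  have fin: "pathfinish \<gamma> \<in> - Z" using avoid by (metis ComplI pathfinish_in_path_image)
  have we: "w + of_real e \<in> - Z"
  proof -
    have "w + of_real e \<in> cball w e" using e(1) by (simp add: dist_norm)
    then have "w + of_real e \<in> - (Z - {w})" using e(2) by blast
    then show ?thesis using e(1) by simp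
  qed
  obtain \<eta> where \<eta>: "polynomial_function \<eta>" "path_image \<eta> \<subseteq> - Z" "pathstart \<eta> = pathfinish \<gamma>" "pathfinish \<eta> = w + of_real e"
    using connected_open_polynomial_connected[OF opZ conZ fin we] by blast
  have v\<eta>: "valid_path \<eta>" using \<eta>(1) by (rule valid_path_polynomial_function)
  define \<kappa> where "\<kappa> = reversepath (circlepath w e)"
  have v\<kappa>: "valid_path \<kappa>" "pathstart \<kappa> = w + of_real e" "pathfinish \<kappa> = w + of_real e"
    by (simp_all add: \<kappa>_def valid_path_imp_reverse)
  have im\<kappa>: "u \<notin> path_image \<kappa>" if "u \<in> Z" for u
    using that e by (auto simp: \<kappa>_def sphere_def)
  \<comment> \<open>Reversing the circle gives it the clockwise orientation, hence index \<open>-1\<close> about \<open>w\<close>.\<close>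
  define \<gamma>' where "\<gamma>' = \<gamma> +++ (\<eta> +++ (\<kappa> +++ reversepath \<eta>))"
  have v': "valid_path \<gamma>'" unfolding \<gamma>'_def
    by (intro valid_path_join v v\<eta> v\<kappa> valid_path_imp_reverse) (use \<eta> v\<kappa> in auto)
  have st: "pathstart \<gamma>' = pathstart \<gamma>" "pathfinish \<gamma>' = pathfinish \<gamma>"
    using \<eta> by (simp_all add: \<gamma>'_def)
  have im': "u \<notin> path_image (closed_loop_part \<gamma>' X)" and wn': "winding_number (closed_loop_part \<gamma>' X) u =
      winding_number (closed_loop_part \<gamma> X) u + winding_number \<kappa> u"
    if "u \<in> Z" "u \<notin> path_image (closed_loop_part \<gamma> X)" for u X
  proof -
    have u: "u \<notin> path_image \<gamma>" "u \<notin> path_image \<eta>" "u \<notin> path_image \<kappa>" using avoid im\<kappa> \<eta>(2) that by auto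
    have p: "path \<gamma>" "path \<eta>" "path \<kappa>" using v v\<eta> v\<kappa> by (auto simp: valid_path_imp_path)
    note facts = u p \<eta>(3,4) v\<kappa>(2,3)
    have i: "u \<notin> path_image \<gamma>'" using facts by (simp add: \<gamma>'_def path_image_join)
    have p': "path \<gamma>'" using v' by (rule valid_path_imp_path)
    have wg: "winding_number \<gamma>' u = winding_number \<gamma> u + winding_number \<kappa> u"
      using facts by (simp add: \<gamma>'_def path_image_join winding_number_join winding_number_reversepath)
    show "u \<notin> path_image (closed_loop_part \<gamma>' X)"
      using that(2) i by (simp add: path_image_closed_loop_part path_image_loop_part st)
    have "u \<notin> closed_segment (Complex X (Im (pathstart \<gamma>))) (pathstart \<gamma>)"
      "u \<notin> closed_segment (pathfinish \<gamma>) (Complex X (Im (pathfinish \<gamma>)))"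
      "u \<notin> closed_segment (Complex X (Im (pathfinish \<gamma>))) (Complex X (Im (pathstart \<gamma>)))"
      using that(2) by (auto simp: path_image_closed_loop_part path_image_loop_part)
    then show "winding_number (closed_loop_part \<gamma>' X) u = winding_number (closed_loop_part \<gamma> X) u + winding_number \<kappa> u"
      using u(1) i p(1) p' unfolding closed_loop_part_def loop_part_def
      by (simp add: path_image_join winding_number_join st wg)
  qed
  have wn\<kappa>: "winding_number \<kappa> u = (if u = w then -1 else 0)" if "u \<in> Z" for u
  proof -
    have "u \<notin> path_image (circlepath w e)" using im\<kappa>[OF that] by (simp add: \<kappa>_def)
    then have "winding_number \<kappa> u = - winding_number (circlepath w e) u"
      by (simp add: \<kappa>_def winding_number_reversepath)
    moreover have "winding_number (circlepath w e) u = 0" if "u \<noteq> w"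
      by (rule winding_number_zero_outside[of _ "cball w e"])
         (use that \<open>u \<in> Z\<close> e in \<open>auto simp: sphere_def\<close>)
    ultimately show ?thesis using winding_number_circlepath_centre[OF e(1), of w] by auto
  qed
  show ?thesis
  proof (intro exI[of _ \<gamma>'])
    have wZ: "w \<in> Z" using w by (simp add: Z_def)
    show "left_loop \<gamma>' (P - {w}) (insert w Q)"
      unfolding left_loop_def
    proof (intro conjI ballI)
      fix u assume u: "u \<in> P - {w}"
      then have uZ: "u \<in> Z" by (simp add: Z_def)
      have "\<forall>\<^sub>F X in at_bot. u \<notin> path_image (closed_loop_part \<gamma> X) \<and> winding_number (closed_loop_part \<gamma> X) u = 1"
        using L u by (simp add: left_loop_def)
      then show "\<forall>\<^sub>F X in at_bot. u \<notin> path_image (closed_loop_part \<gamma>' X) \<and> winding_number (closed_loop_part \<gamma>' X) u = 1"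
        by eventually_elim (use u im'[OF uZ] wn'[OF uZ] wn\<kappa>[OF uZ] in auto)
    next
      fix u assume u: "u \<in> insert w Q"
      then have uZ: "u \<in> Z" using wZ by (auto simp: Z_def)
      have wQ: "w \<notin> Q"
      proof
        assume "w \<in> Q"
        then have "\<forall>\<^sub>F X in at_bot. winding_number (closed_loop_part \<gamma> X) w = 1 \<and> winding_number (closed_loop_part \<gamma> X) w = 0"
          using L w unfolding left_loop_def by (intro eventually_conj) (auto elim: eventually_mono)
        then have "\<forall>\<^sub>F X in (at_bot :: real filter). False" by eventually_elim auto
        then show False by (simp add: eventually_False)
      qed
      have "\<forall>\<^sub>F X in at_bot. u \<notin> path_image (closed_loop_part \<gamma> X) \<and> winding_number (closed_loop_part \<gamma> X) u = (if u = w then 1 else 0)"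
        using L u w by (auto simp: left_loop_def)
      then show "\<forall>\<^sub>F X in at_bot. u \<notin> path_image (closed_loop_part \<gamma>' X) \<and> winding_number (closed_loop_part \<gamma>' X) u = 0"
        by eventually_elim (use im'[OF uZ] wn'[OF uZ] wn\<kappa>[OF uZ] in auto)
    qed (use L st v' in \<open>auto simp: left_loop_def\<close>)
  qed
qed

lemma left_loop_exclude_finite:
  assumes "finite D" "left_loop \<gamma> (P \<union> D) Q" "P \<inter> D = {}" "\<And>r. finite ((P \<union> D \<union> Q) \<inter> cball 0 r)"
  shows "\<exists>\<gamma>'. left_loop \<gamma>' P (D \<union> Q)"
  using assms
proof (induction D arbitrary: \<gamma> Q rule: finite_induct)
  case (insert w D)
  have "\<exists>\<gamma>'. left_loop \<gamma>' (P \<union> insert w D - {w}) (insert w Q)"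
    by (rule left_loop_exclude_point[OF insert.prems(1)]) (use insert.prems(3) in auto)
  moreover have "P \<union> insert w D - {w} = P \<union> D" using insert.hyps insert.prems by auto
  ultimately obtain \<gamma>' where \<gamma>': "left_loop \<gamma>' (P \<union> D) (insert w Q)" by auto
  have "\<exists>\<gamma>''. left_loop \<gamma>'' P (D \<union> insert w Q)"
    by (rule insert.IH[OF \<gamma>']) (use insert.prems in \<open>auto simp: Un_assoc insert_commute\<close>)
  then show ?case by simp
qed auto

section \<open>Integrals over dilations and the hypergeometric function on the cut plane\<close>

text \<open>The Weierstrass M-test against a fixed integrable factor \<open>g\<close>.\<close>
lemma sums_set_integral_bounded:
  fixes g :: "real \<Rightarrow> complex" and t :: "nat \<Rightarrow> real \<Rightarrow> complex"
  assumes g: "set_integrable lborel S g" and S: "S \<in> sets borel"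
    and cont: "\<And>j. continuous_on S (t j)" and B: "\<And>j x. x \<in> S \<Longrightarrow> norm (t j x) \<le> B j" "summable B"
    and T: "\<And>x. x \<in> S \<Longrightarrow> (\<lambda>j. t j x) sums T x"
  shows "set_integrable lborel S (\<lambda>x. T x * g x)"
    and "(\<lambda>j. LINT x:S|lborel. t j x * g x) sums (LINT x:S|lborel. T x * g x)"
proof -
  define f where "f j x = indicator S x *\<^sub>R (t j x * g x)" for j x
  have f_eq: "f j x = (indicator S x *\<^sub>R t j x) * (indicator S x *\<^sub>R g x)" for j x
    by (simp add: f_def indicator_def)
  have meas: "(\<lambda>x. indicator S x *\<^sub>R t j x) \<in> borel_measurable lborel" for j
    using borel_measurable_continuous_on_indicator[OF S cont[of j]] by simp
  have gm: "(\<lambda>x. indicator S x *\<^sub>R g x) \<in> borel_measurable lborel"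
    using g by (auto simp: set_integrable_def)
  have fm: "f j \<in> borel_measurable lborel" for j
    unfolding f_eq[abs_def] by (intro borel_measurable_times meas gm)
  have le: "norm (f j x) \<le> B j * norm (indicator S x *\<^sub>R g x)" for j x
    using B(1)[of x j] by (auto simp: f_def indicator_def norm_mult intro!: mult_right_mono)
  have gi: "integrable lborel (\<lambda>x. B j * norm (indicator S x *\<^sub>R g x))" for j
    using g unfolding set_integrable_def by (intro integrable_mult_right integrable_norm)
  have fi: "integrable lborel (f j)" for j
    by (rule Bochner_Integration.integrable_bound[OF gi fm]) (use le[of j] in \<open>auto intro!: AE_I2 intro: order_trans[OF _ abs_ge_self]\<close>)
  have sn: "summable (\<lambda>j. norm (f j x))" for x
    by (rule summable_comparison_test'[of "\<lambda>j. B j * norm (indicator S x *\<^sub>R g x)" 0])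
       (use le B(2) in \<open>auto intro: summable_mult2\<close>)
  have si: "summable (\<lambda>j. LINT x|lborel. norm (f j x))"
  proof (rule summable_comparison_test'[of "\<lambda>j. B j * (LINT x|lborel. norm (indicator S x *\<^sub>R g x))" 0])
    show "summable (\<lambda>j. B j * (LINT x|lborel. norm (indicator S x *\<^sub>R g x)))"
      by (rule summable_mult2) (rule B(2))
    fix j
    have "(LINT x|lborel. norm (f j x)) \<le> (LINT x|lborel. B j * norm (indicator S x *\<^sub>R g x))"
      by (intro integral_mono integrable_norm fi gi le)
    then show "norm (LINT x|lborel. norm (f j x)) \<le> B j * (LINT x|lborel. norm (indicator S x *\<^sub>R g x))"
      by (simp add: integral_nonneg_AE del: norm_scaleR)
  qed
  have sum: "(\<Sum>j. f j x) = indicator S x *\<^sub>R (T x * g x)" for x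
  proof (cases "x \<in> S")
    case True
    have "(\<lambda>j. t j x * g x) sums (T x * g x)" by (intro sums_mult2 T True)
    then show ?thesis using True by (simp add: f_def sums_iff)
  qed (simp add: f_def)
  show "set_integrable lborel S (\<lambda>x. T x * g x)"
    unfolding set_integrable_def sum[symmetric] by (rule integrable_suminf[OF fi AE_I2[OF sn] si])
  show "(\<lambda>j. LINT x:S|lborel. t j x * g x) sums (LINT x:S|lborel. T x * g x)"
    using sums_integral[OF fi AE_I2[OF sn] si] unfolding sum by (simp add: set_lebesgue_integral_def f_def)
qed

text \<open>
  Near a point \<open>z0\<close>, expand \<open>F\<close> about \<open>x z0\<close> for every
  \<open>x\<close>. The compact segment \<open>[0, z0]\<close> has a distance \<open>e\<close> from
  the complement of \<open>U\<close>, so Cauchy's inequalities bound the Taylor coefficients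
  uniformly in \<open>x\<close>, and integration term by term yields a power series in \<open>z -
  z0\<close>.
\<close>
lemma holomorphic_integral_dilate:
  fixes g :: "real \<Rightarrow> complex"
  assumes F: "F holomorphic_on U" and U: "open U"
    and star: "\<And>x z. x \<in> {0..1} \<Longrightarrow> z \<in> U \<Longrightarrow> of_real x * z \<in> U"
    and g: "set_integrable lborel S g" and S: "S \<in> sets borel" "S \<subseteq> {0..1}"
  shows "(\<lambda>z. LINT x:S|lborel. F (of_real x * z) * g x) holomorphic_on U"
    and "\<And>z. z \<in> U \<Longrightarrow> set_integrable lborel S (\<lambda>x. F (of_real x * z) * g x)"
proof -
  have main: "\<exists>e>0. (\<lambda>z. LINT x:S|lborel. F (of_real x * z) * g x) holomorphic_on ball z0 e \<and>
      set_integrable lborel S (\<lambda>x. F (of_real x * z0) * g x)" if z0: "z0 \<in> U" for z0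
  proof -
    define K where "K = (\<lambda>x. of_real x * z0) ` {0..1::real}"
    have K: "compact K" "K \<subseteq> U" unfolding K_def using star z0
      by (auto intro!: compact_continuous_image continuous_intros)
    obtain e where e: "e > 0" "(\<Union>k\<in>K. cball k e) \<subseteq> U"
      using compact_subset_open_imp_cball_epsilon_subset[OF K(1) U K(2)] by blast
    have "(\<Union>k\<in>K. cball k e) = (\<lambda>(k, b). k + b) ` (K \<times> cball 0 e)"
    proof (intro equalityI subsetI)
      fix w assume "w \<in> (\<Union>k\<in>K. cball k e)"
      then obtain k where "k \<in> K" "w \<in> cball k e" by blast
      then show "w \<in> (\<lambda>(k, b). k + b) ` (K \<times> cball 0 e)"
        by (intro image_eqI[of _ _ "(k, w - k)"]) (auto simp: dist_norm norm_minus_commute)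
    next
      fix w assume "w \<in> (\<lambda>(k, b). k + b) ` (K \<times> cball 0 e)"
      then obtain k b where "k \<in> K" "norm b \<le> e" "w = k + b" by auto
      then show "w \<in> (\<Union>k\<in>K. cball k e)" by (intro UN_I[of k]) (auto simp: dist_norm)
    qed
    moreover have "compact ((\<lambda>(k, b). k + b) ` (K \<times> cball 0 e))"
      by (intro compact_continuous_image compact_Times K(1) compact_cball)
         (auto intro!: continuous_intros simp: case_prod_beta)
    ultimately have "compact (\<Union>k\<in>K. cball k e)" by simp
    then have "bounded (F ` (\<Union>k\<in>K. cball k e))"
      using F e(2) by (intro compact_imp_bounded compact_continuous_image)
        (auto intro: holomorphic_on_imp_continuous_on holomorphic_on_subset)
    then obtain M where M: "M > 0" "\<And>w k. k \<in> K \<Longrightarrow> w \<in> cball k e \<Longrightarrow> norm (F w) \<le> M"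
      unfolding bounded_pos by blast
    define t where "t h j x = (deriv ^^ j) F (of_real x * z0) / fact j * (of_real x * h) ^ j" for h j and x :: real
    have xK: "of_real x * z0 \<in> K" if "x \<in> S" for x using that S(2) by (auto simp: K_def)
    have hol: "F holomorphic_on cball k e" if "k \<in> K" for k
      using that e(2) by (intro holomorphic_on_subset[OF F]) auto
    have cont: "continuous_on S (t h j)" for h j
      unfolding t_def
      by (intro continuous_intros continuous_on_compose2[OF holomorphic_on_imp_continuous_on[OF holomorphic_higher_deriv[OF F U]]])
         (use S(2) star z0 in auto)
    have bound: "norm (t h j x) \<le> M * (1/2) ^ j" if x: "x \<in> S" and h: "norm h \<le> e / 2" for h j x
    proof -
      have "norm ((deriv ^^ j) F (of_real x * z0)) \<le> fact j * M / e ^ j"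
      proof (rule Cauchy_inequality)
        show "F holomorphic_on ball (of_real x * z0) e"
          using hol[OF xK[OF x]] by (rule holomorphic_on_subset) auto
        show "continuous_on (cball (of_real x * z0) e) F"
          using hol[OF xK[OF x]] by (rule holomorphic_on_imp_continuous_on)
        show "norm (F u) \<le> M" if "norm (of_real x * z0 - u) = e" for u
          using M(2)[OF xK[OF x], of u] that by (simp add: dist_norm)
      qed (use e in auto)
      then have 1: "norm ((deriv ^^ j) F (of_real x * z0) / fact j) \<le> M / e ^ j"
        by (simp add: norm_divide field_simps)
      have "norm (of_real x * h) \<le> 1 * (e / 2)"
        unfolding norm_mult using x S(2) h by (intro mult_mono) auto
      then have 2: "norm ((of_real x * h) ^ j) \<le> (e / 2) ^ j"
        unfolding norm_power by (intro power_mono) auto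
      have "norm (t h j x) \<le> M / e ^ j * (e / 2) ^ j"
        unfolding t_def norm_mult[of "_ / _"] using 1 2 M(1) e(1) by (intro mult_mono) auto
      also have "\<dots> = M * (1/2) ^ j" using e(1) by (simp add: power_divide)
      finally show ?thesis .
    qed
    have sums: "(\<lambda>j. t h j x) sums F (of_real x * (z0 + h))" if x: "x \<in> S" and h: "norm h \<le> e / 2" for h x
    proof -
      have "norm (of_real x * h) \<le> 1 * (e / 2)"
        unfolding norm_mult using x S(2) h by (intro mult_mono) auto
      then have w: "of_real x * (z0 + h) \<in> ball (of_real x * z0) e"
        using e(1) by (simp add: dist_norm ring_distribs norm_minus_commute)
      have "F holomorphic_on ball (of_real x * z0) e" using hol[OF xK[OF x]] by (rule holomorphic_on_subset) auto
      from holomorphic_power_series[OF this w] show ?thesis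
        by (simp add: t_def ring_distribs)
    qed
    have sB: "summable (\<lambda>j. M * (1/2) ^ j)" by (intro summable_mult summable_geometric) auto
    define c where "c j = (LINT x:S|lborel. t 1 j x * g x)" for j
    have A: "(\<lambda>x. t h j x * g x) = (\<lambda>x. h ^ j * (t 1 j x * g x))" for h j
      by (simp add: t_def power_mult_distrib fun_eq_iff)
    have tc: "(LINT x:S|lborel. t h j x * g x) = c j * h ^ j" for h j
      unfolding c_def by (subst A) simp
    have "(\<lambda>z. LINT x:S|lborel. F (of_real x * z) * g x) holomorphic_on ball z0 (e/2)"
    proof (rule power_series_holomorphic)
      fix w assume "w \<in> ball z0 (e/2)"
      then have h: "norm (w - z0) \<le> e / 2" by (simp add: dist_norm norm_minus_commute)
      from sums_set_integral_bounded(2)[OF g S(1) cont bound[OF _ h] sB sums[OF _ h]]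
      show "(\<lambda>n. c n * (w - z0) ^ n) sums (LINT x:S|lborel. F (of_real x * w) * g x)"
        by (simp add: tc)
    qed
    moreover have "set_integrable lborel S (\<lambda>x. F (of_real x * z0) * g x)"
      using sums_set_integral_bounded(1)[OF g S(1) cont bound[of _ 0] sB sums[of _ 0]] e(1) by simp
    ultimately show ?thesis using e(1) by (intro exI[of _ "e/2"]) auto
  qed
  show "(\<lambda>z. LINT x:S|lborel. F (of_real x * z) * g x) holomorphic_on U"
    unfolding holomorphic_on_def
  proof
    fix z assume "z \<in> U"
    from main[OF this] obtain e where "e > 0" "(\<lambda>z. LINT x:S|lborel. F (of_real x * z) * g x) holomorphic_on ball z e" by blast
    then have "(\<lambda>z. LINT x:S|lborel. F (of_real x * z) * g x) field_differentiable at z"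
      by (meson centre_in_ball holomorphic_on_imp_differentiable_at open_ball)
    then show "(\<lambda>z. LINT x:S|lborel. F (of_real x * z) * g x) field_differentiable at z within U"
      by (rule field_differentiable_at_within)
  qed
  show "set_integrable lborel S (\<lambda>x. F (of_real x * z) * g x)" if "z \<in> U" for z
    using main[OF that] by blast
qed

abbreviation cut_plane :: "complex set" where
  "cut_plane \<equiv> - complex_of_real ` {1..}"

lemma cut_plane_eq: "cut_plane = - {z. Im z = 0 \<and> 1 \<le> Re z}"
  by (auto simp: image_iff complex_eq_iff intro!: bexI[of _ "Re _"])

lemma open_cut_plane [simp]: "open cut_plane"
  unfolding cut_plane_eq
  by (intro open_Compl closed_Collect_conj closed_Collect_eq closed_Collect_le continuous_intros)

lemma dilate_cut_plane:
  assumes "x \<in> {0..1}" "z \<in> cut_plane"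
  shows "of_real x * z \<in> cut_plane"
proof
  assume "of_real x * z \<in> complex_of_real ` {1..}"
  then have *: "x * Im z = 0" "1 \<le> x * Re z" by (auto simp: complex_eq_iff)
  then have x: "x \<noteq> 0" by auto
  then have "0 < x" using assms by auto
  then have "0 \<le> Re z" using *(2) by (smt (verit) mult_pos_neg)
  then have "x * Re z \<le> 1 * Re z" using assms by (intro mult_right_mono) auto
  then have "1 \<le> Re z" using *(2) by simp
  moreover have "Im z = 0" using *(1) x by simp
  ultimately show False using assms(2) by (auto simp: cut_plane_eq)
qed

lemma connected_cut_plane [simp]: "connected cut_plane"
proof (rule starlike_imp_connected, unfold starlike_def, intro bexI[of _ 0] ballI subsetI)
  fix z w assume z: "z \<in> cut_plane" and "w \<in> closed_segment 0 z"
  then obtain u where "0 \<le> u" "u \<le> 1" "w = of_real u * z"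
    by (auto simp: closed_segment_def scaleR_conv_of_real)
  then show "w \<in> cut_plane" using dilate_cut_plane[OF _ z, of u] by simp
qed (auto simp: cut_plane_eq)

lemma ball_subset_cut_plane: "ball 0 1 \<subseteq> cut_plane"
proof
  fix z :: complex assume "z \<in> ball 0 1"
  then have "Re z < 1" using complex_Re_le_cmod[of z] by simp
  then show "z \<in> cut_plane" by (simp add: cut_plane_eq)
qed

text \<open>
  The sequences that are Taylor coefficients at \<open>0\<close> of a function holomorphic on the
  whole cut plane. Passing to coefficients makes it easy to recognize the effect of the operations
  below.
\<close>
definition cut_series :: "(nat \<Rightarrow> complex) \<Rightarrow> bool" where
  "cut_series f \<longleftrightarrow> (\<exists>F. F holomorphic_on cut_plane \<and> F has_fps_expansion Abs_fps f)"

lemma cut_series_binomial: "cut_series (\<lambda>k. pochhammer a k / fact k)"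
  unfolding cut_series_def
proof (intro exI[of _ "\<lambda>w. (1 - w) powr (- a)"] conjI)
  show "(\<lambda>w. (1 - w) powr - a) holomorphic_on cut_plane"
    by (intro holomorphic_intros) (auto simp: cut_plane_eq complex_nonpos_Reals_iff)
  show "(\<lambda>w. (1 - w) powr - a) has_fps_expansion Abs_fps (\<lambda>k. pochhammer a k / fact k)"
  proof (rule has_fps_expansionI)
    have "\<forall>\<^sub>F w in nhds 0. w \<in> ball (0::complex) 1" by (intro eventually_nhds_in_open) auto
    then show "\<forall>\<^sub>F w in nhds 0. (\<lambda>n. fps_nth (Abs_fps (\<lambda>k. pochhammer a k / fact k)) n * w ^ n) sums (1 - w) powr - a"
    proof eventually_elim
      case (elim w)
      have "(\<lambda>n. (- a gchoose n) * (- w) ^ n) sums (1 + - w) powr (- a)"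
        by (rule gen_binomial_complex) (use elim in simp)
      moreover have "(- a gchoose n) * (- w) ^ n = pochhammer a n / fact n * w ^ n" for n
      proof -
        have "(-1) ^ n * (-1) ^ n = (1 :: complex)" by (simp flip: power_mult_distrib)
        moreover have "(- a gchoose n) * (- w) ^ n = ((-1) ^ n * (-1) ^ n) * (pochhammer a n / fact n * w ^ n)"
          unfolding gbinomial_pochhammer power_minus[of w n] by simp
        ultimately show ?thesis by simp
      qed
      ultimately show ?case by simp
    qed
  qed
qed

lemma cut_series_cong: "cut_series f \<Longrightarrow> (\<And>k. g k = f k) \<Longrightarrow> cut_series g"
  by (metis ext)

lemma cut_series_cmult: "cut_series f \<Longrightarrow> cut_series (\<lambda>k. a * f k)"
  unfolding cut_series_def
proof (elim exE conjE)
  fix F assume F: "F holomorphic_on cut_plane" "F has_fps_expansion Abs_fps f"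
  have "(\<lambda>w. a * F w) has_fps_expansion fps_const a * Abs_fps f"
    using F(2) by (intro fps_expansion_intros)
  also have "fps_const a * Abs_fps f = Abs_fps (\<lambda>k. a * f k)" by (simp add: fps_eq_iff)
  finally show "\<exists>F. F holomorphic_on cut_plane \<and> F has_fps_expansion Abs_fps (\<lambda>k. a * f k)"
    using F(1) by (intro exI[of _ "\<lambda>w. a * F w"] conjI holomorphic_intros)
qed

text \<open>
  The operator \<open>w d/dw + a\<close> multiplies the \<open>k\<close>-th coefficient by \<open>k
  + a\<close>.
\<close>
lemma cut_series_linear_factor: "cut_series f \<Longrightarrow> cut_series (\<lambda>k. (of_nat k + a) * f k)"
  unfolding cut_series_def
proof (elim exE conjE)
  fix F assume F: "F holomorphic_on cut_plane" "F has_fps_expansion Abs_fps f"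
  have "(\<lambda>w. w * deriv F w + a * F w) has_fps_expansion fps_X * fps_deriv (Abs_fps f) + fps_const a * Abs_fps f"
    using F(2) by (intro fps_expansion_intros)
  also have "fps_X * fps_deriv (Abs_fps f) + fps_const a * Abs_fps f = Abs_fps (\<lambda>k. (of_nat k + a) * f k)"
    by (simp add: fps_eq_iff fps_X_mult_nth algebra_simps)
  finally show "\<exists>F. F holomorphic_on cut_plane \<and> F has_fps_expansion Abs_fps (\<lambda>k. (of_nat k + a) * f k)"
    using F(1) by (intro exI[of _ "\<lambda>w. w * deriv F w + a * F w"] conjI holomorphic_intros) auto
qed

lemma cut_series_pochhammer_factor: "cut_series f \<Longrightarrow> cut_series (\<lambda>k. pochhammer (of_nat k + a) L * f k)"
proof (induction L)
  case (Suc L)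
  from cut_series_linear_factor[OF Suc.IH[OF Suc.prems], of "a + of_nat L"] show ?case
    by (rule cut_series_cong) (simp add: pochhammer_Suc algebra_simps)
qed auto

text \<open>
  Divide \<open>F(w) - F(0)\<close> by \<open>w\<close>; the singularity at \<open>0\<close> is
  removable.
\<close>
lemma cut_series_shift: "cut_series f \<Longrightarrow> cut_series (\<lambda>k. f (k + 1))"
  unfolding cut_series_def
proof (elim exE conjE)
  fix F assume F: "F holomorphic_on cut_plane" "F has_fps_expansion Abs_fps f"
  define G where "G z = (if z = 0 then deriv F 0 else (F z - F 0) / (z - 0))" for z
  have F0: "F 0 = f 0" using has_fps_expansion_imp_0_eq_fps_nth_0[OF F(2)] by simp
  have hol: "G holomorphic_on cut_plane" unfolding G_def
    by (rule pole_lemma[OF F(1)]) (simp add: interior_open cut_plane_eq open_cut_plane[unfolded cut_plane_eq])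
  define H where "H = fps_expansion G 0"
  have H: "G has_fps_expansion H" unfolding H_def
    by (rule has_fps_expansion_fps_expansion[OF open_cut_plane _ hol]) (simp add: cut_plane_eq)
  have "(\<lambda>w. f 0 + w * G w) has_fps_expansion fps_const (f 0) + fps_X * H"
    using H by (intro fps_expansion_intros)
  also have "(\<lambda>w. f 0 + w * G w) = F" by (auto simp: G_def F0 fun_eq_iff)
  finally have E: "Abs_fps f = fps_const (f 0) + fps_X * H" using F(2) fps_expansion_unique_complex by blast
  have "fps_nth H k = f (k + 1)" for k
    using arg_cong[OF E, of "\<lambda>h. fps_nth h (k + 1)"] by (simp add: fps_X_mult_nth)
  then have "H = Abs_fps (\<lambda>k. f (k + 1))" by (simp add: fps_eq_iff)
  with H hol show "\<exists>F. F holomorphic_on cut_plane \<and> F has_fps_expansion Abs_fps (\<lambda>k. f (k + 1))"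
    by blast
qed

lemma cut_series_unshift: "cut_series (\<lambda>k. f (k + 1)) \<Longrightarrow> cut_series f"
  unfolding cut_series_def
proof (elim exE conjE)
  fix F assume F: "F holomorphic_on cut_plane" "F has_fps_expansion Abs_fps (\<lambda>k. f (k + 1))"
  have "(\<lambda>w. f 0 + w * F w) has_fps_expansion fps_const (f 0) + fps_X * Abs_fps (\<lambda>k. f (k + 1))"
    using F(2) by (intro fps_expansion_intros)
  also have "fps_const (f 0) + fps_X * Abs_fps (\<lambda>k. f (k + 1)) = Abs_fps f"
    by (auto simp: fps_eq_iff fps_X_mult_nth)
  finally show "\<exists>F. F holomorphic_on cut_plane \<and> F has_fps_expansion Abs_fps f"
    using F(1) by (intro exI[of _ "\<lambda>w. f 0 + w * F w"] conjI holomorphic_intros)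
qed

lemma cut_series_tail: "cut_series (\<lambda>k. f (k + K)) \<longleftrightarrow> cut_series f"
proof (induction K)
  case (Suc K)
  have "cut_series (\<lambda>k. f (k + Suc K)) \<longleftrightarrow> cut_series (\<lambda>k. f (k + K))"
    using cut_series_shift[of "\<lambda>k. f (k + K)"] cut_series_unshift[of "\<lambda>k. f (k + K)"] by auto
  then show ?case using Suc by simp
qed auto

text \<open>By the Weierstrass approximation theorem \<open>h\<close> is orthogonal to itself.\<close>
lemma moments_zero_imp_zero:
  fixes h :: "real \<Rightarrow> real"
  assumes h: "continuous_on {0..1} h" and m: "\<And>j. integral {0..1} (\<lambda>x. x ^ j * h x) = 0" and x: "x \<in> {0..1}"
  shows "h x = 0"
proof -
  have hi: "(\<lambda>x. f x * h x) integrable_on {0..1}" if "continuous_on {0..1} f" for f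
    by (intro integrable_continuous_real continuous_intros that h)
  have sq: "(\<lambda>x. h x * h x) integrable_on {0..1}" by (rule hi[OF h])
  have ab: "(\<lambda>x. \<bar>h x\<bar>) integrable_on {0..1}" by (intro integrable_continuous_real continuous_intros h)
  have "integral {0..1} (\<lambda>x. h x * h x) \<le> e * integral {0..1} (\<lambda>x. \<bar>h x\<bar>)" if e: "e > 0" for e
  proof -
    obtain q where q: "real_polynomial_function q" "\<And>x. x \<in> {0..1} \<Longrightarrow> \<bar>h x - q x\<bar> < e"
      using Stone_Weierstrass_real_polynomial_function[OF _ h e] by auto
    from q(1) obtain a n where an: "q = (\<lambda>x. \<Sum>i\<le>n. a i * x ^ i)"
      unfolding real_polynomial_function_iff_sum by blast
    have qi: "(\<lambda>x. q x * h x) integrable_on {0..1}" by (rule hi) (auto simp: an intro!: continuous_intros)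
    have "integral {0..1} (\<lambda>x. q x * h x) = integral {0..1} (\<lambda>x. \<Sum>i\<le>n. a i * (x ^ i * h x))"
      unfolding an by (intro integral_cong) (simp add: sum_distrib_right mult.assoc)
    also have "\<dots> = (\<Sum>i\<le>n. integral {0..1} (\<lambda>x. a i * (x ^ i * h x)))"
      by (intro integral_sum) (auto intro!: integrable_on_mult_right hi continuous_intros)
    also have "\<dots> = 0" using m by simp
    finally have q0: "integral {0..1} (\<lambda>x. q x * h x) = 0" .
    have "integral {0..1} (\<lambda>x. h x * h x) = integral {0..1} (\<lambda>x. h x * h x - q x * h x)"
      by (subst integral_diff[OF sq qi]) (simp add: q0)
    also have "\<dots> \<le> integral {0..1} (\<lambda>x. e * \<bar>h x\<bar>)"
    proof (intro integral_le integrable_diff sq qi)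
      show "(\<lambda>x. e * \<bar>h x\<bar>) integrable_on {0..1}" by (intro integrable_on_mult_right ab)
      fix x :: real assume x: "x \<in> {0..1}"
      have "h x * h x - q x * h x \<le> \<bar>h x - q x\<bar> * \<bar>h x\<bar>"
        by (metis abs_ge_self abs_mult left_diff_distrib)
      also have "\<dots> \<le> e * \<bar>h x\<bar>" using q(2)[OF x] by (intro mult_right_mono) auto
      finally show "h x * h x - q x * h x \<le> e * \<bar>h x\<bar>" .
    qed
    also have "\<dots> = e * integral {0..1} (\<lambda>x. \<bar>h x\<bar>)" by simp
    finally show ?thesis .
  qed
  note bd = this
  have "integral {0..1} (\<lambda>x. h x * h x) \<le> 0"
  proof (rule field_le_epsilon)
    fix e :: real assume e: "e > 0"
    define I where "I = integral {0..1} (\<lambda>x. \<bar>h x\<bar>)"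
    have I: "I \<ge> 0" unfolding I_def by (intro integral_nonneg ab) auto
    have "integral {0..1} (\<lambda>x. h x * h x) \<le> e / (I + 1) * I" unfolding I_def[symmetric]
      using bd[of "e / (I + 1)"] e I by (simp add: I_def[symmetric])
    also have "\<dots> \<le> 0 + e" using e I by (simp add: field_simps)
    finally show "integral {0..1} (\<lambda>x. h x * h x) \<le> 0 + e" .
  qed
  moreover have "integral {0..1} (\<lambda>x. h x * h x) \<ge> 0" by (intro integral_nonneg sq) auto
  ultimately have "integral {0..1} (\<lambda>x. h x * h x) = 0" by simp
  then have "\<forall>x\<in>{0..1}. h x * h x = 0"
    by (subst (asm) integral_eq_0_iff) (auto intro!: continuous_intros h)
  with x show ?thesis by simp
qed

text \<open>
  The integrand of the beta function \<open>B(c, d - c)\<close>. Its \<open>j\<close>-th moment is a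
  constant multiple of \<open>(c)\<^sub>j / (d)\<^sub>j\<close>.
\<close>
definition beta_kernel :: "complex \<Rightarrow> complex \<Rightarrow> real \<Rightarrow> complex" where
  "beta_kernel c d x = of_real x powr (c - 1) * of_real (1 - x) powr (d - c - 1)"

lemma continuous_on_real_powr:
  assumes "Re z > 0"
  shows "continuous_on {0..1} (\<lambda>x::real. complex_of_real x powr z)"
    and "continuous_on {0..1} (\<lambda>x::real. complex_of_real (1 - x) powr z)"
  using assms by (auto intro!: continuous_on_powr_complex continuous_intros)

lemma continuous_on_beta_kernel:
  assumes "Re c > 1" "Re (d - c) > 1"
  shows "continuous_on {0..1} (beta_kernel c d)"
  unfolding beta_kernel_def[abs_def] using assms by (intro continuous_on_mult continuous_on_real_powr) auto

text \<open>
  Integrate the derivative of \<open>x\<^bsup>c+j\<^esup> (1 - x)\<^bsup>d-c\<^esup>\<close>, which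
  vanishes at both ends.
\<close>
lemma beta_kernel_moment_Suc:
  assumes c: "Re c > 1" "Re (d - c) > 1"
  shows "(d + of_nat j) * integral {0..1} (\<lambda>x. of_real x ^ Suc j * beta_kernel c d x) =
         (c + of_nat j) * integral {0..1} (\<lambda>x. of_real x ^ j * beta_kernel c d x)"
proof -
  define f where "f x = of_real x ^ j * (of_real x powr c * of_real (1 - x) powr (d - c))" for x :: real
  define f' where "f' x = (c + of_nat j) * (of_real x ^ j * beta_kernel c d x) - (d + of_nat j) * (of_real x ^ Suc j * beta_kernel c d x)" for x :: real
  have int: "(\<lambda>x. of_real x ^ i * beta_kernel c d x) integrable_on {0..1}" for i
    by (intro integrable_continuous_real continuous_intros continuous_on_beta_kernel c)
  have "(f' has_integral (f 1 - f 0)) {0..1}"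
  proof (rule fundamental_theorem_of_calculus_interior)
    show "continuous_on {0..1} f" unfolding f_def
      using c by (intro continuous_on_mult continuous_on_real_powr continuous_intros) auto
    fix x :: real assume x: "x \<in> {0<..<1}"
    define X where "X = complex_of_real x"
    have X: "X \<notin> \<real>\<^sub>\<le>\<^sub>0" "1 - X \<notin> \<real>\<^sub>\<le>\<^sub>0" "X \<noteq> 0" "1 - X \<noteq> 0"
      using x by (auto simp: X_def complex_nonpos_Reals_iff complex_eq_iff)
    define A B where "A = X powr (c - 1)" and "B = (1 - X) powr (d - c - 1)"
    have p: "X powr c = X * A" "(1 - X) powr (d - c) = (1 - X) * B"
      using X by (simp_all add: A_def B_def powr_diff)
    have "((\<lambda>z. z ^ j * (z powr c * (1 - z) powr (d - c))) has_field_derivative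
        (of_nat j * X ^ (j - 1) * (X powr c * (1 - X) powr (d - c)) +
         X ^ j * (c * A * (1 - X) powr (d - c) - X powr c * ((d - c) * B)))) (at X)"
      unfolding A_def B_def using X by (auto intro!: derivative_eq_intros simp: algebra_simps)
    also have "of_nat j * X ^ (j - 1) * (X powr c * (1 - X) powr (d - c)) +
         X ^ j * (c * A * (1 - X) powr (d - c) - X powr c * ((d - c) * B)) = f' x"
      unfolding p f'_def beta_kernel_def X_def[symmetric] of_real_diff of_real_1 A_def[symmetric] B_def[symmetric]
      by (cases j) (auto simp: algebra_simps)
    finally have "((\<lambda>z. z ^ j * (z powr c * (1 - z) powr (d - c))) has_field_derivative f' x) (at (of_real x))"
      by (simp add: X_def)
    from has_vector_derivative_real_field[OF this]
    show "(f has_vector_derivative f' x) (at x)" by (simp add: f_def[abs_def])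
  qed auto
  moreover have "f 1 = 0" "f 0 = 0" using c by (auto simp: f_def)
  ultimately have "integral {0..1} f' = 0" by (simp add: integral_unique)
  moreover have "integral {0..1} f' = (c + of_nat j) * integral {0..1} (\<lambda>x. of_real x ^ j * beta_kernel c d x) -
      (d + of_nat j) * integral {0..1} (\<lambda>x. of_real x ^ Suc j * beta_kernel c d x)"
    unfolding f'_def by (subst integral_diff) (use int[of j] int[of "Suc j"] in \<open>auto intro!: integrable_on_mult_right simp del: power_Suc\<close>)
  ultimately show ?thesis by simp
qed

lemma beta_kernel_moment:
  assumes c: "Re c > 1" "Re (d - c) > 1"
  shows "integral {0..1} (\<lambda>x. of_real x ^ j * beta_kernel c d x) =
         integral {0..1} (beta_kernel c d) * (pochhammer c j / pochhammer d j)"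
proof (induction j)
  case (Suc j)
  have nz: "d + of_nat j \<noteq> 0"
  proof
    assume "d + of_nat j = 0"
    then have "Re (d + of_nat j) = 0" by simp
    then show False using c by auto
  qed
  have "integral {0..1} (\<lambda>x. of_real x ^ Suc j * beta_kernel c d x) =
      integral {0..1} (\<lambda>x. of_real x ^ j * beta_kernel c d x) * ((c + of_nat j) / (d + of_nat j))"
    using beta_kernel_moment_Suc[OF c, of j] nz by (simp add: field_simps)
  then show ?case unfolding Suc.IH by (simp add: pochhammer_Suc)
qed auto

text \<open>
  If the integral vanished, so would all moments of the kernel by the recurrence, and then the
  kernel itself.
\<close>
lemma beta_kernel_integral_nonzero:
  assumes c: "Re c > 1" "Re (d - c) > 1"
  shows "integral {0..1} (beta_kernel c d) \<noteq> 0"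
proof
  assume "integral {0..1} (beta_kernel c d) = 0"
  then have m: "integral {0..1} (\<lambda>x. of_real x ^ j * beta_kernel c d x) = 0" for j
    using beta_kernel_moment[OF c] by simp
  have cont: "continuous_on {0..1} (beta_kernel c d)" by (rule continuous_on_beta_kernel[OF c])
  have int: "(\<lambda>x. of_real x ^ j * beta_kernel c d x) integrable_on {0..1}" for j
    by (intro integrable_continuous_real continuous_intros cont)
  have "integral {0..1} (\<lambda>x. x ^ j * Re (beta_kernel c d x)) = 0" for j
  proof -
    have "integral {0..1} (\<lambda>x. x ^ j * Re (beta_kernel c d x)) = integral {0..1} (Re \<circ> (\<lambda>x. of_real x ^ j * beta_kernel c d x))"
      by (intro integral_cong) (simp flip: of_real_power)
    also have "\<dots> = Re (integral {0..1} (\<lambda>x. of_real x ^ j * beta_kernel c d x))"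
      by (rule integral_linear[OF int bounded_linear_Re])
    finally show ?thesis by (simp add: m)
  qed
  then have R: "Re (beta_kernel c d (1/2)) = 0"
    by (intro moments_zero_imp_zero[of "\<lambda>x. Re (beta_kernel c d x)"]) (auto intro!: continuous_intros cont)
  have "integral {0..1} (\<lambda>x. x ^ j * Im (beta_kernel c d x)) = 0" for j
  proof -
    have "integral {0..1} (\<lambda>x. x ^ j * Im (beta_kernel c d x)) = integral {0..1} (Im \<circ> (\<lambda>x. of_real x ^ j * beta_kernel c d x))"
      by (intro integral_cong) (simp flip: of_real_power)
    also have "\<dots> = Im (integral {0..1} (\<lambda>x. of_real x ^ j * beta_kernel c d x))"
      by (rule integral_linear[OF int bounded_linear_Im])
    finally show ?thesis by (simp add: m)
  qed
  then have I: "Im (beta_kernel c d (1/2)) = 0"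
    by (intro moments_zero_imp_zero[of "\<lambda>x. Im (beta_kernel c d x)"]) (auto intro!: continuous_intros cont)
  have "beta_kernel c d (1/2) = 0" using R I by (simp add: complex_eq_iff)
  then show False by (simp add: beta_kernel_def)
qed

text \<open>
  Multiplication of the coefficients by \<open>(c)\<^sub>k / (d)\<^sub>k\<close> is, up to a
  constant, the integral transform \<open>F \<mapsto> \<integral>\<^sub>0\<^sup>1 F(x w)
  x\<^bsup>c-1\<^esup> (1 - x)\<^bsup>d-c-1\<^esup> dx\<close>, which preserves holomorphy on a
  domain that is star-shaped about \<open>0\<close>. The lower bounds on the real parts make the
  kernel continuous.
\<close>
lemma cut_series_beta:
  assumes f: "cut_series f" and c: "Re c > 1" "Re (d - c) > 1"
  shows "cut_series (\<lambda>k. f k * (pochhammer c k / pochhammer d k))"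
proof -
  obtain F where F: "F holomorphic_on cut_plane" "F has_fps_expansion Abs_fps f"
    using f unfolding cut_series_def by blast
  have cont: "continuous_on {0..1} (beta_kernel c d)" by (rule continuous_on_beta_kernel[OF c])
  have g: "set_integrable lborel {0..1} (beta_kernel c d)" by (rule borel_integrable_atLeastAtMost'[OF cont])
  define G where "G z = (LINT x:{0..1}|lborel. F (of_real x * z) * beta_kernel c d x)" for z
  have hol: "G holomorphic_on cut_plane" unfolding G_def[abs_def]
    by (rule holomorphic_integral_dilate(1)[OF F(1) open_cut_plane dilate_cut_plane g]) auto
  define m where "m = integral {0..1} (beta_kernel c d)"
  have Fsums: "(\<lambda>n. f n * z ^ n) sums F z" if "norm z < 1" for z
    using has_fps_expansion_imp_sums_complex[OF F(2), of 1 z] that ball_subset_cut_plane F(1)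
    by (simp add: one_ereal_def holomorphic_on_subset)
  have "G has_fps_expansion Abs_fps (\<lambda>k. m * (f k * (pochhammer c k / pochhammer d k)))"
  proof (rule has_fps_expansionI)
    have "\<forall>\<^sub>F w in nhds 0. w \<in> ball (0::complex) 1" by (intro eventually_nhds_in_open) auto
    then show "\<forall>\<^sub>F w in nhds 0. (\<lambda>n. fps_nth (Abs_fps (\<lambda>k. m * (f k * (pochhammer c k / pochhammer d k)))) n * w ^ n) sums G w"
    proof eventually_elim
      case (elim w)
      obtain r where r: "norm w < r" "r < 1" using elim dense by auto
      have "summable (\<lambda>n. f n * of_real r ^ n)" using Fsums[of "of_real r"] r norm_ge_zero[of w] by (simp add: sums_iff)
      then have B: "summable (\<lambda>n. norm (f n * w ^ n))" by (rule powser_insidea) (use r in auto)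
      have "(\<lambda>n. LINT x:{0..1}|lborel. f n * (of_real x * w) ^ n * beta_kernel c d x) sums G w"
        unfolding G_def
      proof (rule sums_set_integral_bounded(2)[OF g _ _ _ B])
        fix n x assume x: "x \<in> {0..1::real}"
        have "norm (of_real x * w) \<le> 1 * norm w" unfolding norm_mult using x by (intro mult_right_mono) auto
        then show "norm (f n * (of_real x * w) ^ n) \<le> norm (f n * w ^ n)"
          by (auto simp: norm_mult norm_power intro!: mult_left_mono power_mono)
      next
        fix x assume x: "x \<in> {0..1::real}"
        have "norm (of_real x * w) \<le> 1 * norm w" unfolding norm_mult using x by (intro mult_right_mono) auto
        then show "(\<lambda>n. f n * (of_real x * w) ^ n) sums F (of_real x * w)" using elim by (intro Fsums) auto
      qed (auto intro!: continuous_intros)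
      moreover have "(LINT x:{0..1}|lborel. f n * (of_real x * w) ^ n * beta_kernel c d x) =
          m * (f n * (pochhammer c n / pochhammer d n)) * w ^ n" for n
      proof -
        have ci: "continuous_on {0..1} (\<lambda>x. of_real x ^ n * beta_kernel c d x)"
          by (intro continuous_intros cont)
        have "(LINT x:{0..1}|lborel. f n * (of_real x * w) ^ n * beta_kernel c d x) =
            (LINT x:{0..1}|lborel. (f n * w ^ n) * (of_real x ^ n * beta_kernel c d x))"
          by (intro set_lebesgue_integral_cong) (auto simp: power_mult_distrib)
        also have "\<dots> = (f n * w ^ n) * integral {0..1} (\<lambda>x. of_real x ^ n * beta_kernel c d x)"
          using set_borel_integral_eq_integral(2)[OF borel_integrable_atLeastAtMost'[OF ci]] by simp
        finally show ?thesis unfolding beta_kernel_moment[OF c] m_def by (simp add: mult_ac)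
      qed
      ultimately show ?case by simp
    qed
  qed
  with hol have "cut_series (\<lambda>k. m * (f k * (pochhammer c k / pochhammer d k)))"
    unfolding cut_series_def by blast
  from cut_series_cmult[OF this, of "inverse m"] show ?thesis
    by (rule cut_series_cong) (use beta_kernel_integral_nonzero[OF c] in \<open>simp add: m_def\<close>)
qed

lemma pochhammer_nonzero: "- d \<notin> \<nat> \<Longrightarrow> pochhammer d k \<noteq> (0::complex)"
  by (auto simp: pochhammer_eq_0_iff)

text \<open>
  Reduction to parameters with large real parts. Dropping the first \<open>K\<close> coefficients
  replaces \<open>c, d\<close> by \<open>c + K, d + K\<close>, and \<open>1 / (d)\<^sub>k\<close> is
  a constant multiple of \<open>(d + k)\<^sub>L / (d + L)\<^sub>k\<close>, where the numerator is a
  product of \<open>L\<close> linear factors in \<open>k\<close>.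
\<close>
lemma cut_series_pochhammer_ratio:
  assumes f: "cut_series f" and d: "- d \<notin> \<nat>"
  shows "cut_series (\<lambda>k. f k * (pochhammer c k / pochhammer d k))"
proof -
  obtain K where K: "real K > 1 - Re c" using reals_Archimedean2 by blast
  obtain L where L: "real L > 1 - Re (d - c)" using reals_Archimedean2 by blast
  define c' d' where "c' = c + of_nat K" and "d' = d + of_nat K"
  have nz: "pochhammer d k \<noteq> 0" for k using d by (rule pochhammer_nonzero)
  have "cut_series (\<lambda>k. f (k + K))" using f cut_series_tail by blast
  then have "cut_series (\<lambda>k. f (k + K) * (pochhammer c' k / pochhammer (d' + of_nat L) k))"
    by (rule cut_series_beta) (use K L in \<open>auto simp: c'_def d'_def\<close>)
  from cut_series_pochhammer_factor[OF this, of d' L]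
  have "cut_series (\<lambda>k. pochhammer c K / pochhammer d K / pochhammer d' L *
      (pochhammer (of_nat k + d') L * (f (k + K) * (pochhammer c' k / pochhammer (d' + of_nat L) k))))"
    by (rule cut_series_cmult)
  then have "cut_series (\<lambda>k. f (k + K) * (pochhammer c (k + K) / pochhammer d (k + K)))"
  proof (rule cut_series_cong)
    fix k
    have c: "pochhammer c (k + K) = pochhammer c K * pochhammer c' k"
      by (metis add.commute c'_def pochhammer_product')
    have d: "pochhammer d (k + K) = pochhammer d K * pochhammer d' k"
      by (metis add.commute d'_def pochhammer_product')
    have e: "pochhammer d' k * pochhammer (of_nat k + d') L = pochhammer d' L * pochhammer (d' + of_nat L) k"
      by (metis add.commute pochhammer_product')
    have d0: "pochhammer d' k \<noteq> 0" "pochhammer d' L \<noteq> 0" "pochhammer d K \<noteq> 0"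
      using nz[of "K + k"] nz[of "K + L"] by (auto simp: d'_def pochhammer_product')
    have "pochhammer (d' + of_nat L) k \<noteq> 0"
      using nz[of "(K + L) + k"] by (auto simp: d'_def pochhammer_product' add.assoc)
    with e d0 have "pochhammer (of_nat k + d') L / pochhammer (d' + of_nat L) k = pochhammer d' L / pochhammer d' k"
      by (simp add: field_simps)
    moreover have "x * (y * (z * (u / v))) = x * z * u * (y / v)" for x y z u v :: complex by simp
    ultimately have "pochhammer c K / pochhammer d K / pochhammer d' L *
      (pochhammer (of_nat k + d') L * (f (k + K) * (pochhammer c' k / pochhammer (d' + of_nat L) k))) =
      pochhammer c K / pochhammer d K / pochhammer d' L * f (k + K) * pochhammer c' k * (pochhammer d' L / pochhammer d' k)"
      by (simp only:)
    then show "f (k + K) * (pochhammer c (k + K) / pochhammer d (k + K)) = pochhammer c K / pochhammer d K / pochhammer d' L *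
      (pochhammer (of_nat k + d') L * (f (k + K) * (pochhammer c' k / pochhammer (d' + of_nat L) k)))"
      using d0 by (simp add: c d)
  qed
  then show ?thesis using cut_series_tail[of "\<lambda>k. f k * (pochhammer c k / pochhammer d k)" K] by simp
qed

definition hyp_coeff :: "complex list \<Rightarrow> complex list \<Rightarrow> nat \<Rightarrow> complex" where
  "hyp_coeff c d k = poch_vec c k / (poch_vec d k * fact k)"

lemma poch_vec_simps [simp]:
  "poch_vec [] k = 1" "poch_vec (x # v) k = pochhammer x k * poch_vec v k"
  "poch_vec (v @ v') k = poch_vec v k * poch_vec v' k"
  by (simp_all add: poch_vec_def)

lemma cut_series_hyp_coeff:
  assumes "length c = length d" "\<forall>x\<in>set d. - x \<notin> \<nat>"
  shows "cut_series (hyp_coeff (x # c) d)"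
  using assms
proof (induction c d rule: list_induct2)
  case Nil
  show ?case by (rule cut_series_cong[OF cut_series_binomial[of x]]) (simp add: hyp_coeff_def)
next
  case (Cons y c e d)
  have "cut_series (\<lambda>k. hyp_coeff (x # c) d k * (pochhammer y k / pochhammer e k))"
    using Cons by (intro cut_series_pochhammer_ratio) auto
  then show ?case by (rule cut_series_cong) (simp add: hyp_coeff_def mult_ac)
qed

lemma hyp_coeff_sums_cut:
  assumes "length c = length d + 1" "\<forall>x\<in>set d. - x \<notin> \<nat>"
  shows "\<exists>F. F holomorphic_on cut_plane \<and> (\<forall>w. norm w < 1 \<longrightarrow> (\<lambda>k. hyp_coeff c d k * w ^ k) sums F w)"
proof -
  obtain x c' where c: "c = x # c'" using assms(1) by (cases c) auto
  have "cut_series (hyp_coeff c d)" unfolding c by (rule cut_series_hyp_coeff) (use assms c in auto)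
  then obtain F where F: "F holomorphic_on cut_plane" "F has_fps_expansion Abs_fps (hyp_coeff c d)"
    unfolding cut_series_def by blast
  have "(\<lambda>n. hyp_coeff c d n * z ^ n) sums F z" if "norm z < 1" for z
    using has_fps_expansion_imp_sums_complex[OF F(2), of 1 z] that ball_subset_cut_plane F(1)
    by (simp add: one_ereal_def holomorphic_on_subset)
  with F(1) show ?thesis by blast
qed

text \<open>
  Appending parameters \<open>1\<close> to \<open>c\<close>, with \<open>(1)\<^sub>k = k!\<close>,
  leads to a series with radius of convergence at least one. So the coefficients themselves are
  bounded by a constant times \<open>2\<^sup>k / k!\<close>.
\<close>
lemma hyp_coeff_entire_summable:
  assumes "length c \<le> length d" "\<forall>x\<in>set d. - x \<notin> \<nat>"
  shows "summable (\<lambda>k. hyp_coeff c d k * w ^ k)"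
proof -
  define m where "m = length d - length c"
  define c' where "c' = c @ replicate (Suc m) 1"
  have c': "hyp_coeff c' d k = hyp_coeff c d k * fact k ^ Suc m" for k
  proof -
    have "poch_vec (replicate j 1) k = fact k ^ j" for j
      by (induction j) (auto simp: pochhammer_fact[symmetric])
    then show ?thesis by (simp add: hyp_coeff_def c'_def pochhammer_fact[symmetric])
  qed
  have len: "length c' = length d + 1" using assms(1) by (simp add: c'_def m_def)
  obtain F where F: "\<And>w. norm w < 1 \<Longrightarrow> (\<lambda>k. hyp_coeff c' d k * w ^ k) sums F w"
    using hyp_coeff_sums_cut[OF len assms(2)] by blast
  have "summable (\<lambda>k. hyp_coeff c' d k * (1/2) ^ k)" using F[of "1/2"] by (simp add: sums_iff norm_divide)
  then have "Bseq (\<lambda>k. hyp_coeff c' d k * (1/2) ^ k)"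
    by (intro convergent_imp_Bseq) (metis convergentI summable_LIMSEQ_zero)
  then obtain B where B: "B > 0" "\<And>k. norm (hyp_coeff c' d k * (1/2) ^ k) \<le> B" by (auto simp: Bseq_def)
  show ?thesis
  proof (rule summable_comparison_test'[of "\<lambda>k. B * (inverse (fact k) * (2 * norm w) ^ k)" 0])
    show "summable (\<lambda>k. B * (inverse (fact k) * (2 * norm w) ^ k))"
      by (intro summable_mult summable_exp)
    fix k
    have f1: "(1::real) \<le> fact k ^ m" by (simp add: one_le_power)
    have "norm (hyp_coeff c d k) * fact k \<le> norm (hyp_coeff c d k) * fact k * fact k ^ m"
      using mult_left_mono[OF f1, of "norm (hyp_coeff c d k) * fact k"] by simp
    also have "\<dots> = norm (hyp_coeff c' d k)" unfolding c' by (simp add: norm_mult norm_power)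
    also have "\<dots> \<le> B * 2 ^ k" using B(2)[of k] by (simp add: norm_mult norm_power norm_divide field_simps)
    finally have "norm (hyp_coeff c d k) \<le> B * 2 ^ k / fact k" by (simp add: field_simps)
    then have "norm (hyp_coeff c d k) * norm w ^ k \<le> B * 2 ^ k / fact k * norm w ^ k"
      by (intro mult_right_mono) auto
    then show "norm (hyp_coeff c d k * w ^ k) \<le> B * (inverse (fact k) * (2 * norm w) ^ k)"
      by (simp add: norm_mult norm_power power_mult_distrib field_simps)
  qed
qed

definition hyp_dom :: "complex list \<Rightarrow> complex list \<Rightarrow> complex set" where
  "hyp_dom c d = (if length c \<le> length d then UNIV else cut_plane)"

lemma hyp_dom_facts [simp]:
  "open (hyp_dom c d)" "connected (hyp_dom c d)" "ball 0 1 \<subseteq> hyp_dom c d"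
  by (auto simp: hyp_dom_def simp del: subset_ball intro: ball_subset_cut_plane[THEN subsetD])

lemma hyp_dom_shift [simp]: "hyp_dom (shift_vec c \<mu>) (shift_vec d \<nu>) = hyp_dom c d"
  by (simp add: hyp_dom_def shift_vec_def)

text \<open>
  In the case \<open>length c = length d + 1\<close> the choice operator has something to choose
  from by the construction of the continuation.
\<close>
lemma hypF_properties:
  assumes len: "length c \<le> length d + 1" and d: "\<forall>x\<in>set d. - x \<notin> \<nat>"
  shows hypF_holomorphic: "hypF c d holomorphic_on hyp_dom c d"
    and hypF_sums: "norm w < 1 \<Longrightarrow> (\<lambda>k. hyp_coeff c d k * w ^ k) sums hypF c d w"
proof -
  have "hypF c d holomorphic_on hyp_dom c d \<and> (\<forall>w. norm w < 1 \<longrightarrow> (\<lambda>k. hyp_coeff c d k * w ^ k) sums hypF c d w)"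
  proof (cases "length c \<le> length d")
    case True
    have s: "(\<lambda>k. hyp_coeff c d k * w ^ k) sums hypF c d w" for w
      using summable_sums[OF hyp_coeff_entire_summable[OF True d, of w]] True
      by (simp add: hypF_def hyp_series_def hyp_coeff_def)
    have "hypF c d holomorphic_on ball 0 (norm w + 1)" for w
      by (rule power_series_holomorphic[of _ _ "hyp_coeff c d"]) (use s in simp)
    then have "hypF c d field_differentiable at w" for w
      by (rule holomorphic_on_imp_differentiable_at[of _ "ball 0 (norm w + 1)"]) auto
    then have "hypF c d holomorphic_on UNIV" by (auto simp: holomorphic_on_def)
    with s True show ?thesis by (simp add: hyp_dom_def)
  next
    case False
    then have len': "length c = length d + 1" using len by simp
    obtain F where F: "F holomorphic_on cut_plane" "\<And>w. norm w < 1 \<Longrightarrow> (\<lambda>k. hyp_coeff c d k * w ^ k) sums F w"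
      using hyp_coeff_sums_cut[OF len' d] by blast
    have "F w = hyp_series c d w" if "norm w < 1" for w
      using F(2)[OF that] by (simp add: hyp_series_def hyp_coeff_def sums_iff)
    with F(1) have ex: "\<exists>f. f holomorphic_on cut_plane \<and> (\<forall>w. norm w < 1 \<longrightarrow> f w = hyp_series c d w)"
      by blast
    have "hypF c d holomorphic_on cut_plane \<and> (\<forall>w. norm w < 1 \<longrightarrow> hypF c d w = hyp_series c d w)"
      using someI_ex[OF ex] False by (simp add: hypF_def)
    moreover have "(\<lambda>k. hyp_coeff c d k * w ^ k) sums hyp_series c d w" if "norm w < 1" for w
      using F(2)[OF that] by (simp add: hyp_series_def hyp_coeff_def sums_iff)
    ultimately show ?thesis using False by (simp add: hyp_dom_def)
  qed
  then show "hypF c d holomorphic_on hyp_dom c d"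
    and "norm w < 1 \<Longrightarrow> (\<lambda>k. hyp_coeff c d k * w ^ k) sums hypF c d w" by auto
qed

lemma hypF_has_fps_expansion:
  assumes len: "length c \<le> length d + 1" and d: "\<forall>x\<in>set d. - x \<notin> \<nat>"
  shows "hypF c d has_fps_expansion Abs_fps (hyp_coeff c d)"
proof (rule has_fps_expansionI)
  have "\<forall>\<^sub>F w in nhds 0. w \<in> ball (0::complex) 1" by (intro eventually_nhds_in_open) auto
  then show "\<forall>\<^sub>F w in nhds 0. (\<lambda>n. fps_nth (Abs_fps (hyp_coeff c d)) n * w ^ n) sums hypF c d w"
    by eventually_elim (use hypF_sums[OF len d] in simp)
qed

lemma shift_vec_params: "\<forall>x\<in>set d. - x \<notin> \<nat> \<Longrightarrow> \<forall>x\<in>set (shift_vec d (of_nat j)). - x \<notin> \<nat>"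
proof
  fix y assume d: "\<forall>x\<in>set d. - x \<notin> \<nat>" and "y \<in> set (shift_vec d (of_nat j))"
  then obtain x where x: "x \<in> set d" "y = x + of_nat j" by (auto simp: shift_vec_def)
  show "- y \<notin> \<nat>"
  proof
    assume "- y \<in> \<nat>"
    then obtain m where m: "- y = of_nat m" by (auto elim: Nats_cases)
    have "- x = - y + of_nat j" using x by simp
    also have "\<dots> = of_nat (m + j)" by (simp only: m of_nat_add)
    finally show False using d x(1) by (metis of_nat_in_Nats)
  qed
qed

lemma poch_vec_0 [simp]: "poch_vec v 0 = 1"
  by (induction v) auto

lemma shift_vec_0 [simp]: "shift_vec v 0 = v"
  by (induction v) (auto simp: shift_vec_def)

lemma poch_vec_add: "poch_vec v (j + k) = poch_vec v j * poch_vec (shift_vec v (of_nat j)) k"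
  by (induction v) (auto simp: shift_vec_def pochhammer_product')

lemma shift_vec_add: "shift_vec (shift_vec v \<mu>) \<nu> = shift_vec v (\<mu> + \<nu>)"
  by (simp add: shift_vec_def add.assoc)

text \<open>
  Both sides have the same Taylor series at \<open>0\<close>; the identity theorem extends the
  equation to the whole domain.
\<close>
lemma deriv_hypF:
  assumes len: "length c \<le> length d + 1" and d: "\<forall>x\<in>set d. - x \<notin> \<nat>" and w: "w \<in> hyp_dom c d"
  shows "deriv (hypF c d) w = poch_vec c 1 / poch_vec d 1 * hypF (shift_vec c 1) (shift_vec d 1) w"
proof -
  let ?g = "\<lambda>w. poch_vec c 1 / poch_vec d 1 * hypF (shift_vec c 1) (shift_vec d 1) w"
  have len': "length (shift_vec c 1) \<le> length (shift_vec d 1) + 1" using len by (simp add: shift_vec_def)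
  have d': "\<forall>x\<in>set (shift_vec d 1). - x \<notin> \<nat>" using shift_vec_params[OF d, of 1] by simp
  have hol: "hypF c d holomorphic_on hyp_dom c d" by (rule hypF_holomorphic[OF len d])
  have hol': "hypF (shift_vec c 1) (shift_vec d 1) holomorphic_on hyp_dom c d"
    using hypF_holomorphic[OF len' d'] by simp
  have 1: "deriv (hypF c d) has_fps_expansion fps_deriv (Abs_fps (hyp_coeff c d))"
    by (intro has_fps_expansion_deriv hypF_has_fps_expansion len d)
  have "?g has_fps_expansion fps_const (poch_vec c 1 / poch_vec d 1) * Abs_fps (hyp_coeff (shift_vec c 1) (shift_vec d 1))"
    by (intro fps_expansion_intros hypF_has_fps_expansion len' d')
  also have "fps_const (poch_vec c 1 / poch_vec d 1) * Abs_fps (hyp_coeff (shift_vec c 1) (shift_vec d 1)) =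
      fps_deriv (Abs_fps (hyp_coeff c d))"
  proof (rule fps_ext)
    fix k
    have "fact (Suc k) = of_nat (Suc k) * (fact k :: complex)" by simp
    then show "fps_nth (fps_const (poch_vec c 1 / poch_vec d 1) * Abs_fps (hyp_coeff (shift_vec c 1) (shift_vec d 1))) k =
       fps_nth (fps_deriv (Abs_fps (hyp_coeff c d))) k"
      using poch_vec_add[of c 1 k, unfolded of_nat_1] poch_vec_add[of d 1 k, unfolded of_nat_1]
      by (simp add: hyp_coeff_def del: fact_Suc of_nat_Suc)
  qed
  finally have 2: "?g has_fps_expansion fps_deriv (Abs_fps (hyp_coeff c d))" .
  have s1: "(\<lambda>n. fps_nth (fps_deriv (Abs_fps (hyp_coeff c d))) n * z ^ n) sums deriv (hypF c d) z" if "z \<in> ball 0 1" for z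
    by (rule has_fps_expansion_imp_sums_complex[OF 1, of 1])
       (use that in \<open>auto simp: one_ereal_def intro!: holomorphic_deriv holomorphic_on_subset[OF hol] hyp_dom_facts(3)[THEN subsetD]\<close>)
  have s2: "(\<lambda>n. fps_nth (fps_deriv (Abs_fps (hyp_coeff c d))) n * z ^ n) sums ?g z" if "z \<in> ball 0 1" for z
    by (rule has_fps_expansion_imp_sums_complex[OF 2, of 1])
       (use that in \<open>auto simp: one_ereal_def intro!: holomorphic_intros holomorphic_on_subset[OF hol'] hyp_dom_facts(3)[THEN subsetD]\<close>)
  show ?thesis
  proof (rule analytic_continuation_open[of "ball 0 1" "hyp_dom c d" "deriv (hypF c d)" ?g])
    show "deriv (hypF c d) z = ?g z" if "z \<in> ball 0 1" for z
      using s1[OF that] s2[OF that] by (rule sums_unique2)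
  qed (use w hol hol' in \<open>auto intro!: holomorphic_intros holomorphic_deriv hyp_dom_facts(3)[THEN subsetD]\<close>)
qed

lemma higher_deriv_hypF:
  assumes len: "length c \<le> length d + 1" and d: "\<forall>x\<in>set d. - x \<notin> \<nat>" and w: "w \<in> hyp_dom c d"
  shows "(deriv ^^ j) (hypF c d) w =
     poch_vec c j / poch_vec d j * hypF (shift_vec c (of_nat j)) (shift_vec d (of_nat j)) w"
  using w
proof (induction j arbitrary: w)
  case 0
  then show ?case by simp
next
  case (Suc j)
  let ?c = "shift_vec c (of_nat j)" and ?d = "shift_vec d (of_nat j)"
  have len': "length ?c \<le> length ?d + 1" using len by (simp add: shift_vec_def)
  have d': "\<forall>x\<in>set ?d. - x \<notin> \<nat>" by (rule shift_vec_params[OF d])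
  have "(deriv ^^ Suc j) (hypF c d) w = deriv ((deriv ^^ j) (hypF c d)) w" by simp
  also have "\<dots> = deriv (\<lambda>w. poch_vec c j / poch_vec d j * hypF ?c ?d w) w"
  proof (rule deriv_cong_ev)
    have "\<forall>\<^sub>F w in nhds w. w \<in> hyp_dom c d" by (intro eventually_nhds_in_open) (use Suc.prems in auto)
    then show "\<forall>\<^sub>F w in nhds w. (deriv ^^ j) (hypF c d) w = poch_vec c j / poch_vec d j * hypF ?c ?d w"
      by eventually_elim (rule Suc.IH)
  qed auto
  also have "\<dots> = poch_vec c j / poch_vec d j * deriv (hypF ?c ?d) w"
    by (rule deriv_cmult, rule holomorphic_on_imp_differentiable_at[OF hypF_holomorphic[OF len' d']])
       (use Suc.prems in auto)
  also have "deriv (hypF ?c ?d) w = poch_vec ?c 1 / poch_vec ?d 1 * hypF (shift_vec ?c 1) (shift_vec ?d 1) w"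
    by (rule deriv_hypF[OF len' d']) (use Suc.prems in simp)
  finally show ?case
    using poch_vec_add[of c j 1] poch_vec_add[of d j 1] by (simp add: shift_vec_add add.commute)
qed

text \<open>
  The terms are those of the Taylor series about \<open>-z\<close> at the point \<open>-z t = -z + z
  (1 - t)\<close>. All these points lie at distance at most \<open>\<bar>z\<bar>\<close> from the
  centre, strictly inside a disc contained in the domain.
\<close>
lemma hypF_taylor:
  assumes len: "length c \<le> length d + 1" and d: "\<forall>x\<in>set d. - x \<notin> \<nat>"
    and z: "length c \<le> length d \<or> Re z > - 1 / 2"
  defines "q \<equiv> \<lambda>j. z ^ j * poch_vec c j / (fact j * poch_vec d j) *
                 hypF (shift_vec c (of_nat j)) (shift_vec d (of_nat j)) (- z)"
  shows "summable (\<lambda>j. norm (q j))"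
    and "t \<in> {0..1} \<Longrightarrow> (\<lambda>j. q j * of_real (1 - t) ^ j) sums hypF c d (- z * of_real t)"
proof -
  have "\<exists>r. norm z < r \<and> ball (- z) r \<subseteq> hyp_dom c d"
  proof (cases "length c \<le> length d")
    case True
    then show ?thesis by (intro exI[of _ "norm z + 1"]) (simp add: hyp_dom_def)
  next
    case False
    then have re: "Re z > - 1 / 2" using z by simp
    \<comment> \<open>After squaring, this reads \<open>0 < 1 + 2 Re z\<close>.\<close>
    have "norm z < norm (1 + z)"
    proof (rule power2_less_imp_less)
      show "(norm z)\<^sup>2 < (norm (1 + z))\<^sup>2" unfolding cmod_power2 using re by (simp add: power2_sum)
    qed auto
    moreover have "ball (- z) (norm (1 + z)) \<subseteq> cut_plane"
    proof
      fix w assume "w \<in> ball (- z) (norm (1 + z))"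
      then have w: "norm (w + z) < norm (1 + z)" by (simp add: dist_norm norm_minus_commute)
      show "w \<in> cut_plane"
      proof (rule ccontr)
        assume "w \<notin> cut_plane"
        then have "Im w = 0" "1 \<le> Re w" by (auto simp: cut_plane_eq)
        then have "(norm (1 + z))\<^sup>2 \<le> (norm (w + z))\<^sup>2"
          unfolding cmod_power2 using re by (auto intro!: power_mono)
        then show False using w by (meson norm_ge_zero not_less power2_le_imp_le)
      qed
    qed
    ultimately show ?thesis using False by (intro exI[of _ "norm (1 + z)"]) (simp add: hyp_dom_def)
  qed
  then obtain r where r: "norm z < r" "ball (- z) r \<subseteq> hyp_dom c d" by blast
  have hol: "hypF c d holomorphic_on ball (- z) r"
    using hypF_holomorphic[OF len d] r(2) holomorphic_on_subset by blast
  have mz: "- z \<in> hyp_dom c d" using r le_less_trans[OF norm_ge_zero r(1)] by (meson centre_in_ball subsetD)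
  define p where "p j = (deriv ^^ j) (hypF c d) (- z) / fact j" for j
  have q: "q j = p j * z ^ j" for j
    unfolding q_def p_def higher_deriv_hypF[OF len d mz] by (simp add: mult_ac)
  \<comment> \<open>Convergence at a point slightly further out gives absolute convergence at distance \<open>\<bar>z\<bar>\<close>.\<close>
  obtain r' where r': "norm z < r'" "r' < r" using dense[OF r(1)] by blast
  have r'0: "r' > 0" using r'(1) norm_ge_zero[of z] by linarith
  have "(\<lambda>j. p j * ((- z + of_real r') - (- z)) ^ j) sums hypF c d (- z + of_real r')"
    unfolding p_def by (rule holomorphic_power_series[OF hol]) (use r' r'0 in \<open>simp add: dist_norm\<close>)
  then have "summable (\<lambda>j. p j * of_real r' ^ j)" by (simp add: sums_iff)
  then show "summable (\<lambda>j. norm (q j))" unfolding q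
    by (rule powser_insidea) (use r' r'0 in simp)
  show "(\<lambda>j. q j * of_real (1 - t) ^ j) sums hypF c d (- z * of_real t)" if t: "t \<in> {0..1}"
  proof -
    have "norm (z * of_real (1 - t)) \<le> norm z * 1"
      unfolding norm_mult norm_of_real using t by (intro mult_left_mono) auto
    moreover have eq: "- z * of_real t - (- z) = z * of_real (1 - t)" by (simp add: algebra_simps)
    moreover have "- z - - z * of_real t = - (z * of_real (1 - t))" by (simp add: algebra_simps)
    then have "dist (- z) (- z * of_real t) = norm (z * of_real (1 - t))" by (simp only: dist_norm norm_minus_cancel)
    ultimately have "- z * of_real t \<in> ball (- z) r" using r(1) by simp
    from holomorphic_power_series[OF hol this]
    have "(\<lambda>j. p j * (- z * of_real t - (- z)) ^ j) sums hypF c d (- z * of_real t)" by (simp add: p_def)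
    then show ?thesis unfolding eq q by (simp add: power_mult_distrib mult.assoc)
  qed
qed

section \<open>Decay of Gamma quotients on loops\<close>

text \<open>The common integrable majorant for the rays of all loops.\<close>
lemma integrable_one_plus_abs_powr:
  fixes e :: real
  assumes "e > 1"
  shows "integrable lborel (\<lambda>x::real. (1 + \<bar>x\<bar>) powr - e)"
proof -
  define f where "f x = (if x \<in> {1..} then x powr - e else 0)" for x :: real
  have fm: "f \<in> borel_measurable borel" unfolding f_def by measurable
  have hi: "(f has_integral (-(1 powr (- e + 1)) / (- e + 1))) UNIV"
    unfolding f_def has_integral_restrict_UNIV using has_integral_powr_to_inf[of "- e" 1] assms by simp
  have "integral\<^sup>N lborel f = ennreal (-(1 powr (- e + 1)) / (- e + 1))"
    by (rule nn_integral_has_integral_lborel[OF fm _ hi]) (auto simp: f_def)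
  then have f: "integrable lborel f"
    using fm by (intro integrableI_nonneg) (auto simp: f_def)
  have "integrable lborel (\<lambda>x. f (1 + 1 * x) + f (1 + (- 1) * x))"
    by (intro Bochner_Integration.integrable_add lborel_integrable_real_affine f) auto
  then show ?thesis
    by (rule Bochner_Integration.integrable_bound) (auto simp: f_def intro!: AE_I2)
qed

definition Gamma_poles :: "complex list \<Rightarrow> complex set" where
  "Gamma_poles \<alpha> = {w. \<exists>x\<in>set \<alpha>. \<exists>l::nat. x + w = - of_nat l}"

lemma Gamma_quot_holomorphic: "Gamma_quot \<alpha> \<beta> holomorphic_on - Gamma_poles \<alpha>"
proof -
  have 1: "(\<lambda>s. Gamma_vec (shift_vec \<alpha> s)) holomorphic_on - Gamma_poles \<alpha>"
  proof (induction \<alpha>)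
    case (Cons x \<alpha>)
    have "(\<lambda>s. Gamma (x + s) * Gamma_vec (shift_vec \<alpha> s)) holomorphic_on - Gamma_poles (x # \<alpha>)"
      by (intro holomorphic_intros holomorphic_on_subset[OF Cons])
         (auto simp: Gamma_poles_def elim!: nonpos_Ints_cases')
    then show ?case by (simp add: Gamma_vec_def shift_vec_def)
  qed (simp add: Gamma_vec_def shift_vec_def)
  have "(\<lambda>s. rGamma_vec (shift_vec \<beta> s)) holomorphic_on UNIV"
  proof (induction \<beta>)
    case (Cons y \<beta>)
    have "(\<lambda>s. rGamma (y + s) * rGamma_vec (shift_vec \<beta> s)) holomorphic_on UNIV"
      by (intro holomorphic_intros Cons)
    then show ?case by (simp add: rGamma_vec_def shift_vec_def)
  qed (simp add: rGamma_vec_def shift_vec_def)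
  then have 2: "(\<lambda>s. rGamma_vec (shift_vec \<beta> s)) holomorphic_on - Gamma_poles \<alpha>"
    by (rule holomorphic_on_subset) auto
  show ?thesis unfolding Gamma_quot_def[abs_def] by (intro holomorphic_on_mult 1 2)
qed

text \<open>
  The factor \<open>h\<close> compensates the power growth of the Gamma quotient and leaves a decay
  of order \<open>e\<close>.
\<close>
lemma Gamma_quot_mult_decay:
  fixes h :: "complex \<Rightarrow> complex"
  assumes len: "length \<alpha> = length \<beta>" and K: "compact K"
    and avoid: "\<And>s x. s \<in> K \<Longrightarrow> x \<in> set \<alpha> \<Longrightarrow> x + s \<notin> \<int>"
    and h: "\<And>Y. \<exists>C X0. \<forall>s. Re s \<le> X0 \<longrightarrow> \<bar>Im s\<bar> \<le> Y \<longrightarrow>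
        norm (h s) \<le> C * (- Re s) powr (- Re (sum_list \<alpha> - sum_list \<beta>) - e)"
  shows "\<exists>C M. C > 0 \<and> (\<forall>s\<in>K. \<forall>m\<ge>M. m > 0 \<and>
           norm (Gamma_quot \<alpha> \<beta> (s - of_nat m) * h (s - of_nat m)) \<le> C * real m powr - e)"
proof -
  define D where "D = Re (sum_list \<alpha> - sum_list \<beta>)"
  obtain C1 M1 where 1: "C1 > 0" "\<And>s m. s \<in> K \<Longrightarrow> m \<ge> M1 \<Longrightarrow> m > 0"
     "\<And>s m. s \<in> K \<Longrightarrow> m \<ge> M1 \<Longrightarrow> norm (Gamma_quot \<alpha> \<beta> (s - of_nat m)) \<le> C1 * real m powr D"
    using Gamma_quot_bound_left_compact[OF len K avoid] unfolding D_def by blast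
  obtain B where B: "B > 0" "\<And>s. s \<in> K \<Longrightarrow> norm s \<le> B"
    using compact_imp_bounded[OF K] unfolding bounded_pos by blast
  obtain C2 X0 where 2: "\<And>s. Re s \<le> X0 \<Longrightarrow> \<bar>Im s\<bar> \<le> B \<Longrightarrow> norm (h s) \<le> C2 * (- Re s) powr (- D - e)"
    using h[of B] unfolding D_def by blast
  define p where "p = 2 powr \<bar>- D - e\<bar>"
  obtain M2 where M2: "real M2 \<ge> 2 * B + \<bar>X0\<bar>" using real_arch_simple by blast
  show ?thesis
  proof (rule exI[of _ "C1 * (\<bar>C2\<bar> * p) + 1"], rule exI[of _ "max M1 M2"], intro conjI ballI allI impI)
    show "C1 * (\<bar>C2\<bar> * p) + 1 > 0" using 1(1) by (simp add: p_def add_nonneg_pos)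
    fix s m assume s: "s \<in> K" and m: "m \<ge> max M1 M2"
    show m0: "m > 0" using 1(2)[OF s] m by simp
    have rm: "real m \<ge> 2 * B + \<bar>X0\<bar>" using M2 m by linarith
    have re: "\<bar>Re s\<bar> \<le> B" "\<bar>Im s\<bar> \<le> B" using B(2)[OF s] abs_Re_le_cmod[of s] abs_Im_le_cmod[of s] by linarith+
    have "norm (h (s - of_nat m)) \<le> C2 * (- Re (s - of_nat m)) powr (- D - e)"
      by (rule 2) (use rm re B in auto)
    also have "\<dots> \<le> \<bar>C2\<bar> * (- Re (s - of_nat m)) powr (- D - e)" by (intro mult_right_mono) auto
    also have "\<dots> \<le> \<bar>C2\<bar> * (p * real m powr (- D - e))"
      unfolding p_def by (intro mult_left_mono powr_comparable) (use rm re B(1) m0 in auto)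
    finally have hb: "norm (h (s - of_nat m)) \<le> \<bar>C2\<bar> * (p * real m powr (- D - e))" .
    have "norm (Gamma_quot \<alpha> \<beta> (s - of_nat m) * h (s - of_nat m)) \<le>
        (C1 * real m powr D) * (\<bar>C2\<bar> * (p * real m powr (- D - e)))"
      unfolding norm_mult using 1(1) m by (intro mult_mono 1(3) hb s) auto
    also have "\<dots> = C1 * (\<bar>C2\<bar> * p) * (real m powr D * real m powr (- D - e))" by simp
    also have "real m powr D * real m powr (- D - e) = real m powr - e" by (simp flip: powr_add)
    also have "C1 * (\<bar>C2\<bar> * p) * real m powr - e \<le> (C1 * (\<bar>C2\<bar> * p) + 1) * real m powr - e"
      by (intro mult_right_mono) auto
    finally show "norm (Gamma_quot \<alpha> \<beta> (s - of_nat m) * h (s - of_nat m)) \<le> (C1 * (\<bar>C2\<bar> * p) + 1) * real m powr - e" .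
  qed
qed

lemma Ints_diff_of_nat_nonpos:
  assumes "z \<in> \<int>"
  shows "\<exists>m0. \<forall>m\<ge>m0. \<exists>l::nat. z - of_nat m = (- of_nat l :: complex)"
proof -
  obtain k where k: "z = of_int k" using assms by (auto elim: Ints_cases)
  show ?thesis
  proof (rule exI[of _ "nat k"], intro allI impI)
    fix m assume "m \<ge> nat k"
    then have "int m \<ge> k" by simp
    then have "of_int k - of_nat m = (- of_nat (nat (int m - k)) :: complex)"
      by (simp add: of_nat_nat)
    then show "\<exists>l::nat. z - of_nat m = - of_nat l" using k by blast
  qed
qed

text \<open>
  On rays and vertical segments off the poles the product is \<open>O(\<bar>Re
  s\<bar>\<^sup>-\<^sup>e)\<close> with \<open>e > 1\<close>. Far to the left only the poles of the
  Gamma factors matter.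
\<close>
lemma loop_decaying_Gamma_quot:
  fixes h :: "complex \<Rightarrow> complex"
  assumes len: "length \<alpha> = length \<beta>" and Z: "Gamma_poles \<alpha> \<subseteq> Z" "\<And>w. w \<in> Z - Gamma_poles \<alpha> \<Longrightarrow> X1 < Re w"
    and hol: "h holomorphic_on - Z" and e: "e > 1"
    and h: "\<And>Y. \<exists>C X0. \<forall>s. Re s \<le> X0 \<longrightarrow> \<bar>Im s\<bar> \<le> Y \<longrightarrow>
        norm (h s) \<le> C * (- Re s) powr (- Re (sum_list \<alpha> - sum_list \<beta>) - e)"
  shows "loop_decaying (\<lambda>s. Gamma_quot \<alpha> \<beta> s * h s) Z"
  unfolding loop_decaying_def
proof (intro conjI allI impI)
  let ?F = "\<lambda>s. Gamma_quot \<alpha> \<beta> s * h s"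
  show F: "?F holomorphic_on - Z"
    by (intro holomorphic_on_mult hol holomorphic_on_subset[OF Gamma_quot_holomorphic]) (use Z in auto)
  show "set_integrable lborel {..x0} (\<lambda>x. ?F (Complex x y))" if ray: "\<forall>x\<le>x0. Complex x y \<notin> Z" for x0 y
  proof -
    define K where "K = (\<lambda>u. Complex u y) ` {0..1}"
    have K: "compact K" unfolding K_def Complex_eq by (intro compact_continuous_image continuous_intros) auto
    have avoid: "x + s \<notin> \<int>" if "s \<in> K" "x \<in> set \<alpha>" for s x
    proof
      assume "x + s \<in> \<int>"
      then obtain m0 where m0: "\<And>m. m \<ge> m0 \<Longrightarrow> \<exists>l::nat. x + s - of_nat m = - of_nat l"
        using Ints_diff_of_nat_nonpos by blast
      obtain m1 where m1: "real m1 \<ge> Re s - x0" using real_arch_simple by blast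
      define m where "m = max m0 m1"
      have "s - of_nat m \<in> Gamma_poles \<alpha>"
        using m0[of m] that(2) unfolding Gamma_poles_def m_def by (auto simp: algebra_simps intro!: bexI[of _ x])
      moreover have "s - of_nat m = Complex (Re s - real m) y" using that(1) by (auto simp: K_def complex_eq_iff)
      moreover have "Re s - real m \<le> x0" using m1 by (simp add: m_def)
      ultimately show False using ray Z(1) by auto
    qed
    obtain C M where CM: "C > 0" "\<And>s m. s \<in> K \<Longrightarrow> m \<ge> M \<Longrightarrow> m > 0 \<and> norm (?F (s - of_nat m)) \<le> C * real m powr - e"
      using Gamma_quot_mult_decay[OF len K avoid h] by blast
    have cont: "continuous_on {..x0} (\<lambda>x. ?F (Complex x y))"
      by (rule continuous_on_horizontal[OF F]) (use ray in auto)
    define x1 where "x1 = min x0 (- real M - 1)"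
    have far: "norm (?F (Complex x y)) \<le> C * 2 powr \<bar>- e\<bar> * (1 + \<bar>x\<bar>) powr - e" if "x \<le> x1" for x
    proof -
      \<comment> \<open>Here \<open>x\<close> is the translate by \<open>-m\<close> of a point \<open>x + m\<close> of \<open>[0, 1]\<close>.\<close>
      define m where "m = nat \<lceil>- x\<rceil>"
      have xneg: "- x \<ge> real M + 1" using that by (simp add: x1_def)
      have m: "real m \<ge> - x" "real m < - x + 1" using xneg unfolding m_def by linarith+
      have mM: "m \<ge> M" using m(1) xneg by linarith
      have "Complex (x + real m) y \<in> K" unfolding K_def using m by auto
      from CM(2)[OF this mM] have "norm (?F (Complex (x + real m) y - of_nat m)) \<le> C * real m powr - e" by blast
      also have "Complex (x + real m) y - of_nat m = Complex x y" by (simp add: complex_eq_iff)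
      also have "real m powr - e \<le> 2 powr \<bar>- e\<bar> * (1 + \<bar>x\<bar>) powr - e"
        by (rule powr_comparable) (use m xneg in auto)
      finally show ?thesis using CM(1) by (simp add: mult_left_mono mult.assoc)
    qed
    have i1: "set_integrable lborel {..x1} (\<lambda>x. ?F (Complex x y))"
    proof (rule set_integrable_bound)
      show "set_integrable lborel {..x1} (\<lambda>x. C * 2 powr \<bar>- e\<bar> * (1 + \<bar>x\<bar>) powr - e)"
        unfolding set_integrable_def
        by (intro integrable_mult_indicator integrable_mult_right integrable_one_plus_abs_powr e) auto
      have "continuous_on {..x1} (\<lambda>x. ?F (Complex x y))"
        by (rule continuous_on_subset[OF cont]) (auto simp: x1_def)
      from borel_measurable_continuous_on_indicator[OF _ this]
      show "set_borel_measurable lborel {..x1} (\<lambda>x. ?F (Complex x y))" unfolding set_borel_measurable_def by simp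
      show "AE x in lborel. x \<in> {..x1} \<longrightarrow> norm (?F (Complex x y)) \<le> norm (C * 2 powr \<bar>- e\<bar> * (1 + \<bar>x\<bar>) powr - e)"
        using far CM(1) by (intro AE_I2) simp
    qed
    have "set_integrable lborel ({..x1} \<union> {x1..x0}) (\<lambda>x. ?F (Complex x y))"
      by (intro set_integrable_Un i1 borel_integrable_atLeastAtMost' continuous_on_subset[OF cont]) auto
    moreover have "{..x1} \<union> {x1..x0} = {..x0}" by (auto simp: x1_def)
    ultimately show ?thesis by simp
  qed
  show "\<exists>\<xi>. filterlim \<xi> at_bot sequentially \<and> (\<forall>m y. Complex (\<xi> m) y \<notin> Z) \<and>
        (\<forall>y0 y1. (\<lambda>m. contour_integral (linepath (Complex (\<xi> m) y0) (Complex (\<xi> m) y1)) ?F) \<longlonglongrightarrow> 0)"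
  proof -
    \<comment> \<open>A vertical line meets a pole of \<open>\<Gamma>(x + s)\<close> only if its abscissa is \<open>-Re x\<close> modulo one.\<close>
    have "finite ((\<lambda>x. frac (- Re x)) ` set \<alpha>)" by simp
    then obtain \<xi>0 where \<xi>0: "\<xi>0 \<in> {0<..<1::real}" "\<xi>0 \<notin> (\<lambda>x. frac (- Re x)) ` set \<alpha>"
      using infinite_Ioo[of "0::real" 1] by (metis finite_subset subsetI zero_less_one)
    have av: "x + s \<notin> \<int>" if "Re s = \<xi>0" "x \<in> set \<alpha>" for s x
    proof
      assume "x + s \<in> \<int>"
      then obtain k where "x + s = of_int k" by (auto elim: Ints_cases)
      then have "Re x + \<xi>0 = of_int k" using that(1) by (metis Re_complex_of_real complex_Re_of_int plus_complex.sel(1))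
      then have "- Re x = \<xi>0 + of_int (- k)" by simp
      then have "frac (- Re x) = \<xi>0" using \<xi>0(1) by (simp add: frac_unique_iff)
      then show False using \<xi>0(2) that(2) by auto
    qed
    obtain M0 where M0: "real M0 \<ge> 1 + \<bar>X1\<bar>" using real_arch_simple by blast
    define \<xi> where "\<xi> m = \<xi>0 - real (m + M0)" for m
    have eq: "Complex (\<xi> m) y = Complex \<xi>0 y - of_nat (m + M0)" for m y
      by (simp add: complex_eq_iff \<xi>_def)
    have "filterlim \<xi> at_bot sequentially" unfolding \<xi>_def by real_asymp
    moreover have nZ: "Complex (\<xi> m) y \<notin> Z" for m y
    proof
      assume inZ: "Complex (\<xi> m) y \<in> Z"
      have "\<not> X1 < \<xi> m" using M0 \<xi>0(1) by (auto simp: \<xi>_def)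
      then have "Complex (\<xi> m) y \<in> Gamma_poles \<alpha>" using Z(2)[of "Complex (\<xi> m) y"] inZ by auto
      then obtain x l where x: "x \<in> set \<alpha>" "x + Complex (\<xi> m) y = - of_nat l" by (auto simp: Gamma_poles_def)
      have "x + Complex \<xi>0 y = (x + Complex (\<xi> m) y) + of_nat (m + M0)" unfolding eq by simp
      also have "\<dots> \<in> \<int>" unfolding x(2) by simp
      finally show False using av[OF _ x(1)] by auto
    qed
    moreover have "(\<lambda>m. contour_integral (linepath (Complex (\<xi> m) y0) (Complex (\<xi> m) y1)) ?F) \<longlonglongrightarrow> 0" for y0 y1
    proof -
      define K where "K = closed_segment (Complex \<xi>0 y0) (Complex \<xi>0 y1)"
      have K: "compact K" by (simp add: K_def)
      have KRe: "Re s = \<xi>0" if "s \<in> K" for s using that by (auto simp: K_def closed_segment_same_Re)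
      obtain C M where CM: "C > 0" "\<And>s m. s \<in> K \<Longrightarrow> m \<ge> M \<Longrightarrow> m > 0 \<and> norm (?F (s - of_nat m)) \<le> C * real m powr - e"
        using Gamma_quot_mult_decay[OF len K av[OF KRe] h] by blast
      have bd: "norm (contour_integral (linepath (Complex (\<xi> m) y0) (Complex (\<xi> m) y1)) ?F) \<le>
          (C * real (m + M0) powr - e) * norm (Complex (\<xi> m) y1 - Complex (\<xi> m) y0)" if "m \<ge> M" for m
      proof (rule contour_integral_bound_linepath)
        have seg: "s \<in> - Z" if "s \<in> closed_segment (Complex (\<xi> m) y0) (Complex (\<xi> m) y1)" for s
          using nZ[of m "Im s"] that by (auto simp: closed_segment_same_Re complex_eq_iff)
             (metis complex.exhaust_sel)
        show "?F contour_integrable_on linepath (Complex (\<xi> m) y0) (Complex (\<xi> m) y1)"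
          using seg by (intro contour_integrable_continuous_linepath holomorphic_on_imp_continuous_on holomorphic_on_subset[OF F]) auto
        fix s assume s: "s \<in> closed_segment (Complex (\<xi> m) y0) (Complex (\<xi> m) y1)"
        have "s + of_nat (m + M0) \<in> K"
          using s unfolding K_def by (auto simp: closed_segment_same_Re \<xi>_def)
        from CM(2)[OF this, of "m + M0"] that
        show "norm (?F s) \<le> C * real (m + M0) powr - e" by simp
      qed (use CM(1) in auto)
      have lim: "(\<lambda>m. (C * real (m + M0) powr - e) * norm (Complex 0 (y1 - y0))) \<longlonglongrightarrow> 0"
      proof -
        have "(\<lambda>m. (C * real (m + M0) powr - e) * norm (Complex 0 (y1 - y0))) \<longlonglongrightarrow> (C * 0) * norm (Complex 0 (y1 - y0))"
          by (intro tendsto_intros tendsto_neg_powr filterlim_compose[OF filterlim_real_sequentially] filterlim_add_const_nat_at_top)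
             (use e in auto)
        then show ?thesis by simp
      qed
      show ?thesis
      proof (rule tendsto_norm_zero_cancel, rule tendsto_sandwich[OF _ _ tendsto_const lim])
        show "\<forall>\<^sub>F m in sequentially. norm (contour_integral (linepath (Complex (\<xi> m) y0) (Complex (\<xi> m) y1)) ?F)
           \<le> (C * real (m + M0) powr - e) * norm (Complex 0 (y1 - y0))"
          using eventually_ge_at_top[of M]
        proof eventually_elim
          case (elim m)
          have "Complex (\<xi> m) y1 - Complex (\<xi> m) y0 = Complex 0 (y1 - y0)" by (simp add: complex_eq_iff)
          then show ?case using bd[OF elim] by simp
        qed
      qed auto
    qed
    ultimately show ?thesis by blast
  qed
qed

section \<open>Mellin transforms and residues\<close>

lemma set_integral_powr_unit:
  fixes r :: real
  assumes "r < 1"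
  shows "set_integrable lborel {0<..<1} (\<lambda>t. t powr - r)"
    and "(LINT t:{0<..<1}|lborel. t powr - r) = 1 / (1 - r)"
proof -
  have "set_integrable lborel {0<..<1} (\<lambda>t. t powr ((1 - r) - 1) * (1 - t) powr (1 - 1))"
    by (rule set_integrable_subset[OF integrable_Beta]) (use assms in auto)
  then show i: "set_integrable lborel {0<..<1} (\<lambda>t. t powr - r)"
    by (rule set_integrable_cong[THEN iffD1, rotated -1]) auto
  have "((\<lambda>t. t powr - r) has_integral (1 powr (- r + 1) / (- r + 1))) {0..1}"
    by (rule has_integral_powr_from_0) (use assms in auto)
  then have "((\<lambda>t. t powr - r) has_integral (1 / (1 - r))) {0<..<1}"
    using has_integral_Icc_iff_Ioo[of "\<lambda>t. t powr - r" _ 0 1] by (simp add: add.commute)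
  then show "(LINT t:{0<..<1}|lborel. t powr - r) = 1 / (1 - r)"
    using set_borel_integral_eq_integral(2)[OF i] by (simp add: integral_unique)
qed

text \<open>
  Induction on \<open>j\<close>: writing \<open>1 - t\<close> for one factor expresses the integral
  by those for \<open>z\<close> and \<open>z - 1\<close>.
\<close>
lemma set_integral_beta_power:
  fixes z :: complex
  assumes z: "Re z < 1"
  shows "set_integrable lborel {0<..<1} (\<lambda>t. of_real (1 - t) ^ j * of_real t powr - z)" (is "?A j z")
    and "(LINT t:{0<..<1}|lborel. of_real (1 - t) ^ j * of_real t powr - z) = fact j / pochhammer (1 - z) (Suc j)" (is "?B j z")
proof -
  have cont: "continuous_on {0<..<1} (\<lambda>t. of_real t powr - z)" for z :: complex
    by (rule continuous_on_powr_complex) (auto intro!: continuous_intros)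
  have int: "?A j z" if z: "Re z < 1" for j z
  proof (rule set_integrable_bound[OF set_integral_powr_unit(1)[OF z]])
    have "continuous_on {0<..<1} (\<lambda>t. of_real (1 - t) ^ j * of_real t powr - z)"
      by (intro continuous_intros cont)
    from borel_measurable_continuous_on_indicator[OF _ this]
    show "set_borel_measurable lborel {0<..<1} (\<lambda>t. of_real (1 - t) ^ j * of_real t powr - z)"
      unfolding set_borel_measurable_def by simp
    show "AE t in lborel. t \<in> {0<..<1} \<longrightarrow> norm (of_real (1 - t) ^ j * of_real t powr - z) \<le> norm (t powr - Re z)"
    proof (intro AE_I2 impI)
      fix t :: real assume t: "t \<in> {0<..<1}"
      have "norm (of_real (1 - t) ^ j * of_real t powr - z) = (1 - t) ^ j * t powr - Re z"
        using t by (simp add: norm_mult norm_power norm_powr_real_powr del: of_real_diff)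
      also have "\<dots> \<le> 1 * t powr - Re z" using t by (intro mult_right_mono power_le_one) auto
      finally show "norm (of_real (1 - t) ^ j * of_real t powr - z) \<le> norm (t powr - Re z)" by simp
    qed
  qed
  show "?A j z" by (rule int[OF z])
  show "?B j z" using z
  proof (induction j arbitrary: z)
    case (0 z)
    have nz: "1 - z \<noteq> 0" using 0 by (auto simp: complex_eq_iff)
    have "((\<lambda>t. of_real t powr - z) has_integral (of_real 1 powr (1 - z) / (1 - z) - of_real 0 powr (1 - z) / (1 - z))) {0..1}"
    proof (rule fundamental_theorem_of_calculus_interior)
      show "continuous_on {0..1} (\<lambda>t. of_real t powr (1 - z) / (1 - z))"
        using 0 nz by (intro continuous_intros continuous_on_real_powr) auto
      fix t :: real assume t: "t \<in> {0<..<1}"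
      then have t': "of_real t \<notin> \<real>\<^sub>\<le>\<^sub>0" by (auto simp: complex_nonpos_Reals_iff)
      have "((\<lambda>w. w powr (1 - z) / (1 - z)) has_field_derivative (of_real t powr - z)) (at (of_real t))"
        using t' nz by (auto intro!: derivative_eq_intros)
      from has_vector_derivative_real_field[OF this]
      show "((\<lambda>t. of_real t powr (1 - z) / (1 - z)) has_vector_derivative (of_real t powr - z)) (at t)" by simp
    qed auto
    then have "((\<lambda>t. of_real t powr - z) has_integral (1 / (1 - z))) {0<..<1::real}"
      by (subst has_integral_Icc_iff_Ioo[symmetric]) simp
    then show ?case using set_borel_integral_eq_integral(2)[OF int[OF 0, of 0]] by (simp add: integral_unique)
  next
    case (Suc j z)
    have z1: "Re (z - 1) < 1" using Suc.prems by simp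
    have "of_real (1 - t) ^ Suc j * of_real t powr - z =
        of_real (1 - t) ^ j * of_real t powr - z - of_real (1 - t) ^ j * of_real t powr - (z - 1)" if "t \<in> {0<..<1}" for t
    proof -
      have "of_real t powr - (z - 1) = of_real t powr (- z) * (of_real t :: complex)"
        using that by (simp add: powr_diff[of _ 1 z, simplified] powr_minus field_simps)
      then show ?thesis by (simp add: algebra_simps)
    qed
    then have "(LINT t:{0<..<1}|lborel. of_real (1 - t) ^ Suc j * of_real t powr - z) =
        (LINT t:{0<..<1}|lborel. of_real (1 - t) ^ j * of_real t powr - z - of_real (1 - t) ^ j * of_real t powr - (z - 1))"
      by (intro set_lebesgue_integral_cong) auto
    also have "\<dots> = fact j / pochhammer (1 - z) (Suc j) - fact j / pochhammer (1 - (z - 1)) (Suc j)"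
      by (subst set_integral_diff(2)) (use int[OF Suc.prems, of j] int[OF z1, of j] Suc.IH[OF Suc.prems] Suc.IH[OF z1] in auto)
    also have "\<dots> = fact (Suc j) / pochhammer (1 - z) (Suc (Suc j))"
    proof -
      have nz: "1 - z + of_nat k \<noteq> 0" for k
      proof
        assume "1 - z + of_nat k = 0"
        then have "Re (1 - z + of_nat k) = 0" by simp
        then show False using Suc.prems by simp
      qed
      define P where "P = pochhammer (2 - z) j"
      have P0: "P \<noteq> 0"
      proof
        assume "P = 0"
        then obtain k where "2 - z = - of_nat k" unfolding P_def pochhammer_eq_0_iff by blast
        then have "1 - z + of_nat (Suc k) = 0" by (simp add: algebra_simps)
        then show False using nz by blast
      qed
      have 1: "pochhammer (1 - z) (Suc j) = (1 - z) * P"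
        by (simp add: pochhammer_rec P_def add.commute)
      have 2: "pochhammer (1 - (z - 1)) (Suc j) = P * (2 - z + of_nat j)"
        by (simp add: pochhammer_Suc P_def)
      have 3: "pochhammer (1 - z) (Suc (Suc j)) = (1 - z) * P * (2 - z + of_nat j)"
        by (simp add: pochhammer_Suc[of _ "Suc j"] 1 add.commute)
      have "2 - z + of_nat j \<noteq> 0" using nz[of "Suc j"] by (simp add: algebra_simps)
      then show ?thesis unfolding 1 2 3 using P0 nz[of 0] by (simp add: divide_simps) (simp add: algebra_simps)
    qed
    finally show ?case .
  qed
qed

text \<open>
  Interchange of the integration in \<open>t\<close> with that along a piece \<open>\<sigma>\<close>
  of a contour. For \<open>j = 0\<close> the integral of the absolute value over \<open>t\<close> is
  \<open>\<bar>\<phi>\<bar> / (1 - Re \<sigma>)\<close>, whose integrability is the hypothesis; the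
  factor \<open>(1 - t)\<^sup>j\<close> is bounded by one.
\<close>
lemma mellin_fubini:
  fixes \<sigma> \<phi> :: "real \<Rightarrow> complex"
  assumes S: "S \<in> sets borel" and \<sigma>: "continuous_on S \<sigma>" and \<phi>: "continuous_on S \<phi>"
    and less: "\<And>x. x \<in> S \<Longrightarrow> Re (\<sigma> x) < 1"
    and int: "set_integrable lborel S (\<lambda>x. norm (\<phi> x) / (1 - Re (\<sigma> x)))"
  shows "set_integrable lborel {0<..<1} (\<lambda>t. LINT x:S|lborel. \<phi> x * of_real t powr - \<sigma> x)"
    and "(LINT t:{0<..<1}|lborel. of_real (1 - t) ^ j * (LINT x:S|lborel. \<phi> x * of_real t powr - \<sigma> x)) =
         (LINT x:S|lborel. \<phi> x * (fact j / pochhammer (1 - \<sigma> x) (Suc j)))"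
proof -
  define f where "f j x t = indicator S x *\<^sub>R (indicator {0<..<1} t *\<^sub>R (of_real (1 - t) ^ j * (\<phi> x * of_real t powr - \<sigma> x)))" for j x and t :: real
  have meas: "case_prod (f j) \<in> borel_measurable (lborel \<Otimes>\<^sub>M lborel)" for j
  proof -
    have e: "of_real t powr - \<sigma> x = exp (- \<sigma> x * of_real (ln t))" if "t \<in> {0<..<1}" for t x
      using that by (simp add: powr_def Ln_of_real)
    have "continuous_on (S \<times> {0<..<1}) (\<lambda>p. of_real (1 - snd p) ^ j * (\<phi> (fst p) * exp (- \<sigma> (fst p) * of_real (ln (snd p)))))"
      by (intro continuous_intros continuous_on_compose2[OF \<phi>] continuous_on_compose2[OF \<sigma>]) auto
    from borel_measurable_continuous_on_indicator[OF _ this]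
    have "(\<lambda>p. indicator (S \<times> {0<..<1}) p *\<^sub>R (of_real (1 - snd p) ^ j * (\<phi> (fst p) * exp (- \<sigma> (fst p) * of_real (ln (snd p))))))
        \<in> borel_measurable borel"
      using S by (simp add: borel_Times)
    also have "(\<lambda>p. indicator (S \<times> {0<..<1}) p *\<^sub>R (of_real (1 - snd p) ^ j * (\<phi> (fst p) * exp (- \<sigma> (fst p) * of_real (ln (snd p)))))) =
        case_prod (f j)"
      by (auto simp: fun_eq_iff f_def indicator_def e)
    finally show ?thesis by (simp add: lborel_prod)
  qed
  have inner: "(LINT t|lborel. f j x t) = indicator S x *\<^sub>R (\<phi> x * (fact j / pochhammer (1 - \<sigma> x) (Suc j)))" for j x
  proof (cases "x \<in> S")
    case True
    have "(LINT t|lborel. f j x t) = (LINT t:{0<..<1}|lborel. \<phi> x * (of_real (1 - t) ^ j * of_real t powr - \<sigma> x))"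
      unfolding set_lebesgue_integral_def using True
      by (intro Bochner_Integration.integral_cong) (auto simp: f_def indicator_def)
    then show ?thesis using set_integral_beta_power(2)[OF less[OF True]] True by simp
  qed (simp add: f_def)
  have f_int: "integrable lborel (f j x)" for j x
  proof (cases "x \<in> S")
    case True
    have "set_integrable lborel {0<..<1} (\<lambda>t. \<phi> x * (of_real (1 - t) ^ j * of_real t powr - \<sigma> x))"
      by (intro set_integrable_mult_right) (use set_integral_beta_power(1)[OF less[OF True]] in auto)
    then show ?thesis using True by (simp add: f_def[abs_def] set_integrable_def mult_ac)
  qed (simp add: f_def[abs_def])
  have "integrable (lborel \<Otimes>\<^sub>M lborel) (case_prod (f 0))"
  proof (rule lborel_pair.Fubini_integrable[OF meas])
    have "(LINT t|lborel. norm (f 0 x t)) = indicator S x *\<^sub>R (norm (\<phi> x) / (1 - Re (\<sigma> x)))" for x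
    proof (cases "x \<in> S")
      case True
      have "(LINT t|lborel. norm (f 0 x t)) = (LINT t:{0<..<1}|lborel. norm (\<phi> x) * t powr - Re (\<sigma> x))"
        unfolding set_lebesgue_integral_def using True
        by (intro Bochner_Integration.integral_cong) (auto simp: f_def indicator_def norm_mult norm_powr_real_powr)
      then show ?thesis using set_integral_powr_unit(2)[OF less[OF True]] True by simp
    qed (simp add: f_def)
    then show "integrable lborel (\<lambda>x. LINT y|lborel. norm (case (x, y) of (x, y) \<Rightarrow> f 0 x y))"
      using int by (simp add: set_integrable_def)
  qed (use f_int in auto)
  then have fi: "integrable (lborel \<Otimes>\<^sub>M lborel) (case_prod (f j))" for j
  proof (rule Bochner_Integration.integrable_bound[OF _ meas])
    show "AE p in lborel \<Otimes>\<^sub>M lborel. norm (case_prod (f j) p) \<le> norm (case_prod (f 0) p)"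
    proof (intro AE_I2)
      fix p :: "real \<times> real"
      obtain x t where p: "p = (x, t)" by (cases p)
      show "norm (case_prod (f j) p) \<le> norm (case_prod (f 0) p)"
      proof (cases "t \<in> {0<..<1}")
        case True
        have "norm ((of_real (1 - t) :: complex) ^ j) \<le> 1"
          using True by (simp add: norm_power power_le_one del: of_real_diff)
        then have "norm (of_real (1 - t) ^ j * (\<phi> x * of_real t powr - \<sigma> x)) \<le> 1 * norm (\<phi> x * of_real t powr - \<sigma> x)"
          unfolding norm_mult[of "of_real (1 - t) ^ j"] by (intro mult_right_mono) auto
        then show ?thesis by (simp add: p f_def indicator_def)
      qed (simp add: p f_def)
    qed
  qed
  have outer: "(LINT x|lborel. f j x t) = indicator {0<..<1} t *\<^sub>R (of_real (1 - t) ^ j * (LINT x:S|lborel. \<phi> x * of_real t powr - \<sigma> x))" for j t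
  proof (cases "t \<in> {0<..<1}")
    case True
    have "(LINT x|lborel. f j x t) = (LINT x:S|lborel. of_real (1 - t) ^ j * (\<phi> x * of_real t powr - \<sigma> x))"
      unfolding set_lebesgue_integral_def using True
      by (intro Bochner_Integration.integral_cong) (auto simp: f_def indicator_def)
    then show ?thesis using True by simp
  qed (simp add: f_def)
  show "set_integrable lborel {0<..<1} (\<lambda>t. LINT x:S|lborel. \<phi> x * of_real t powr - \<sigma> x)"
    using lborel_pair.integrable_snd[OF fi[of 0]] unfolding outer by (simp add: set_integrable_def)
  show "(LINT t:{0<..<1}|lborel. of_real (1 - t) ^ j * (LINT x:S|lborel. \<phi> x * of_real t powr - \<sigma> x)) =
         (LINT x:S|lborel. \<phi> x * (fact j / pochhammer (1 - \<sigma> x) (Suc j)))"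
    using lborel_pair.Fubini_integral[OF fi[of j]] unfolding outer inner by (simp add: set_lebesgue_integral_def)
qed

text \<open>
  The denominator is the product of the factors \<open>(1 - n + m) - s\<close> for \<open>m \<le>
  M\<close>, so all its zeros are simple.
\<close>
lemma residue_over_pochhammer:
  assumes S: "open S" "f holomorphic_on S" "1 - of_nat n + of_nat i \<in> S" and i: "i \<le> M"
  shows "residue (\<lambda>s. f s / pochhammer (1 - of_nat n - s) (Suc M)) (1 - of_nat n + of_nat i) =
         - (f (1 - of_nat n + of_nat i) * ((-1) ^ i / (fact i * fact (M - i))))"
proof -
  define w where "w m = (1 - of_nat n + of_nat m :: complex)" for m
  define I where "I = {..M} - {i}"
  have wi: "w m = w k \<longleftrightarrow> m = k" for m k by (simp add: w_def)
  have poch: "pochhammer (1 - of_nat n - s) (Suc M) = (w i - s) * (\<Prod>m\<in>I. w m - s)" for s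
  proof -
    have "pochhammer (1 - of_nat n - s) (Suc M) = (\<Prod>m\<le>M. w m - s)"
      unfolding pochhammer_prod by (rule prod.cong) (auto simp: w_def algebra_simps)
    also have "\<dots> = (w i - s) * (\<Prod>m\<in>I. w m - s)"
      unfolding I_def using i by (subst prod.remove[of _ i]) auto
    finally show ?thesis .
  qed
  define g where "g s = - f s / (\<Prod>m\<in>I. w m - s)" for s
  have finI: "finite I" by (simp add: I_def)
  have op: "open (S - w ` I)" using S(1) finI by (intro open_Diff finite_imp_closed) auto
  have "g holomorphic_on S - w ` I" unfolding g_def
    by (intro holomorphic_intros holomorphic_on_subset[OF S(2)]) (use finI in auto)
  moreover have win: "w i \<in> S - w ` I" using S(3) by (auto simp: w_def I_def)
  ultimately have "residue (\<lambda>s. g s / (s - w i)) (w i) = g (w i)"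
    by (intro residue_simple[OF op])
  moreover have "(\<lambda>s. g s / (s - w i)) = (\<lambda>s. f s / pochhammer (1 - of_nat n - s) (Suc M))"
  proof
    fix s
    show "g s / (s - w i) = f s / pochhammer (1 - of_nat n - s) (Suc M)"
    proof -
      have e: "(w i - s) * (\<Prod>m\<in>I. w m - s) = - ((\<Prod>m\<in>I. w m - s) * (s - w i))" by (simp add: algebra_simps)
      show ?thesis unfolding g_def poch e by (simp only: divide_divide_eq_left) (metis minus_divide_left minus_divide_right)
    qed
  qed
  moreover have "(\<Prod>m\<in>I. w m - w i) = (-1) ^ i * fact i * fact (M - i)"
  proof -
    have "I = {..<i} \<union> {Suc i..M}" using i by (auto simp: I_def)
    then have "(\<Prod>m\<in>I. w m - w i) = (\<Prod>m<i. w m - w i) * (\<Prod>m=Suc i..M. w m - w i)"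
      by (simp only:) (rule prod.union_disjoint, auto)
    also have "(\<Prod>m<i. w m - w i) = (\<Prod>m<i. - of_nat (i - m))"
      by (rule prod.cong) (auto simp: w_def of_nat_diff)
    also have "\<dots> = (-1) ^ i * (\<Prod>m<i. of_nat (i - m))" by (subst prod_uminus) simp
    also have "(\<Prod>m<i. of_nat (i - m)) = (fact i :: complex)"
      unfolding fact_prod_rev by (simp add: lessThan_atLeast0)
    also have "(\<Prod>m=Suc i..M. w m - w i) = (\<Prod>m=1..M - i. of_nat m)"
      by (rule prod.reindex_bij_witness[of _ "\<lambda>m. m + i" "\<lambda>m. m - i"]) (use i in \<open>auto simp: w_def of_nat_diff\<close>)
    also have "\<dots> = (fact (M - i) :: complex)" by (simp add: fact_prod)
    finally show ?thesis by simp
  qed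
  moreover have "inverse ((-1) ^ i) = ((-1) ^ i :: complex)" by (simp flip: power_inverse)
  ultimately show ?thesis unfolding w_def[symmetric] g_def
    by (simp add: divide_inverse)
qed

section \<open>Rectangular loops around the poles\<close>

lemma finite_lattice_in_cball:
  "finite ({w. \<exists>l::nat. w = c + s * of_nat l} \<inter> cball 0 r)" if "s = 1 \<or> s = - 1" for c s :: complex
proof -
  obtain M where M: "real M \<ge> r + norm c" using real_arch_simple by blast
  have "{w. \<exists>l::nat. w = c + s * of_nat l} \<inter> cball 0 r \<subseteq> (\<lambda>l. c + s * of_nat l) ` {..M}"
  proof
    fix w assume "w \<in> {w. \<exists>l::nat. w = c + s * of_nat l} \<inter> cball 0 r"
    then obtain l :: nat where l: "w = c + s * of_nat l" "norm w \<le> r" by auto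
    have "real l = norm (w - c)" using that l(1) by (auto simp: norm_mult)
    also have "\<dots> \<le> r + norm c" using l(2) norm_triangle_ineq4[of w c] by linarith
    finally have "l \<le> M" using M by linarith
    then show "w \<in> (\<lambda>l. c + s * of_nat l) ` {..M}" using l(1) by auto
  qed
  then show ?thesis by (rule finite_subset) auto
qed

text \<open>
  Each of the \<open>M\<close> factors has modulus at least \<open>\<bar>s\<bar> / 2\<close>.
\<close>
lemma norm_pochhammer_ge:
  "norm s \<ge> 2 * (real n + real M + 1) \<Longrightarrow> norm (pochhammer (1 - of_nat n - s :: complex) M) \<ge> (norm s / 2) ^ M"
proof -
  assume s: "norm s \<ge> 2 * (real n + real M + 1)"
  have "(\<Prod>m=0..<M. norm s / 2) \<le> (\<Prod>m=0..<M. norm (1 - of_nat n - s + of_nat m))"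
  proof (rule prod_mono, intro conjI)
    fix m assume m: "m \<in> {0..<M}"
    have "norm (1 - of_nat n + of_nat m :: complex) \<le> norm (1 - of_nat n :: complex) + norm (of_nat m :: complex)"
      by (rule norm_triangle_ineq)
    also have "\<dots> \<le> (norm (1::complex) + norm (of_nat n :: complex)) + norm (of_nat m :: complex)"
      by (intro add_right_mono norm_triangle_ineq4)
    also have "\<dots> \<le> real n + real M + 1" using m by simp
    finally have "norm (1 - of_nat n + of_nat m :: complex) \<le> norm s / 2" using s by simp
    moreover have "norm s - norm (1 - of_nat n + of_nat m :: complex) \<le> norm (s - (1 - of_nat n + of_nat m))"
      by (rule norm_triangle_ineq2)
    moreover have "norm (s - (1 - of_nat n + of_nat m)) = norm (1 - of_nat n - s + of_nat m)"
      by (subst norm_minus_commute) (simp add: algebra_simps)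
    ultimately show "norm s / 2 \<le> norm (1 - of_nat n - s + of_nat m)" by linarith
  qed auto
  then show ?thesis by (simp add: pochhammer_prod prod_norm)
qed

lemma divide_half_power:
  fixes x c :: real
  assumes "x > 0"
  shows "c / (x / 2) ^ k = c * 2 ^ k * x powr - real k"
  unfolding powr_minus powr_realpow[OF assms] power_divide by (simp add: field_simps)

lemma powr_exp_bound:
  fixes t q :: real
  assumes "0 < t" "t < 1"
  shows "\<exists>x1. \<forall>x\<ge>x1. t powr x \<le> x powr q"
proof -
  have "((\<lambda>x. t powr x * x powr - q) \<longlongrightarrow> 0) at_top" using assms by real_asymp
  then have "\<forall>\<^sub>F x in at_top. t powr x * x powr - q < 1" by (rule order_tendstoD) simp
  then have "\<forall>\<^sub>F x in at_top. t powr x \<le> x powr q"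
    using eventually_gt_at_top[of 0]
    by eventually_elim (auto simp: powr_minus field_simps)
  then show ?thesis by (simp add: eventually_at_top_linorder)
qed

text \<open>
  The integral along the loop that comes in at height \<open>-Y\<close>, goes up on \<open>Re s =
  R\<close> and leaves at height \<open>Y\<close>, written as three Lebesgue integrals so that
  Fubini's theorem can be applied.
\<close>
definition rect_integral :: "(complex \<Rightarrow> complex) \<Rightarrow> real \<Rightarrow> real \<Rightarrow> complex" where
  "rect_integral F R Y = (LINT x:{..R}|lborel. F (Complex x (- Y))) + \<i> * (LINT y:{-Y..Y}|lborel. F (Complex R y)) -
     (LINT x:{..R}|lborel. F (Complex x Y))"

lemma loop_integral_rect:
  assumes L: "left_loop (rect_loop R Y) P Q" and cl: "closed (P \<union> Q)" and D: "loop_decaying F (P \<union> Q)" and Y: "Y > 0"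
  shows "loop_integral (rect_loop R Y) F = rect_integral F R Y"
proof -
  have hol: "F holomorphic_on - (P \<union> Q)" using D by (simp add: loop_decaying_def)
  have "Complex R y \<notin> P \<union> Q" if "y \<in> {-Y..Y}" for y
  proof
    assume "Complex R y \<in> P \<union> Q"
    from left_loop_right_of(1)[OF L _ _ this, of R] have "Complex R y \<notin> path_image (loop_part (rect_loop R Y) R)" by simp
    moreover have "Complex R y \<in> path_image (rect_loop R Y)"
      using that Y by (simp add: rect_loop_def closed_segment_same_Re closed_segment_eq_real_ivl)
    ultimately show False by (simp add: path_image_loop_part)
  qed
  then have "continuous_on {-Y..Y} (\<lambda>y. F (Complex R y))" by (intro continuous_on_vertical[OF hol]) auto
  then have "contour_integral (rect_loop R Y) F = \<i> * (LINT y:{-Y..Y}|lborel. F (Complex R y))"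
    unfolding rect_loop_def by (intro contour_integral_vertical) (use Y in auto)
  then show ?thesis using loop_part_tendsto(2)[OF L cl D] by (simp add: rect_integral_def)
qed

text \<open>
  On the rectangle \<open>Re s \<le> T\<close>, \<open>\<bar>Im s\<bar> \<le> T\<close> every
  boundary point satisfies \<open>\<bar>s\<bar> \<ge> T\<close>. Splitting the decay of order
  \<open>e\<close> into a small power of \<open>T\<close> and an integrable function of the position
  along the side bounds the three integrals by a multiple of
  \<open>T\<^bsup>-\<delta>\<^esup>\<close>.
\<close>
lemma rect_integral_tendsto_0:
  fixes F :: "complex \<Rightarrow> complex"
  assumes F: "\<And>s. norm s \<ge> R \<Longrightarrow> Re s \<ge> 0 \<or> \<bar>Im s\<bar> \<ge> Y \<Longrightarrow> norm (F s) \<le> C * norm s powr - e"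
    and e: "e > 1" and C: "C \<ge> 0"
    and int: "\<And>T. T \<ge> T0 \<Longrightarrow> set_integrable lborel {..T} (\<lambda>x. F (Complex x (- T)))"
       "\<And>T. T \<ge> T0 \<Longrightarrow> set_integrable lborel {..T} (\<lambda>x. F (Complex x T))"
       "\<And>T. T \<ge> T0 \<Longrightarrow> set_integrable lborel {-T..T} (\<lambda>y. F (Complex T y))"
  shows "((\<lambda>T. rect_integral F T T) \<longlongrightarrow> 0) at_top"
proof -
  \<comment> \<open>Half of the excess of the order of decay over one.\<close>
  define \<delta> where "\<delta> = (e - 1) / 2"
  have \<delta>: "\<delta> > 0" "e - \<delta> > 1" using e by (auto simp: \<delta>_def field_simps)
  define g where "g x = C * (2 powr \<bar>- (e - \<delta>)\<bar> * (1 + \<bar>x\<bar>) powr - (e - \<delta>))" for x :: real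
  have gi: "integrable lborel g" unfolding g_def
    by (intro integrable_mult_right integrable_one_plus_abs_powr \<delta>)
  have g0: "g x \<ge> 0" for x using C by (simp add: g_def)
  define J where "J = (LINT x|lborel. g x)"
  have key: "C * norm s powr - e \<le> T powr - \<delta> * g x" if "norm s \<ge> T" "T \<ge> 1" "norm s \<ge> \<bar>x\<bar>" for s :: complex and T x
  proof -
    have s: "norm s \<ge> 1" using that by linarith
    have "norm s powr - e = norm s powr - \<delta> * norm s powr - (e - \<delta>)" by (simp flip: powr_add)
    also have "\<dots> \<le> T powr - \<delta> * (((1 + \<bar>x\<bar>) / 2) powr - (e - \<delta>))"
      using \<delta> that s by (intro mult_mono powr_mono2') auto
    also have "((1 + \<bar>x\<bar>) / 2) powr - (e - \<delta>) \<le> 2 powr \<bar>- (e - \<delta>)\<bar> * (1 + \<bar>x\<bar>) powr - (e - \<delta>)"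
      by (rule powr_comparable) auto
    finally have "norm s powr - e \<le> T powr - \<delta> * (2 powr \<bar>- (e - \<delta>)\<bar> * (1 + \<bar>x\<bar>) powr - (e - \<delta>))"
      by (simp add: mult_left_mono)
    from mult_left_mono[OF this C] show ?thesis by (simp add: g_def mult_ac)
  qed
  have bound: "norm (LINT x:A|lborel. f x) \<le> T powr - \<delta> * J"
    if A: "set_integrable lborel A f" and f: "\<And>x. x \<in> A \<Longrightarrow> norm (f x) \<le> T powr - \<delta> * g x" for A :: "real set" and f :: "real \<Rightarrow> complex" and T
  proof -
    have "norm (LINT x:A|lborel. f x) \<le> (LINT x|lborel. norm (indicator A x *\<^sub>R f x))"
      unfolding set_lebesgue_integral_def by (rule integral_norm_bound)
    also have "\<dots> \<le> (LINT x|lborel. T powr - \<delta> * g x)"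
    proof (rule integral_mono)
      show "integrable lborel (\<lambda>x. norm (indicator A x *\<^sub>R f x))" using A unfolding set_integrable_def by (rule integrable_norm)
      show "integrable lborel (\<lambda>x. T powr - \<delta> * g x)" by (intro integrable_mult_right gi)
      show "norm (indicator A x *\<^sub>R f x) \<le> T powr - \<delta> * g x" for x
        using f[of x] g0[of x] by (auto simp: indicator_def)
    qed
    finally show ?thesis by (simp add: J_def)
  qed
  have "\<forall>\<^sub>F T in at_top. norm (rect_integral F T T) \<le> 3 * (T powr - \<delta> * J)"
    using eventually_ge_at_top[of "max (max 1 T0) (max R Y)"]
  proof eventually_elim
    case (elim T)
    then have T: "T \<ge> 1" "T \<ge> T0" "T \<ge> R" "T \<ge> Y" by auto
    have c1: "norm (F (Complex x y)) \<le> T powr - \<delta> * g x" if "\<bar>y\<bar> = T" for x y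
    proof -
      have "norm (Complex x y) \<ge> T" using abs_Im_le_cmod[of "Complex x y"] that by simp
      moreover have "norm (Complex x y) \<ge> \<bar>x\<bar>" using abs_Re_le_cmod[of "Complex x y"] by simp
      ultimately show ?thesis using key[of T "Complex x y" x] F[of "Complex x y"] T that by auto
    qed
    have c2: "norm (F (Complex T y)) \<le> T powr - \<delta> * g y" for y
    proof -
      have "norm (Complex T y) \<ge> T" using abs_Re_le_cmod[of "Complex T y"] T by simp
      moreover have "norm (Complex T y) \<ge> \<bar>y\<bar>" using abs_Im_le_cmod[of "Complex T y"] by simp
      ultimately show ?thesis using key[of T "Complex T y" y] F[of "Complex T y"] T by auto
    qed
    have "norm (rect_integral F T T) \<le> norm (LINT x:{..T}|lborel. F (Complex x (- T))) +
       norm (\<i> * (LINT y:{-T..T}|lborel. F (Complex T y))) + norm (LINT x:{..T}|lborel. F (Complex x T))"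
      unfolding rect_integral_def by (intro order_trans[OF norm_triangle_ineq4] add_right_mono norm_triangle_ineq)
    also have "\<dots> \<le> T powr - \<delta> * J + T powr - \<delta> * J + T powr - \<delta> * J"
      unfolding norm_mult norm_ii mult_1 using T by (intro add_mono bound int c1 c2) auto
    finally show ?case by linarith
  qed
  moreover have "((\<lambda>T. 3 * (T powr - \<delta> * J)) \<longlongrightarrow> 3 * (0 * J)) at_top"
    by (intro tendsto_intros tendsto_neg_powr filterlim_ident) (use \<delta> in auto)
  then have "((\<lambda>T. 3 * (T powr - \<delta> * J)) \<longlongrightarrow> 0) at_top" by simp
  ultimately show ?thesis by (rule Lim_null_comparison)
qed

lemma sum_list_shift_vec: "sum_list (shift_vec v \<mu>) = sum_list v + of_nat (length v) * \<mu>"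
  by (induction v) (auto simp: shift_vec_def algebra_simps)

text \<open>
  The parameters of \<open>Ghat\<close> under the hypotheses that bound its behaviour. In terms of
  \<open>\<psi>\<close>, the last one reads \<open>Re \<psi> > -n\<close>.
\<close>
locale ghat =
  fixes n :: nat and a b :: "complex list"
  assumes len: "length a = length b" and re_a: "\<And>x. x \<in> set a \<Longrightarrow> Re x > - real n"
    and re_psi: "Re (sum_list a - sum_list b) < real n"
begin

definition "\<alpha> = shift_vec a (of_nat n - 1)"
definition "\<beta> = shift_vec b (of_nat n - 1)"

text \<open>
  The growth exponent: \<open>Q(s) = O(\<bar>s\<bar>\<^sup>D)\<close> away from the poles. It equals
  \<open>-Re \<psi>\<close>.
\<close>
definition "D = Re (sum_list a - sum_list b)"

text \<open>
  The points \<open>1 - n, 2 - n, ...\<close>, which the loop in the definition of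
  \<open>Ghat\<close> leaves on its right.
\<close>
definition "node i = (1 - of_nat n + of_nat i :: complex)"

definition "Q = Gamma_quot \<alpha> \<beta>"

text \<open>
  The integrand of \<open>Ghat\<close> with \<open>t\<^sup>-\<^sup>s\<close> replaced by its
  integral \<open>j! / (1 - s)\<^bsub>j+1\<^esub>\<close> against \<open>(1 - t)\<^sup>j\<close>,
  since \<open>(1 - n - s)\<^sub>n (1 - s)\<^bsub>j+1\<^esub> = (1 - n -
  s)\<^bsub>n+j+1\<^esub>\<close>.
\<close>
definition "H j s = Q s * (fact j / pochhammer (1 - of_nat n - s) (Suc (n + j)))"

lemma len_shifted: "length \<alpha> = length \<beta>"
  using len by (simp add: \<alpha>_def \<beta>_def shift_vec_def)

lemma D_shifted: "Re (sum_list \<alpha> - sum_list \<beta>) = D"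
  using len by (simp add: \<alpha>_def \<beta>_def sum_list_shift_vec D_def)

lemma D_less: "D < real n"
  using re_psi by (simp add: D_def)

lemma Gamma_poles_shifted: "Gamma_poles \<alpha> = {1 - x - of_nat n - of_nat l |x l. x \<in> set a}"
proof -
  have "x + (of_nat n - 1) + w = - of_nat l \<longleftrightarrow> w = 1 - x - of_nat n - of_nat l" for x w :: complex and l
    by (auto simp: algebra_simps eq_neg_iff_add_eq_0)
  then show ?thesis unfolding Gamma_poles_def \<alpha>_def shift_vec_def by auto
qed

lemma Gamma_poles_Re: "w \<in> Gamma_poles \<alpha> \<Longrightarrow> Re w < 1"
  using re_a by (fastforce simp: Gamma_poles_shifted)

text \<open>
  The real parts are less than one because \<open>Re a > -n\<close>. So there is room for a vertical
  side between the poles and \<open>Re s = 1\<close>; requiring \<open>R > 0\<close> puts the nodes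
  \<open>1 - n, ..., 0\<close> to its left as well.
\<close>
lemma Gamma_poles_bounds: "\<exists>R Y. 0 < R \<and> R < 1 \<and> 0 < Y \<and> (\<forall>w\<in>Gamma_poles \<alpha>. Re w < R \<and> \<bar>Im w\<bar> < Y)"
proof -
  \<comment> \<open>Including \<open>0\<close> in the maximum ensures \<open>R > 0\<close>.\<close>
  define m where "m = Max (insert 0 ((\<lambda>x. 1 - Re x - real n) ` set a))"
  have "m < 1" unfolding m_def using re_a by (subst Max_less_iff) fastforce+
  have m0: "0 \<le> m" unfolding m_def by (rule Max_ge) auto
  define Y where "Y = Max (insert 0 ((\<lambda>x. \<bar>Im x\<bar>) ` set a)) + 1"
  have "0 \<le> Max (insert 0 ((\<lambda>x. \<bar>Im x\<bar>) ` set a))" by (rule Max_ge) auto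
  then have Y0: "0 < Y" unfolding Y_def by linarith
  have "Re w < (1 + m) / 2 \<and> \<bar>Im w\<bar> < Y" if "w \<in> Gamma_poles \<alpha>" for w
  proof -
    from that obtain x l where x: "x \<in> set a" "w = 1 - x - of_nat n - of_nat l" by (auto simp: Gamma_poles_shifted)
    have "1 - Re x - real n \<le> m" unfolding m_def using x(1) by (intro Max_ge) auto
    moreover have "\<bar>Im x\<bar> \<le> Y - 1" unfolding Y_def using x(1) by (simp add: Max_ge)
    ultimately show ?thesis using x(2) \<open>m < 1\<close> by auto
  qed
  then show ?thesis using \<open>m < 1\<close> m0 Y0 by (intro exI[of _ "(1 + m) / 2"] exI[of _ Y]) auto
qed

lemma finite_Gamma_poles_cball: "finite (Gamma_poles \<alpha> \<inter> cball 0 r)"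
proof -
  have "Gamma_poles \<alpha> \<inter> cball 0 r = (\<Union>x\<in>set a. {w. \<exists>l::nat. w = (1 - x - of_nat n) + (-1) * of_nat l} \<inter> cball 0 r)"
    by (auto simp: Gamma_poles_shifted)
  also have "finite \<dots>" by (intro finite_UN_I finite_lattice_in_cball) auto
  finally show ?thesis .
qed

lemma finite_nodes_cball: "finite (range node \<inter> cball 0 r)"
proof -
  have "range node = {w. \<exists>l::nat. w = (1 - of_nat n) + 1 * of_nat l}" by (auto simp: node_def)
  then show ?thesis using finite_lattice_in_cball[of 1 "1 - of_nat n" r] by simp
qed

lemma finite_poles_cball: "B \<subseteq> range node \<Longrightarrow> finite ((Gamma_poles \<alpha> \<union> B) \<inter> cball 0 r)"
  by (rule finite_subset[of _ "(Gamma_poles \<alpha> \<inter> cball 0 r) \<union> (range node \<inter> cball 0 r)"])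
     (use finite_Gamma_poles_cball finite_nodes_cball in auto)

lemma finite_Gamma_poles_right: "finite {w \<in> Gamma_poles \<alpha>. X < Re w}"
proof -
  obtain R Y where RY: "\<And>w. w \<in> Gamma_poles \<alpha> \<Longrightarrow> Re w < R \<and> \<bar>Im w\<bar> < Y" using Gamma_poles_bounds by blast
  have "{w \<in> Gamma_poles \<alpha>. X < Re w} \<subseteq> Gamma_poles \<alpha> \<inter> cball 0 (\<bar>X\<bar> + \<bar>R\<bar> + Y)"
  proof
    fix w assume "w \<in> {w \<in> Gamma_poles \<alpha>. X < Re w}"
    then have w: "w \<in> Gamma_poles \<alpha>" "X < Re w" by auto
    have "norm w \<le> \<bar>Re w\<bar> + \<bar>Im w\<bar>" by (rule cmod_le)
    then show "w \<in> Gamma_poles \<alpha> \<inter> cball 0 (\<bar>X\<bar> + \<bar>R\<bar> + Y)" using w RY[OF w(1)] by auto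
  qed
  then show ?thesis using finite_Gamma_poles_cball finite_subset by blast
qed

lemma node_Re: "Re (node i) = 1 - real n + real i" "Im (node i) = 0"
  by (simp_all add: node_def)

lemma node_inj: "node i = node k \<longleftrightarrow> i = k"
  by (simp add: node_def)

lemma pochhammer_node_nonzero: "s \<notin> node ` {..<M} \<Longrightarrow> pochhammer (1 - of_nat n - s) M \<noteq> 0"
proof
  assume s: "s \<notin> node ` {..<M}" and "pochhammer (1 - of_nat n - s) M = 0"
  then obtain k where k: "k < M" "1 - of_nat n - s = - of_nat k" by (auto simp: pochhammer_eq_0_iff)
  then have "s = node k" by (simp add: node_def algebra_simps)
  then show False using s k(1) by auto
qed

text \<open>
  The denominator has degree \<open>n + j + 1\<close>, and \<open>D < n\<close>, so the order of
  decay exceeds one.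
\<close>
lemma loop_decaying_H: "loop_decaying (H j) (Gamma_poles \<alpha> \<union> node ` {..n + j})"
proof -
  define e where "e = real (Suc (n + j)) - D"
  have "loop_decaying (\<lambda>s. Gamma_quot \<alpha> \<beta> s * (fact j / pochhammer (1 - of_nat n - s) (Suc (n + j)))) (Gamma_poles \<alpha> \<union> node ` {..n + j})"
  proof (rule loop_decaying_Gamma_quot[OF len_shifted, of _ "- real n" _ e])
    show "e > 1" using D_less by (simp add: e_def)
    show "(\<lambda>s. fact j / pochhammer (1 - of_nat n - s) (Suc (n + j))) holomorphic_on - (Gamma_poles \<alpha> \<union> node ` {..n + j})"
    proof (rule holomorphic_on_divide)
      show "(\<lambda>s. pochhammer (1 - of_nat n - s) (Suc (n + j))) holomorphic_on - (Gamma_poles \<alpha> \<union> node ` {..n + j})"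
        unfolding pochhammer_prod by (intro holomorphic_intros)
      show "pochhammer (1 - of_nat n - s) (Suc (n + j)) \<noteq> 0" if "s \<in> - (Gamma_poles \<alpha> \<union> node ` {..n + j})" for s
        using that by (intro pochhammer_node_nonzero) (auto simp: lessThan_Suc_atMost)
    qed auto
    show "- real n < Re w" if "w \<in> Gamma_poles \<alpha> \<union> node ` {..n + j} - Gamma_poles \<alpha>" for w
      using that by (auto simp: node_Re)
    fix Y
    show "\<exists>C X0. \<forall>s. Re s \<le> X0 \<longrightarrow> \<bar>Im s\<bar> \<le> Y \<longrightarrow> norm (fact j / pochhammer (1 - of_nat n - s) (Suc (n + j)))
        \<le> C * (- Re s) powr (- Re (sum_list \<alpha> - sum_list \<beta>) - e)"
    proof (rule exI[of _ "fact j * 2 ^ Suc (n + j)"], rule exI[of _ "- (2 * (real n + real (Suc (n + j)) + 1))"], intro allI impI)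
      fix s assume s: "Re s \<le> - (2 * (real n + real (Suc (n + j)) + 1))"
      have ns: "norm s \<ge> - Re s" using abs_Re_le_cmod[of s] by linarith
      have "0 < 2 * (real n + real (Suc (n + j)) + 1)" by (simp add: add_nonneg_pos)
      with s have pos: "- Re s > 0" by linarith
      have "(- Re s / 2) ^ Suc (n + j) \<le> (norm s / 2) ^ Suc (n + j)" using ns pos by (intro power_mono) auto
      also have "\<dots> \<le> norm (pochhammer (1 - of_nat n - s) (Suc (n + j)))"
        by (rule norm_pochhammer_ge) (use s ns in linarith)
      finally have ge: "(- Re s / 2) ^ Suc (n + j) \<le> norm (pochhammer (1 - of_nat n - s) (Suc (n + j)))" .
      have "0 < (- Re s / 2) ^ Suc (n + j)" using pos by (intro zero_less_power) auto
      with ge have "norm (fact j / pochhammer (1 - of_nat n - s) (Suc (n + j))) \<le> fact j / (- Re s / 2) ^ Suc (n + j)"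
        unfolding norm_divide norm_fact by (intro divide_left_mono mult_pos_pos) (linarith | simp)+
      also have "\<dots> = fact j * 2 ^ Suc (n + j) * (- Re s) powr - real (Suc (n + j))"
        using pos by (rule divide_half_power)
      also have "- real (Suc (n + j)) = - Re (sum_list \<alpha> - sum_list \<beta>) - e" unfolding D_shifted e_def by simp
      finally show "norm (fact j / pochhammer (1 - of_nat n - s) (Suc (n + j))) \<le>
        fact j * 2 ^ Suc (n + j) * (- Re s) powr (- Re (sum_list \<alpha> - sum_list \<beta>) - e)" .
    qed
  qed auto
  then show ?thesis by (simp add: H_def[abs_def] Q_def)
qed

lemma H_far_bound: "\<exists>C R Y e. C \<ge> 0 \<and> e > 1 \<and> (\<forall>s. norm s \<ge> R \<longrightarrow> Re s \<ge> 0 \<or> \<bar>Im s\<bar> \<ge> Y \<longrightarrow> norm (H j s) \<le> C * norm s powr - e)"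
proof -
  define e where "e = real (Suc (n + j)) - D"
  have e: "e > 1" using D_less by (simp add: e_def)
  obtain C R Y where CR: "C > 0" "R > 0" "\<And>s. norm s \<ge> R \<Longrightarrow> Re s \<ge> 0 \<or> \<bar>Im s\<bar> \<ge> Y \<Longrightarrow> norm (Q s) \<le> C * norm s powr D"
    using Gamma_quot_bound_far[OF len_shifted] unfolding D_shifted Q_def by blast
  define R' where "R' = R + 2 * (real n + real (Suc (n + j)) + 1)"
  have "norm (H j s) \<le> C * (fact j * 2 ^ Suc (n + j)) * norm s powr - e" if s: "norm s \<ge> R'" "Re s \<ge> 0 \<or> \<bar>Im s\<bar> \<ge> Y" for s
  proof -
    have s2: "norm s \<ge> 2 * (real n + real (Suc (n + j)) + 1)" "norm s \<ge> R" using s(1) CR(2) by (auto simp: R'_def)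
    have pos: "norm s > 0" using s2 CR(2) by linarith
    have "0 < (norm s / 2) ^ Suc (n + j)" using pos by (intro zero_less_power) auto
    with norm_pochhammer_ge[OF s2(1)]
    have "norm (fact j / pochhammer (1 - of_nat n - s) (Suc (n + j))) \<le> fact j / (norm s / 2) ^ Suc (n + j)"
      unfolding norm_divide norm_fact by (intro divide_left_mono mult_pos_pos) (linarith | simp)+
    also have "\<dots> = fact j * 2 ^ Suc (n + j) * norm s powr - real (Suc (n + j))"
      using pos by (rule divide_half_power)
    finally have h: "norm (fact j / pochhammer (1 - of_nat n - s) (Suc (n + j))) \<le> \<dots>" .
    have "norm (H j s) \<le> (C * norm s powr D) * (fact j * 2 ^ Suc (n + j) * norm s powr - real (Suc (n + j)))"
      unfolding H_def norm_mult[of "Q s"] using CR(1) by (intro mult_mono CR(3) h s2 s) auto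
    also have "\<dots> = C * (fact j * 2 ^ Suc (n + j)) * (norm s powr D * norm s powr - real (Suc (n + j)))" by (simp only: mult_ac)
    also have "norm s powr D * norm s powr - real (Suc (n + j)) = norm s powr - e"
      unfolding e_def by (simp only: powr_add[symmetric]) (simp add: algebra_simps)
    finally show ?thesis .
  qed
  then show ?thesis using e CR(1) by (intro exI[of _ "C * (fact j * 2 ^ Suc (n + j))"] exI[of _ R'] exI[of _ Y] exI[of _ e]) auto
qed

lemma closed_poles: "B \<subseteq> range node \<Longrightarrow> closed (Gamma_poles \<alpha> \<union> B)"
  by (rule closed_locally_finite[OF finite_poles_cball]) auto

lemma open_Gamma_poles_compl: "open (- Gamma_poles \<alpha>)"
  using closed_poles[of "{}"] by (simp add: open_Compl)

lemma Q_holomorphic: "Q holomorphic_on - Gamma_poles \<alpha>"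
  unfolding Q_def by (rule Gamma_quot_holomorphic)

lemma left_loop_rect_poles:
  assumes "\<And>w. w \<in> Gamma_poles \<alpha> \<Longrightarrow> Re w < R \<and> \<bar>Im w\<bar> < Y" "0 < R" "R < 1" "0 < Y" "B \<subseteq> node ` {n..}"
  shows "left_loop (rect_loop R Y) (Gamma_poles \<alpha> \<union> node ` {..<n}) B"
  by (rule left_loop_rect) (use assms in \<open>fastforce simp: node_Re\<close>)+

text \<open>
  Up to sign, the residue of \<open>Q(s) / (1 - n - s)\<^bsub>M+1\<^esub>\<close> at the
  \<open>i\<close>-th node.
\<close>
definition "res_coeff M i = Q (node i) * ((-1) ^ i / (fact i * fact (M - i)))"

lemma node_not_pole: "i \<ge> n \<Longrightarrow> node i \<notin> Gamma_poles \<alpha>"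
  using Gamma_poles_Re[of "node i"] by (auto simp: node_Re)

lemma residue_H:
  assumes "node i \<notin> Gamma_poles \<alpha>" "i \<le> n + j"
  shows "residue (H j) (node i) = - (fact j * res_coeff (n + j) i)"
proof -
  have "residue (\<lambda>s. (Q s * fact j) / pochhammer (1 - of_nat n - s) (Suc (n + j))) (1 - of_nat n + of_nat i) =
      - ((Q (1 - of_nat n + of_nat i) * fact j) * ((-1) ^ i / (fact i * fact (n + j - i))))"
    by (rule residue_over_pochhammer[OF open_Gamma_poles_compl])
       (use assms Q_holomorphic in \<open>auto simp: node_def intro!: holomorphic_intros\<close>)
  then show ?thesis by (simp add: H_def[abs_def] node_def res_coeff_def mult_ac)
qed

text \<open>
  Blow up the rectangle. The integral over a large rectangle, with all \<open>n + j + 1\<close>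
  nodes inside, tends to zero; it differs from the given one by the residues at the nodes in
  between, those with real part at least one.
\<close>
lemma rect_integral_H:
  assumes RY: "\<And>w. w \<in> Gamma_poles \<alpha> \<Longrightarrow> Re w < R \<and> \<bar>Im w\<bar> < Y" "0 < R" "R < 1" "0 < Y"
  shows "rect_integral (H j) R Y = 2 * pi * \<i> * (fact j * (\<Sum>i=n..n+j. res_coeff (n + j) i))"
proof -
  let ?P = "Gamma_poles \<alpha> \<union> node ` {..<n}" and ?N = "node ` {n..n+j}"
  have Z: "?P \<union> ?N = Gamma_poles \<alpha> \<union> node ` {..n+j}"
  proof -
    have "{..n+j} = {..<n} \<union> {n..n+j}" by auto
    then show ?thesis by (simp only: image_Un Un_assoc)
  qed
  have dec: "loop_decaying (H j) (?P \<union> ?N)" unfolding Z by (rule loop_decaying_H)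
  have cl: "closed (?P \<union> ?N)" unfolding Z by (rule closed_poles) auto
  have lf: "finite ((?P \<union> ?N) \<inter> cball 0 r)" for r unfolding Z by (rule finite_poles_cball) auto
  have L1: "left_loop (rect_loop R Y) ?P ?N" by (rule left_loop_rect_poles[OF RY]) auto
  define T0 where "T0 = Y + real n + real j + 2"
  have L2: "left_loop (rect_loop T T) (?P \<union> ?N) {}" if "T \<ge> T0" for T
  proof (rule left_loop_rect)
    show "T > 0" using that RY(4) by (simp add: T0_def)
    fix w assume "w \<in> ?P \<union> ?N"
    then show "Re w < T \<and> \<bar>Im w\<bar> < T" unfolding Z
    proof
      assume "w \<in> Gamma_poles \<alpha>"
      then show ?thesis using RY(1)[of w] RY(3,4) that by (auto simp: T0_def)
    next
      assume "w \<in> node ` {..n + j}"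
      then show ?thesis using that RY(4) by (auto simp: T0_def node_Re)
    qed
  qed auto
  have disj: "?P \<inter> ?N = {}" using node_not_pole by (auto simp: node_inj)
  have finA: "finite {w \<in> ?P. X < Re w}" for X
    by (rule finite_subset[of _ "{w \<in> Gamma_poles \<alpha>. X < Re w} \<union> node ` {..<n}"]) (use finite_Gamma_poles_right in auto)
  have eq: "rect_integral (H j) T T = rect_integral (H j) R Y + 2 * pi * \<i> * (\<Sum>w\<in>?N. residue (H j) w)" if T: "T \<ge> T0" for T
  proof -
    have "T > 0" using T RY(4) by (simp add: T0_def)
    then have "loop_integral (rect_loop T T) (H j) = rect_integral (H j) T T"
      using loop_integral_rect[OF L2[OF T]] dec cl by simp
    moreover have "loop_integral (rect_loop R Y) (H j) = rect_integral (H j) R Y"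
      by (rule loop_integral_rect[OF L1 cl dec RY(4)])
    moreover have "loop_integral (rect_loop T T) (H j) = loop_integral (rect_loop R Y) (H j) + 2 * pi * \<i> * (\<Sum>w\<in>?N. residue (H j) w)"
      by (rule loop_integral_change[OF L1 L2[OF T] _ _ disj lf dec finA]) auto
    ultimately show ?thesis by simp
  qed
  obtain C R1 Y1 e where CR: "C \<ge> 0" "e > 1" "\<And>s. norm s \<ge> R1 \<Longrightarrow> Re s \<ge> 0 \<or> \<bar>Im s\<bar> \<ge> Y1 \<Longrightarrow> norm (H j s) \<le> C * norm s powr - e"
    using H_far_bound by blast
  have off: "w \<notin> Gamma_poles \<alpha> \<union> node ` {..n + j}" if "T \<ge> T0" "\<bar>Im w\<bar> = T \<or> Re w = T" for w T
  proof
    assume "w \<in> Gamma_poles \<alpha> \<union> node ` {..n + j}"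
    then show False
    proof
      assume "w \<in> Gamma_poles \<alpha>"
      then show ?thesis using RY(1)[of w] RY(3,4) that by (auto simp: T0_def)
    next
      assume "w \<in> node ` {..n + j}"
      then show ?thesis using that RY(4) by (auto simp: T0_def node_Re)
    qed
  qed
  have hol: "H j holomorphic_on - (Gamma_poles \<alpha> \<union> node ` {..n + j})"
    using loop_decaying_H by (simp add: loop_decaying_def)
  have ray: "set_integrable lborel {..x0} (\<lambda>x. H j (Complex x y))" if "\<bar>y\<bar> = T" "T \<ge> T0" for x0 y T
  proof -
    have "Complex x y \<notin> Gamma_poles \<alpha> \<union> node ` {..n + j}" for x by (rule off[OF that(2)]) (use that in auto)
    then show ?thesis using loop_decaying_H[of j] unfolding loop_decaying_def by blast
  qed
  have "((\<lambda>T. rect_integral (H j) T T) \<longlongrightarrow> 0) at_top"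
  proof (rule rect_integral_tendsto_0[OF CR(3,2,1), where ?T0.0 = "max 0 T0"])
    fix T assume T: "T \<ge> max 0 T0"
    show "set_integrable lborel {..T} (\<lambda>x. H j (Complex x (- T)))" by (rule ray[of _ T]) (use T in auto)
    show "set_integrable lborel {..T} (\<lambda>x. H j (Complex x T))" by (rule ray[of _ T]) (use T in auto)
    have "Complex T y \<notin> Gamma_poles \<alpha> \<union> node ` {..n + j}" for y by (rule off[of T]) (use T in auto)
    then show "set_integrable lborel {-T..T} (\<lambda>y. H j (Complex T y))"
      by (intro borel_integrable_atLeastAtMost' continuous_on_vertical[OF hol]) auto
  qed
  moreover have "((\<lambda>T. rect_integral (H j) T T) \<longlongrightarrow> rect_integral (H j) R Y + 2 * pi * \<i> * (\<Sum>w\<in>?N. residue (H j) w)) at_top"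
    by (rule tendsto_eventually, rule eventually_mono[OF eventually_ge_at_top[of T0]], rule eq)
  ultimately have "rect_integral (H j) R Y + 2 * pi * \<i> * (\<Sum>w\<in>?N. residue (H j) w) = 0"
    using tendsto_unique trivial_limit_at_top_linorder by blast
  moreover have "(\<Sum>w\<in>?N. residue (H j) w) = (\<Sum>i=n..n+j. residue (H j) (node i))"
    by (subst sum.reindex) (auto simp: inj_on_def node_inj)
  moreover have "\<dots> = - (fact j * (\<Sum>i=n..n+j. res_coeff (n + j) i))"
    unfolding sum_distrib_left sum_negf[symmetric]
    by (intro sum.cong refl residue_H node_not_pole) auto
  ultimately show ?thesis by (simp add: add_eq_0_iff)
qed

definition "F t = Ghat_integrand n a b t"

lemma F_eq: "F t s = Q s * (Gamma (1 - of_nat n - s) * rGamma (1 - s) * of_real t powr - s)"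
  by (simp add: F_def Ghat_integrand_def Q_def Gamma_quot_def \<alpha>_def \<beta>_def shift_vec_add mult_ac)

lemma Gamma_rGamma_off_nodes:
  assumes s: "s \<notin> range node"
  shows "Gamma (1 - of_nat n - s) * rGamma (1 - s) = 1 / pochhammer (1 - of_nat n - s) n"
proof -
  have nI: "1 - of_nat n - s \<notin> \<int>\<^sub>\<le>\<^sub>0"
  proof
    assume "1 - of_nat n - s \<in> \<int>\<^sub>\<le>\<^sub>0"
    then obtain k where "1 - of_nat n - s = - of_nat k" by (elim nonpos_Ints_cases')
    then have "s = node k" by (simp add: node_def algebra_simps)
    then show False using s by blast
  qed
  have "rGamma (1 - of_nat n - s) = pochhammer (1 - of_nat n - s) n * rGamma (1 - of_nat n - s + of_nat n)"
    by (rule pochhammer_rGamma)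
  also have "1 - of_nat n - s + of_nat n = 1 - s" by simp
  finally have e: "rGamma (1 - of_nat n - s) = pochhammer (1 - of_nat n - s) n * rGamma (1 - s)" .
  have "Gamma (1 - of_nat n - s) * rGamma (1 - of_nat n - s) = 1"
    using nI by (simp add: rGamma_inverse_Gamma Gamma_eq_zero_iff)
  then have "Gamma (1 - of_nat n - s) * rGamma (1 - s) * pochhammer (1 - of_nat n - s) n = 1" unfolding e by (simp add: mult_ac)
  then show ?thesis by (metis mult_zero_right nonzero_eq_divide_eq zero_neq_one)
qed

lemma F_off_nodes:
  "s \<notin> range node \<Longrightarrow> F t s = Q s / pochhammer (1 - of_nat n - s) n * of_real t powr - s"
  unfolding F_eq by (simp add: Gamma_rGamma_off_nodes)

text \<open>
  To the left, the exponential decay of \<open>t\<^sup>-\<^sup>s\<close> for \<open>t < 1\<close>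
  beats every power.
\<close>
lemma loop_decaying_F:
  assumes t: "0 < t" "t < 1"
  shows "loop_decaying (F t) (Gamma_poles \<alpha> \<union> range node)"
proof -
  have "loop_decaying (\<lambda>s. Gamma_quot \<alpha> \<beta> s * (Gamma (1 - of_nat n - s) * rGamma (1 - s) * of_real t powr - s)) (Gamma_poles \<alpha> \<union> range node)"
  proof (rule loop_decaying_Gamma_quot[OF len_shifted, of _ "- real n" _ 2])
    show "(\<lambda>s. Gamma (1 - of_nat n - s) * rGamma (1 - s) * of_real t powr - s) holomorphic_on - (Gamma_poles \<alpha> \<union> range node)"
    proof (intro holomorphic_intros)
      fix s assume s: "s \<in> - (Gamma_poles \<alpha> \<union> range node)"
      show "1 - of_nat n - s \<notin> \<int>\<^sub>\<le>\<^sub>0"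
      proof
        assume "1 - of_nat n - s \<in> \<int>\<^sub>\<le>\<^sub>0"
        then obtain k where "1 - of_nat n - s = - of_nat k" by (elim nonpos_Ints_cases')
        then have "s = node k" by (simp add: node_def algebra_simps)
        then show False using s by blast
      qed
    qed
    show "- real n < Re w" if "w \<in> Gamma_poles \<alpha> \<union> range node - Gamma_poles \<alpha>" for w
      using that by (auto simp: node_Re)
    obtain x1 where x1: "\<And>x. x \<ge> x1 \<Longrightarrow> t powr x \<le> x powr (- D - 2)"
      using powr_exp_bound[OF t] by blast
    fix Y
    show "\<exists>C X0. \<forall>s. Re s \<le> X0 \<longrightarrow> \<bar>Im s\<bar> \<le> Y \<longrightarrow> norm (Gamma (1 - of_nat n - s) * rGamma (1 - s) * of_real t powr - s)
        \<le> C * (- Re s) powr (- Re (sum_list \<alpha> - sum_list \<beta>) - 2)"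
    proof (rule exI[of _ 1], rule exI[of _ "min (- x1) (- (2 * (real n + real n + 1)))"], intro allI impI)
      fix s assume s: "Re s \<le> min (- x1) (- (2 * (real n + real n + 1)))"
      have sn: "s \<notin> range node" using s by (auto simp: node_Re)
      have ns: "norm s \<ge> - Re s" using abs_Re_le_cmod[of s] by linarith
      have "1 ^ n \<le> (norm s / 2) ^ n" by (rule power_mono) (use s ns in auto)
      also have "\<dots> \<le> norm (pochhammer (1 - of_nat n - s) n)" by (rule norm_pochhammer_ge) (use s ns in linarith)
      finally have p: "1 \<le> norm (pochhammer (1 - of_nat n - s) n)" by simp
      have "norm (Gamma (1 - of_nat n - s) * rGamma (1 - s) * of_real t powr - s) =
          1 / norm (pochhammer (1 - of_nat n - s) n) * t powr (- Re s)"
        unfolding Gamma_rGamma_off_nodes[OF sn] using t by (simp add: norm_mult norm_divide norm_powr_real_powr)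
      also have "\<dots> \<le> 1 * (- Re s) powr (- D - 2)"
        using p s by (intro mult_mono x1) (auto simp: divide_le_eq_1)
      finally show "norm (Gamma (1 - of_nat n - s) * rGamma (1 - s) * of_real t powr - s) \<le>
          1 * (- Re s) powr (- Re (sum_list \<alpha> - sum_list \<beta>) - 2)" by (simp only: D_shifted)
    qed
  qed auto
  then show ?thesis by (simp add: F_eq[abs_def] Q_def)
qed

end

section \<open>Moments and the integral representation\<close>

lemma set_lebesgue_integral_sum:
  fixes f :: "'i \<Rightarrow> 'a \<Rightarrow> 'b::{banach, second_countable_topology}"
  assumes "\<And>i. i \<in> I \<Longrightarrow> set_integrable M A (f i)"
  shows "(LINT x:A|M. (\<Sum>i\<in>I. f i x)) = (\<Sum>i\<in>I. LINT x:A|M. f i x)"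
  using assms by (simp add: set_lebesgue_integral_def set_integrable_def scaleR_sum_right)

lemma set_integrable_one_minus_power:
  fixes f :: "real \<Rightarrow> complex"
  assumes f: "set_integrable lborel {0<..<1} f"
  shows "set_integrable lborel {0<..<1} (\<lambda>t. of_real (1 - t) ^ j * f t)"
proof (rule set_integrable_bound[OF f])
  have "(\<lambda>t. of_real (1 - t) ^ j * (indicator {0<..<1} t *\<^sub>R f t)) \<in> borel_measurable lborel"
    using f unfolding set_integrable_def by (intro borel_measurable_times) auto
  then show "set_borel_measurable lborel {0<..<1} (\<lambda>t. of_real (1 - t) ^ j * f t)"
    unfolding set_borel_measurable_def by simp
  show "AE t in lborel. t \<in> {0<..<1} \<longrightarrow> norm (of_real (1 - t) ^ j * f t) \<le> norm (f t)"
    by (intro AE_I2) (auto simp: norm_mult norm_power power_le_one intro!: mult_left_le_one_le simp del: of_real_diff)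
qed

lemma set_integrable_unit_interval_continuous:
  fixes f :: "real \<Rightarrow> complex"
  assumes "continuous_on {0..1} f"
  shows "set_integrable lborel {0<..<1} f"
  by (rule set_integrable_subset[OF borel_integrable_atLeastAtMost'[OF assms]]) auto

lemma not_nonpos_Ints: "- x \<notin> \<nat> \<Longrightarrow> x \<notin> \<int>\<^sub>\<le>\<^sub>0" for x :: complex
  by (auto elim!: nonpos_Ints_cases')

context ghat begin

text \<open>
  On a part \<open>\<sigma>\<close> of the rectangle, Fubini's theorem needs
  \<open>\<bar>\<phi>\<bar> / (1 - Re \<sigma>)\<close> to be integrable, where \<open>\<phi> = Q /
  (1 - n - s)\<^sub>n\<close>. This quotient is comparable to \<open>\<bar>\<phi>\<bar> / \<bar>1 -
  \<sigma>\<bar>\<close>, which is \<open>\<bar>H 0\<bar>\<close>, so the decay of \<open>H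
  0\<close> suffices.
\<close>
lemma segment_moments:
  fixes \<sigma> :: "real \<Rightarrow> complex"
  assumes S: "S \<in> sets borel" and \<sigma>: "continuous_on S \<sigma>"
    and off: "\<And>x. x \<in> S \<Longrightarrow> \<sigma> x \<notin> Gamma_poles \<alpha> \<union> node ` {..<n}"
    and bd: "\<And>x. x \<in> S \<Longrightarrow> Re (\<sigma> x) \<le> R \<and> \<bar>Im (\<sigma> x)\<bar> \<le> Y" and R: "R < 1"
    and int: "set_integrable lborel S (\<lambda>x. H 0 (\<sigma> x))"
  shows "set_integrable lborel {0<..<1} (\<lambda>t. LINT x:S|lborel. F t (\<sigma> x))"
    and "(LINT t:{0<..<1}|lborel. of_real (1 - t) ^ j * (LINT x:S|lborel. F t (\<sigma> x))) = (LINT x:S|lborel. H j (\<sigma> x))"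
proof -
  define \<phi> where "\<phi> x = Q (\<sigma> x) / pochhammer (1 - of_nat n - \<sigma> x) n" for x
  have less: "Re (\<sigma> x) < 1" if "x \<in> S" for x using bd[OF that] R by linarith
  have nodes: "\<sigma> x \<notin> range node" if "x \<in> S" for x
  proof
    assume "\<sigma> x \<in> range node"
    then obtain i where i: "\<sigma> x = node i" by blast
    then have "real i < real n" using less[OF that] by (simp add: node_Re)
    then show False using off[OF that] i by auto
  qed
  have poch: "pochhammer (1 - of_nat n - \<sigma> x) n \<noteq> 0" if "x \<in> S" for x
    using off[OF that] by (intro pochhammer_node_nonzero) auto
  have cont: "continuous_on S \<phi>"
    unfolding \<phi>_def pochhammer_prod
    by (intro continuous_intros continuous_on_compose2[OF holomorphic_on_imp_continuous_on[OF Q_holomorphic] \<sigma>])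
       (use off poch \<sigma> in \<open>auto simp: pochhammer_prod\<close>)
  have H_eq: "\<phi> x * (fact j / pochhammer (1 - \<sigma> x) (Suc j)) = H j (\<sigma> x)" for x j
    using pochhammer_product'[of "1 - of_nat n - \<sigma> x" n "Suc j"] by (simp add: \<phi>_def H_def)
  have F_eq': "F t (\<sigma> x) = \<phi> x * of_real t powr - \<sigma> x" if "x \<in> S" for x t
    using F_off_nodes[OF nodes[OF that]] by (simp add: \<phi>_def)
  \<comment> \<open>Since \<open>1 - Re \<sigma> \<ge> 1 - R > 0\<close>, this constant bounds \<open>\<bar>1 - \<sigma>\<bar> / (1 - Re \<sigma>)\<close>.\<close>
  define c where "c = 1 + \<bar>Y\<bar> / (1 - R)"
  have le: "norm (\<phi> x) / (1 - Re (\<sigma> x)) \<le> c * norm (H 0 (\<sigma> x))" if x: "x \<in> S" for x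
  proof -
    have p: "1 - Re (\<sigma> x) > 0" using less[OF x] by simp
    have "norm (1 - \<sigma> x) \<le> \<bar>Re (1 - \<sigma> x)\<bar> + \<bar>Im (1 - \<sigma> x)\<bar>" by (rule cmod_le)
    also have "\<dots> \<le> (1 - Re (\<sigma> x)) + \<bar>Y\<bar>" using p bd[OF x] by auto
    also have "\<bar>Y\<bar> \<le> \<bar>Y\<bar> / (1 - R) * (1 - Re (\<sigma> x))"
    proof -
      have "\<bar>Y\<bar> * 1 \<le> \<bar>Y\<bar> * ((1 - Re (\<sigma> x)) / (1 - R))" using bd[OF x] R by (intro mult_left_mono) auto
      then show ?thesis by simp
    qed
    finally have n1: "norm (1 - \<sigma> x) \<le> c * (1 - Re (\<sigma> x))" by (simp add: c_def algebra_simps)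
    have nz: "1 - \<sigma> x \<noteq> 0" using p by (auto simp: complex_eq_iff)
    have "H 0 (\<sigma> x) = \<phi> x / (1 - \<sigma> x)" using H_eq[of x 0] by simp
    then have "norm (\<phi> x) = norm (1 - \<sigma> x) * norm (H 0 (\<sigma> x))" using nz by (simp add: norm_divide)
    also have "\<dots> \<le> (c * (1 - Re (\<sigma> x))) * norm (H 0 (\<sigma> x))" by (intro mult_right_mono n1) auto
    finally show ?thesis using p by (simp add: divide_simps mult_ac)
  qed
  have int': "set_integrable lborel S (\<lambda>x. norm (\<phi> x) / (1 - Re (\<sigma> x)))"
  proof (rule set_integrable_bound)
    show "set_integrable lborel S (\<lambda>x. of_real c * H 0 (\<sigma> x))" by (intro set_integrable_mult_right int)
    have "continuous_on S (\<lambda>x. norm (\<phi> x) / (1 - Re (\<sigma> x)))"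
      using less by (intro continuous_intros cont \<sigma>) force
    from borel_measurable_continuous_on_indicator[OF S this]
    show "set_borel_measurable lborel S (\<lambda>x. norm (\<phi> x) / (1 - Re (\<sigma> x)))"
      unfolding set_borel_measurable_def by simp
    show "AE x in lborel. x \<in> S \<longrightarrow> norm (norm (\<phi> x) / (1 - Re (\<sigma> x))) \<le> norm (of_real c * H 0 (\<sigma> x))"
    proof (intro AE_I2 impI)
      fix x assume x: "x \<in> S"
      have "norm (norm (\<phi> x) / (1 - Re (\<sigma> x))) = norm (\<phi> x) / (1 - Re (\<sigma> x))"
        using less[OF x] by simp
      also have "\<dots> \<le> \<bar>c\<bar> * norm (H 0 (\<sigma> x))"
        using le[OF x] by (rule order_trans) (intro mult_right_mono, auto)
      finally show "norm (norm (\<phi> x) / (1 - Re (\<sigma> x))) \<le> norm (of_real c * H 0 (\<sigma> x))" by (simp add: norm_mult)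
    qed
  qed
  have inner: "(LINT x:S|lborel. F t (\<sigma> x)) = (LINT x:S|lborel. \<phi> x * of_real t powr - \<sigma> x)" for t
    using S by (intro set_lebesgue_integral_cong) (auto simp: F_eq')
  show "set_integrable lborel {0<..<1} (\<lambda>t. LINT x:S|lborel. F t (\<sigma> x))"
    unfolding inner by (rule mellin_fubini(1)[OF S \<sigma> cont _ int']) (rule less)
  have "(LINT t:{0<..<1}|lborel. of_real (1 - t) ^ j * (LINT x:S|lborel. \<phi> x * of_real t powr - \<sigma> x)) =
      (LINT x:S|lborel. \<phi> x * (fact j / pochhammer (1 - \<sigma> x) (Suc j)))"
    by (rule mellin_fubini(2)[OF S \<sigma> cont _ int']) (rule less)
  then show "(LINT t:{0<..<1}|lborel. of_real (1 - t) ^ j * (LINT x:S|lborel. F t (\<sigma> x))) = (LINT x:S|lborel. H j (\<sigma> x))"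
    unfolding inner H_eq .
qed

lemma rect_integral_moments:
  assumes RY: "\<And>w. w \<in> Gamma_poles \<alpha> \<Longrightarrow> Re w < R \<and> \<bar>Im w\<bar> < Y" "0 < R" "R < 1" "0 < Y"
  shows "set_integrable lborel {0<..<1} (\<lambda>t. rect_integral (F t) R Y)"
    and "(LINT t:{0<..<1}|lborel. of_real (1 - t) ^ j * rect_integral (F t) R Y) = rect_integral (H j) R Y"
proof -
  have off: "w \<notin> Gamma_poles \<alpha> \<union> node ` {..<n}" "w \<notin> node ` {..n}" if "\<bar>Im w\<bar> = Y \<or> Re w = R" for w
    using RY(1)[of w] RY(2,3,4) that by (auto simp: node_Re)
  have dec: "loop_decaying (H 0) (Gamma_poles \<alpha> \<union> node ` {..n})" using loop_decaying_H[of 0] by simp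
  have hol: "H 0 holomorphic_on - (Gamma_poles \<alpha> \<union> node ` {..n})"
    using dec by (simp add: loop_decaying_def)
  have ray: "set_integrable lborel {..x0} (\<lambda>x. H 0 (Complex x y))" if "\<bar>y\<bar> = Y" for x0 y
  proof -
    have "Complex x y \<notin> Gamma_poles \<alpha> \<union> node ` {..n}" for x using off[of "Complex x y"] that by auto
    then show ?thesis using dec unfolding loop_decaying_def by blast
  qed
  have h1: "set_integrable lborel {0<..<1} (\<lambda>t. LINT x:{..R}|lborel. F t (Complex x y))" if "\<bar>y\<bar> = Y" for y
    by (rule segment_moments(1)[where R = R and Y = Y])
       (use that off[of "Complex _ y"] RY(3) ray[OF that] in \<open>auto simp: Complex_eq intro!: continuous_intros\<close>)
  have h2: "(LINT t:{0<..<1}|lborel. of_real (1 - t) ^ j * (LINT x:{..R}|lborel. F t (Complex x y))) = (LINT x:{..R}|lborel. H j (Complex x y))"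
    if "\<bar>y\<bar> = Y" for y j
    by (rule segment_moments(2)[where R = R and Y = Y])
       (use that off[of "Complex _ y"] RY(3) ray[OF that] in \<open>auto simp: Complex_eq intro!: continuous_intros\<close>)
  have vint: "set_integrable lborel {-Y..Y} (\<lambda>y. H 0 (Complex R y))"
    by (intro borel_integrable_atLeastAtMost' continuous_on_vertical[OF hol]) (use off in auto)
  have v1: "set_integrable lborel {0<..<1} (\<lambda>t. LINT y:{-Y..Y}|lborel. F t (Complex R y))"
    by (rule segment_moments(1)[where R = R and Y = Y])
       (use off[of "Complex R _"] RY(3) vint in \<open>auto simp: Complex_eq intro!: continuous_intros\<close>)
  have v2: "(LINT t:{0<..<1}|lborel. of_real (1 - t) ^ j * (LINT y:{-Y..Y}|lborel. F t (Complex R y))) = (LINT y:{-Y..Y}|lborel. H j (Complex R y))" for j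
    by (rule segment_moments(2)[where R = R and Y = Y])
       (use off[of "Complex R _"] RY(3) vint in \<open>auto simp: Complex_eq intro!: continuous_intros\<close>)
  let ?L1 = "\<lambda>t. LINT x:{..R}|lborel. F t (Complex x (- Y))" and ?L2 = "\<lambda>t. LINT y:{-Y..Y}|lborel. F t (Complex R y)"
    and ?L3 = "\<lambda>t. LINT x:{..R}|lborel. F t (Complex x Y)"
  have i: "set_integrable lborel {0<..<1} ?L1" "set_integrable lborel {0<..<1} ?L2" "set_integrable lborel {0<..<1} ?L3"
    using h1[of "-Y"] h1[of Y] v1 RY(4) by simp_all
  show "set_integrable lborel {0<..<1} (\<lambda>t. rect_integral (F t) R Y)"
    unfolding rect_integral_def by (intro set_integral_add set_integral_diff set_integrable_mult_right i)
  note w = set_integrable_one_minus_power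
  have "(LINT t:{0<..<1}|lborel. of_real (1 - t) ^ j * rect_integral (F t) R Y) =
     (LINT t:{0<..<1}|lborel. of_real (1 - t) ^ j * ?L1 t + \<i> * (of_real (1 - t) ^ j * ?L2 t) - of_real (1 - t) ^ j * ?L3 t)"
    unfolding rect_integral_def by (intro set_lebesgue_integral_cong) (auto simp: algebra_simps)
  also have "\<dots> = (LINT t:{0<..<1}|lborel. of_real (1 - t) ^ j * ?L1 t + \<i> * (of_real (1 - t) ^ j * ?L2 t)) -
      (LINT t:{0<..<1}|lborel. of_real (1 - t) ^ j * ?L3 t)"
    by (intro set_integral_diff(2) set_integral_add(1) set_integrable_mult_right w i)
  also have "(LINT t:{0<..<1}|lborel. of_real (1 - t) ^ j * ?L1 t + \<i> * (of_real (1 - t) ^ j * ?L2 t)) =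
      (LINT t:{0<..<1}|lborel. of_real (1 - t) ^ j * ?L1 t) + (LINT t:{0<..<1}|lborel. \<i> * (of_real (1 - t) ^ j * ?L2 t))"
    by (intro set_integral_add(2) set_integrable_mult_right w i)
  also have "(LINT t:{0<..<1}|lborel. \<i> * (of_real (1 - t) ^ j * ?L2 t)) = \<i> * (LINT t:{0<..<1}|lborel. of_real (1 - t) ^ j * ?L2 t)"
    by (rule set_integral_mult_right)
  finally show "(LINT t:{0<..<1}|lborel. of_real (1 - t) ^ j * rect_integral (F t) R Y) = rect_integral (H j) R Y"
    using h2[of "-Y" j] h2[of Y j] v2[of j] RY(4) by (simp add: rect_integral_def)
qed

text \<open>
  At the \<open>i\<close>-th node the factor \<open>t\<^sup>-\<^sup>s\<close> is the power
  \<open>t\<^bsup>n-1-i\<^esup>\<close>.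
\<close>
lemma residue_F:
  assumes t: "0 < t" and na: "node i \<notin> Gamma_poles \<alpha>" and i: "i < n"
  shows "residue (F t) (node i) = - (res_coeff (n - 1) i * of_real t ^ (n - 1 - i))"
proof -
  have n: "n = Suc (n - 1)" using i by simp
  have tp: "of_real t powr - node i = (of_real t :: complex) ^ (n - 1 - i)"
  proof -
    have "- node i = of_nat (n - 1 - i)" using i by (simp add: node_def of_nat_diff)
    then show ?thesis using t by (simp add: powr_nat')
  qed
  have "residue (F t) (node i) = residue (\<lambda>s. (Q s * of_real t powr - s) / pochhammer (1 - of_nat n - s) n) (node i)"
  proof (rule residue_cong)
    have "closed (range node - {node i})"
      by (rule closed_locally_finite[OF finite_nodes_cball]) auto
    then have "open (- (range node - {node i}))" by (rule open_Compl)
    then have "\<forall>\<^sub>F s in at (node i). s \<in> - (range node - {node i}) - {node i}"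
      by (rule eventually_at_in_open) simp
    then show "\<forall>\<^sub>F s in at (node i). F t s = (Q s * of_real t powr - s) / pochhammer (1 - of_nat n - s) n"
      by eventually_elim (subst F_off_nodes, auto)
  qed simp
  also have "\<dots> = residue (\<lambda>s. (Q s * of_real t powr - s) / pochhammer (1 - of_nat n - s) (Suc (n - 1))) (1 - of_nat n + of_nat i)"
    using n by (simp add: node_def)
  also have "\<dots> = - ((Q (1 - of_nat n + of_nat i) * of_real t powr - (1 - of_nat n + of_nat i)) * ((-1) ^ i / (fact i * fact (n - 1 - i))))"
    by (rule residue_over_pochhammer[OF open_Gamma_poles_compl])
       (use t i na Q_holomorphic in \<open>auto simp: node_def complex_nonpos_Reals_iff intro!: holomorphic_intros\<close>)
  also have "\<dots> = - (res_coeff (n - 1) i * of_real t ^ (n - 1 - i))"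
    unfolding node_def[symmetric] tp by (simp add: res_coeff_def)
  finally show ?thesis .
qed

lemma Q_node: "Q (node i) = Gamma_vec (shift_vec a (of_nat i)) * rGamma_vec (shift_vec b (of_nat i))"
  by (simp add: Q_def Gamma_quot_def \<alpha>_def \<beta>_def node_def shift_vec_add)

lemma power_beta_moment:
  "set_integrable lborel {0<..<1} (\<lambda>t. of_real t ^ m :: complex)"
  "(LINT t:{0<..<1}|lborel. of_real (1 - t) ^ j * of_real t ^ m) = (fact j * fact m / fact (m + j + 1) :: complex)"
proof -
  have e: "of_real t powr - (- of_nat m) = (of_real t ^ m :: complex)" if "t \<in> {0<..<1}" for t
    using that by (simp add: powr_nat')
  have "set_integrable lborel {0<..<1} (\<lambda>t. of_real (1 - t) ^ 0 * of_real t powr - (- of_nat m) :: complex)"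
    by (rule set_integral_beta_power) simp
  then show "set_integrable lborel {0<..<1} (\<lambda>t. of_real t ^ m :: complex)"
    by (rule set_integrable_cong[THEN iffD1, rotated -1]) (auto simp: e)
  have "(LINT t:{0<..<1}|lborel. of_real (1 - t) ^ j * of_real t ^ m) = (LINT t:{0<..<1}|lborel. of_real (1 - t) ^ j * of_real t powr - (- of_nat m) :: complex)"
    by (intro set_lebesgue_integral_cong) (auto simp: e)
  also have "\<dots> = fact j / pochhammer (1 - (- of_nat m)) (Suc j)" by (rule set_integral_beta_power) simp
  also have "(fact (m + Suc j) :: complex) = fact m * pochhammer (1 + of_nat m) (Suc j)"
    unfolding pochhammer_fact pochhammer_product' ..
  then have "fact j / pochhammer (1 - (- of_nat m)) (Suc j) = (fact j * fact m / fact (m + j + 1) :: complex)"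
    by (simp del: fact_Suc)
  finally show "(LINT t:{0<..<1}|lborel. of_real (1 - t) ^ j * of_real t ^ m) = (fact j * fact m / fact (m + j + 1) :: complex)" .
qed

text \<open>
  The loop in the definition of \<open>Ghat\<close> leaves the nodes \<open>1 - n, ..., 0\<close> on
  its right, the rectangle encloses them. The residues at these nodes form a polynomial in
  \<open>t\<close>. The same comparison shows that the value does not depend on which loop was
  chosen, once one exists.
\<close>
lemma Ghat_rect:
  assumes na: "\<forall>x\<in>set a. - x \<notin> \<nat>"
    and RY: "\<And>w. w \<in> Gamma_poles \<alpha> \<Longrightarrow> Re w < R \<and> \<bar>Im w\<bar> < Y" "0 < R" "R < 1" "0 < Y"
    and t: "0 < t" "t < 1"
  shows "Ghat n a b t = 1 / (2 * of_real pi * \<i>) * rect_integral (F t) R Y + (\<Sum>i<n. res_coeff (n - 1) i * of_real t ^ (n - 1 - i))"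
proof -
  let ?A = "Gamma_poles \<alpha>" and ?D = "node ` {..<n}" and ?B' = "node ` {n..}"
  have nodes: "?D \<union> ?B' = range node"
    by (auto simp: image_Un[symmetric] intro!: arg_cong[of _ _ "image node"])
  have node_pole: "node i \<notin> ?A" for i
  proof
    assume "node i \<in> ?A"
    then obtain x l where "x \<in> set a" "node i = 1 - x - of_nat n - of_nat l" by (auto simp: Gamma_poles_shifted)
    then have "x + of_nat (i + l) = 0" "x \<in> set a" by (auto simp: node_def algebra_simps)
    then show False using na by (metis add_eq_0_iff of_nat_in_Nats)
  qed
  have lf: "finite ((?A \<union> range node) \<inter> cball 0 r)" for r by (rule finite_poles_cball) auto
  have L: "left_loop (rect_loop R Y) (?A \<union> ?D) ?B'" by (rule left_loop_rect_poles[OF RY]) auto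
  have disj: "?A \<inter> ?D = {}" using node_pole by auto
  have "\<exists>\<gamma>. left_loop \<gamma> ?A (?D \<union> ?B')"
    by (rule left_loop_exclude_finite[OF _ L disj]) (use lf nodes in \<open>auto simp: Un_assoc\<close>)
  then have "\<exists>\<gamma>. left_loop \<gamma> ?A (range node)" by (simp only: nodes)
  then have "left_loop (SOME \<gamma>. left_loop \<gamma> ?A (range node)) ?A (range node)" by (rule someI_ex)
  moreover have "(SOME \<gamma>. left_loop \<gamma> ?A (range node)) = Ghat_loop n a"
    unfolding Ghat_loop_def Gamma_poles_shifted node_def[abs_def] by (simp add: conj_commute)
  ultimately have G: "left_loop (Ghat_loop n a) ?A (range node)" by simp
  have dec: "loop_decaying (F t) (?A \<union> range node)" by (rule loop_decaying_F[OF t])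
  have "loop_integral (rect_loop R Y) (F t) = loop_integral (Ghat_loop n a) (F t) + 2 * pi * \<i> * (\<Sum>w\<in>?D. residue (F t) w)"
    by (rule loop_integral_change[OF G L _ _ disj lf dec finite_Gamma_poles_right]) (use nodes in auto)
  moreover have "loop_integral (rect_loop R Y) (F t) = rect_integral (F t) R Y"
    by (rule loop_integral_rect[OF L _ _ RY(4)])
       (use closed_poles[of "range node"] dec nodes in \<open>auto simp: Un_assoc\<close>)
  moreover have "(\<Sum>w\<in>?D. residue (F t) w) = (\<Sum>i<n. residue (F t) (node i))"
    by (subst sum.reindex) (auto simp: inj_on_def node_inj)
  moreover have "\<dots> = - (\<Sum>i<n. res_coeff (n - 1) i * of_real t ^ (n - 1 - i))"
    unfolding sum_negf[symmetric] by (intro sum.cong refl residue_F t node_pole) auto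
  ultimately have "loop_integral (Ghat_loop n a) (F t) = rect_integral (F t) R Y +
      2 * pi * \<i> * (\<Sum>i<n. res_coeff (n - 1) i * of_real t ^ (n - 1 - i))"
    by (simp add: algebra_simps)
  moreover have "1 / (2 * pi * \<i>) * (2 * pi * \<i> * z) = z" for z by simp
  ultimately show ?thesis unfolding Ghat_def F_def[symmetric] by (simp only: distrib_left) simp
qed

text \<open>
  The rectangle contributes the terms \<open>i \<ge> n\<close> of the sum, and the polynomial
  contributes the terms \<open>i < n\<close>.
\<close>
lemma Ghat_moments:
  assumes na: "\<forall>x\<in>set a. - x \<notin> \<nat>"
  shows "set_integrable lborel {0<..<1} (Ghat n a b)"
    and "(LINT t:{0<..<1}|lborel. of_real (1 - t) ^ j * Ghat n a b t) = fact j * (\<Sum>i\<le>n+j. res_coeff (n + j) i)"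
proof -
  obtain R Y where RY: "\<And>w. w \<in> Gamma_poles \<alpha> \<Longrightarrow> Re w < R \<and> \<bar>Im w\<bar> < Y" "0 < R" "R < 1" "0 < Y"
    using Gamma_poles_bounds by blast
  define g1 where "g1 t = 1 / (2 * of_real pi * \<i>) * rect_integral (F t) R Y" for t
  \<comment> \<open>The part of \<open>Ghat\<close> that comes from the residues at the nodes.\<close>
  define g2 where "g2 t = (\<Sum>i<n. res_coeff (n - 1) i * of_real t ^ (n - 1 - i))" for t :: real
  have G: "Ghat n a b t = g1 t + g2 t" if "t \<in> {0<..<1}" for t
    using Ghat_rect[OF na RY, of t] that by (simp add: g1_def g2_def)
  have i1: "set_integrable lborel {0<..<1} g1" unfolding g1_def[abs_def]
    by (intro set_integrable_mult_right rect_integral_moments(1)[OF RY])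
  note ci = set_integrable_unit_interval_continuous
  have i2: "set_integrable lborel {0<..<1} g2" unfolding g2_def by (intro ci continuous_intros)
  have "set_integrable lborel {0<..<1} (\<lambda>t. g1 t + g2 t)" by (intro set_integral_add i1 i2)
  then show "set_integrable lborel {0<..<1} (Ghat n a b)"
    by (rule set_integrable_cong[THEN iffD1, rotated -1]) (auto simp: G)
  note w = set_integrable_one_minus_power[OF i1, of j]
  have w2: "set_integrable lborel {0<..<1} (\<lambda>t. of_real (1 - t) ^ j * g2 t)" unfolding g2_def by (intro ci continuous_intros)
  have "(LINT t:{0<..<1}|lborel. of_real (1 - t) ^ j * Ghat n a b t) = (LINT t:{0<..<1}|lborel. of_real (1 - t) ^ j * g1 t + of_real (1 - t) ^ j * g2 t)"
    by (intro set_lebesgue_integral_cong) (auto simp: G distrib_left)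
  also have "\<dots> = (LINT t:{0<..<1}|lborel. of_real (1 - t) ^ j * g1 t) + (LINT t:{0<..<1}|lborel. of_real (1 - t) ^ j * g2 t)"
    by (intro set_integral_add w w2)
  also have "(LINT t:{0<..<1}|lborel. of_real (1 - t) ^ j * g1 t) = fact j * (\<Sum>i=n..n+j. res_coeff (n + j) i)"
  proof -
    have "(LINT t:{0<..<1}|lborel. of_real (1 - t) ^ j * g1 t) =
        1 / (2 * of_real pi * \<i>) * (LINT t:{0<..<1}|lborel. of_real (1 - t) ^ j * rect_integral (F t) R Y)"
      unfolding g1_def by (subst set_integral_mult_right[symmetric]) (simp add: mult_ac)
    also have "(LINT t:{0<..<1}|lborel. of_real (1 - t) ^ j * rect_integral (F t) R Y) = rect_integral (H j) R Y"
      by (rule rect_integral_moments(2)[OF RY])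
    also have "\<dots> = 2 * pi * \<i> * (fact j * (\<Sum>i=n..n+j. res_coeff (n + j) i))"
      by (rule rect_integral_H[OF RY])
    finally show ?thesis by simp
  qed
  also have "(LINT t:{0<..<1}|lborel. of_real (1 - t) ^ j * g2 t) = fact j * (\<Sum>i<n. res_coeff (n + j) i)"
  proof -
    have "(LINT t:{0<..<1}|lborel. of_real (1 - t) ^ j * g2 t) =
        (LINT t:{0<..<1}|lborel. \<Sum>i<n. res_coeff (n - 1) i * (of_real (1 - t) ^ j * of_real t ^ (n - 1 - i)))"
      unfolding g2_def by (intro set_lebesgue_integral_cong) (auto simp: sum_distrib_left mult_ac)
    also have "\<dots> = (\<Sum>i<n. LINT t:{0<..<1}|lborel. res_coeff (n - 1) i * (of_real (1 - t) ^ j * of_real t ^ (n - 1 - i)))"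
      by (intro set_lebesgue_integral_sum ci continuous_intros)
    also have "\<dots> = (\<Sum>i<n. fact j * res_coeff (n + j) i)"
    proof (intro sum.cong refl)
      fix i assume "i \<in> {..<n}"
      then have e: "n - 1 - i + j + 1 = n + j - i" by auto
      show "(LINT t:{0<..<1}|lborel. res_coeff (n - 1) i * (of_real (1 - t) ^ j * of_real t ^ (n - 1 - i))) = fact j * res_coeff (n + j) i"
        unfolding set_integral_mult_right power_beta_moment(2) e by (simp add: res_coeff_def)
    qed
    finally show ?thesis by (simp add: sum_distrib_left)
  qed
  also have "fact j * (\<Sum>i=n..n+j. res_coeff (n + j) i) + fact j * (\<Sum>i<n. res_coeff (n + j) i) = fact j * (\<Sum>i\<le>n+j. res_coeff (n + j) i)"
  proof -
    have "{..n+j} = {..<n} \<union> {n..n+j}" by auto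
    then have "(\<Sum>i\<le>n+j. res_coeff (n + j) i) = (\<Sum>i<n. res_coeff (n + j) i) + (\<Sum>i=n..n+j. res_coeff (n + j) i)"
      by (simp only:) (rule sum.union_disjoint, auto)
    then show ?thesis by (simp add: distrib_left)
  qed
  finally show "(LINT t:{0<..<1}|lborel. of_real (1 - t) ^ j * Ghat n a b t) = fact j * (\<Sum>i\<le>n+j. res_coeff (n + j) i)" .
qed

lemma pochhammer_neg_nat:
  assumes "i \<le> N"
  shows "(-1) ^ i / (fact i * fact (N - i)) = (pochhammer (- of_nat N) i / fact i / fact N :: complex)"
proof -
  have e: "(-1) ^ i * pochhammer (- of_nat N) i / fact i = (fact N / (fact i * fact (N - i)) :: complex)"
    using binomial_fact[OF assms, where ?'a = complex] by (simp only: binomial_gbinomial gbinomial_pochhammer)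
  have s: "(-1) ^ i * (-1) ^ i = (1 :: complex)" by (simp flip: power_mult_distrib)
  have "pochhammer (- of_nat N) i / fact i / fact N = ((-1) ^ i * (-1) ^ i) * (pochhammer (- of_nat N) i / fact i / fact N :: complex)"
    by (simp only: s mult_1)
  also have "\<dots> = (-1) ^ i * ((-1) ^ i * pochhammer (- of_nat N) i / fact i) / fact N" by simp
  also have "\<dots> = (-1) ^ i / (fact i * fact (N - i))" unfolding e by simp
  finally show ?thesis ..
qed

text \<open>
  If some component of \<open>a\<close> is a non-positive integer \<open>-m\<close>, then \<open>m <
  n\<close>, and the continuous extension is just the polynomial part; the terms with \<open>i \<ge>
  n\<close> of the terminating series vanish together with \<open>(a)\<^sub>i\<close>.
\<close>
lemma Ghat_div_Gamma_moments:
  shows "set_integrable lborel {0<..<1} (Ghat_div_Gamma n a b)"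
    and "(LINT t:{0<..<1}|lborel. of_real (1 - t) ^ j * Ghat_div_Gamma n a b t) = fact j / fact (n + j) * reg_term_hypF (n + j) a b"
proof -
  define c where "c i = poch_vec a i * rGamma_vec (shift_vec b (of_nat i))" for i
  have reg: "reg_term_hypF (n + j) a b / fact (n + j) = (\<Sum>i\<le>n+j. c i * ((-1) ^ i / (fact i * fact (n + j - i))))" for j
    unfolding reg_term_hypF_def atMost_atLeast0 sum_divide_distrib
  proof (intro sum.cong refl)
    fix i assume "i \<in> {0..n+j}"
    then have i: "i \<le> n + j" by simp
    show "pochhammer (- of_nat (n + j)) i * poch_vec a i * rGamma_vec (shift_vec b (of_nat i)) / fact i / fact (n + j) =
        c i * ((-1) ^ i / (fact i * fact (n + j - i)))"
      unfolding pochhammer_neg_nat[OF i] c_def by simp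
  qed
  have "set_integrable lborel {0<..<1} (Ghat_div_Gamma n a b) \<and>
    (LINT t:{0<..<1}|lborel. of_real (1 - t) ^ j * Ghat_div_Gamma n a b t) = fact j / fact (n + j) * reg_term_hypF (n + j) a b"
  proof (cases "\<forall>x\<in>set a. - x \<notin> \<nat>")
    case True
    have nz: "Gamma_vec a \<noteq> 0"
      using True unfolding Gamma_vec_def
      using not_nonpos_Ints by (auto simp: prod_list_zero_iff Gamma_eq_zero_iff)
    have shift: "Gamma_vec (shift_vec a (of_nat i)) = Gamma_vec a * poch_vec a i" for i
      using True
    proof (induction a)
      case (Cons x v)
      have "x \<notin> \<int>\<^sub>\<le>\<^sub>0" using Cons.prems by (intro not_nonpos_Ints) simp
      then have "Gamma (x + of_nat i) = Gamma x * pochhammer x i"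
        by (simp add: pochhammer_Gamma Gamma_eq_zero_iff)
      then show ?case using Cons by (simp add: Gamma_vec_def shift_vec_def)
    qed (simp add: Gamma_vec_def shift_vec_def)
    have rc: "res_coeff (n + j) i = Gamma_vec a * (c i * ((-1) ^ i / (fact i * fact (n + j - i))))" for i
      unfolding res_coeff_def Q_node shift c_def by (simp add: mult_ac)
    have eq: "Ghat_div_Gamma n a b = (\<lambda>t. Ghat n a b t / Gamma_vec a)"
      using True by (simp add: Ghat_div_Gamma_def fun_eq_iff)
    have "(LINT t:{0<..<1}|lborel. of_real (1 - t) ^ j * (Ghat n a b t / Gamma_vec a)) =
        (LINT t:{0<..<1}|lborel. of_real (1 - t) ^ j * Ghat n a b t) / Gamma_vec a"
      unfolding times_divide_eq_right by (rule set_integral_divide_zero)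
    also have "\<dots> = fact j * (reg_term_hypF (n + j) a b / fact (n + j))"
      unfolding Ghat_moments(2)[OF True] reg rc sum_distrib_left[symmetric] using nz by simp
    finally show ?thesis unfolding eq using Ghat_moments(1)[OF True] by (simp add: set_integrable_divide)
  next
    case False
    then obtain x where x: "x \<in> set a" "- x \<in> \<nat>" by blast
    then obtain m where m: "- x = of_nat m" by (auto elim: Nats_cases)
    have "Re (- x) = real m" unfolding m by simp
    then have mn: "m < n" using re_a[OF x(1)] by simp
    have n0: "n \<noteq> 0" using mn by simp
    have "x = - of_nat m" using m by (metis minus_minus)
    then have "pochhammer x i = 0" if "i \<ge> n" for i
      using that mn by (auto simp: pochhammer_eq_0_iff)
    then have "poch_vec a i = 0" if "i \<ge> n" for i
      using x(1) that unfolding poch_vec_def prod_list_zero_iff set_map by (metis image_eqI)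
    then have c0: "c i = 0" if "i \<ge> n" for i
      using that by (simp add: c_def)
    define e where "e i = c i * ((-1) ^ i / (fact i * fact (n - 1 - i)))" for i
    have eq: "Ghat_div_Gamma n a b t = (\<Sum>i<n. e i * of_real t ^ (n - 1 - i))" if t: "t \<in> {0<..<1}" for t
    proof -
      have "Ghat_div_Gamma n a b t = of_real t ^ (n - 1) / fact (n - 1) *
           (\<Sum>j=0..n-1. pochhammer (1 - of_nat n) j * poch_vec a j *
              rGamma_vec (shift_vec b (of_nat j)) / fact j * inverse (of_real t) ^ j)"
        using False n0 by (simp only: Ghat_div_Gamma_def if_False)
      also have "\<dots> = (\<Sum>i=0..n-1. e i * of_real t ^ (n - 1 - i))"
        unfolding sum_distrib_left
      proof (intro sum.cong refl)
        fix i assume i: "i \<in> {0..n-1}"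
        have e1: "e i = c i * (pochhammer (1 - of_nat n) i / fact i / fact (n - 1))"
          using pochhammer_neg_nat[of i "n - 1"] i n0 by (simp add: e_def of_nat_diff)
        have t0: "of_real t \<noteq> (0::complex)" using t by simp
        have "(of_real t :: complex) ^ (n - 1) * inverse (of_real t) ^ i = of_real t ^ (n - 1 - i)"
        proof -
          have "n - 1 = (n - 1 - i) + i" using i by simp
          then have "(of_real t :: complex) ^ (n - 1) = of_real t ^ (n - 1 - i) * of_real t ^ i" by (metis power_add)
          then show ?thesis using t0 by (simp add: power_inverse)
        qed
        moreover have "of_real t ^ (n - 1) / fact (n - 1) * (pochhammer (1 - of_nat n) i * poch_vec a i *
              rGamma_vec (shift_vec b (of_nat i)) / fact i * inverse (of_real t) ^ i) =
              c i * (pochhammer (1 - of_nat n) i / fact i / fact (n - 1)) * (of_real t ^ (n - 1) * inverse (of_real t) ^ i)"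
          by (simp add: c_def mult_ac)
        ultimately show "of_real t ^ (n - 1) / fact (n - 1) * (pochhammer (1 - of_nat n) i * poch_vec a i *
              rGamma_vec (shift_vec b (of_nat i)) / fact i * inverse (of_real t) ^ i) = e i * of_real t ^ (n - 1 - i)"
          unfolding e1 by (simp only:)
      qed
      also have "{0..n-1} = {..<n}" using n0 by auto
      finally show ?thesis .
    qed
    note ci = set_integrable_unit_interval_continuous
    have "set_integrable lborel {0<..<1} (\<lambda>t. \<Sum>i<n. e i * of_real t ^ (n - 1 - i))" by (intro ci continuous_intros)
    then have 1: "set_integrable lborel {0<..<1} (Ghat_div_Gamma n a b)"
      by (rule set_integrable_cong[THEN iffD1, rotated -1]) (auto simp: eq)
    have "(LINT t:{0<..<1}|lborel. of_real (1 - t) ^ j * Ghat_div_Gamma n a b t) =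
        (LINT t:{0<..<1}|lborel. \<Sum>i<n. e i * (of_real (1 - t) ^ j * of_real t ^ (n - 1 - i)))"
      by (intro set_lebesgue_integral_cong) (auto simp: eq sum_distrib_left mult_ac)
    also have "\<dots> = (\<Sum>i<n. LINT t:{0<..<1}|lborel. e i * (of_real (1 - t) ^ j * of_real t ^ (n - 1 - i)))"
      by (intro set_lebesgue_integral_sum ci continuous_intros)
    also have "\<dots> = (\<Sum>i<n. fact j * (c i * ((-1) ^ i / (fact i * fact (n + j - i)))))"
    proof (intro sum.cong refl)
      fix i assume "i \<in> {..<n}"
      then have ee: "n - 1 - i + j + 1 = n + j - i" by auto
      show "(LINT t:{0<..<1}|lborel. e i * (of_real (1 - t) ^ j * of_real t ^ (n - 1 - i))) = fact j * (c i * ((-1) ^ i / (fact i * fact (n + j - i))))"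
        unfolding set_integral_mult_right power_beta_moment(2) ee by (simp add: e_def)
    qed
    also have "\<dots> = (\<Sum>i\<le>n+j. fact j * (c i * ((-1) ^ i / (fact i * fact (n + j - i)))))"
      by (rule sum.mono_neutral_left) (auto simp: c0)
    also have "\<dots> = fact j * (reg_term_hypF (n + j) a b / fact (n + j))" unfolding reg sum_distrib_left ..
    finally show ?thesis using 1 by simp
  qed
  then show "set_integrable lborel {0<..<1} (Ghat_div_Gamma n a b)"
    and "(LINT t:{0<..<1}|lborel. of_real (1 - t) ^ j * Ghat_div_Gamma n a b t) = fact j / fact (n + j) * reg_term_hypF (n + j) a b"
    by auto
qed

end

theorem proposition7:
  fixes p n u s :: nat
    and a b c d :: "complex list"
    and \<psi> :: complex
  assumes "p \<ge> 1"
    and "length a = p" and "length b = p"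
    and "\<psi> = (\<Sum>k<p. b ! k - a ! k)"
    and "u \<le> s + 1"
    and "length c = u" and "length d = s"
    and "\<forall>x\<in>set d. - x \<notin> \<nat>"
    and "Re \<psi> > - real n"
    and "\<forall>x\<in>set a. Re x > - real n"
  shows "(\<forall>z. (u = s + 1 \<longrightarrow> z \<notin> complex_of_real ` {..-1}) \<longrightarrow>
            set_integrable lborel {0<..<1}
              (\<lambda>t. hypF c d (- z * of_real t) * Ghat_div_Gamma n a b t)) \<and>
         (\<forall>z. (u \<le> s \<or> Re z > - 1 / 2) \<longrightarrow>
            (\<lambda>j. z ^ j * poch_vec c j / (fact (n + j) * poch_vec d j) *
                 hypF (shift_vec c (of_nat j)) (shift_vec d (of_nat j)) (- z) *
                 reg_term_hypF (n + j) a b)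
            sums (LINT t:{0<..<1}|lborel. hypF c d (- z * of_real t) * Ghat_div_Gamma n a b t)) \<and>
         (u = s + 1 \<longrightarrow>
            (\<lambda>z. LINT t:{0<..<1}|lborel. hypF c d (- z * of_real t) * Ghat_div_Gamma n a b t)
              holomorphic_on (- complex_of_real ` {..-1}))"
proof -
  have "\<psi> = sum_list b - sum_list a"
    using assms(2-4) by (simp add: sum_subtractf sum_list_sum_nth lessThan_atLeast0)
  then interpret ghat n a b
    using assms(2,3,9,10) by unfold_locales auto
  have len_cd: "length c \<le> length d + 1" using assms by simp
  note d = assms(8)
  let ?g = "Ghat_div_Gamma n a b"
  have g: "set_integrable lborel {0<..<1} ?g" by (rule Ghat_div_Gamma_moments(1))
  have star: "of_real x * w \<in> hyp_dom c d" if "x \<in> {0..1}" "w \<in> hyp_dom c d" for x w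
    using dilate_cut_plane[OF that(1), of w] that(2) by (auto simp: hyp_dom_def split: if_splits)
  have S: "{0<..<1::real} \<in> sets borel" "{0<..<1} \<subseteq> {0..1::real}" by auto
  have dil1: "(\<lambda>w. LINT t:{0<..<1}|lborel. hypF c d (of_real t * w) * ?g t) holomorphic_on hyp_dom c d"
    by (rule holomorphic_integral_dilate(1)[OF hypF_holomorphic[OF len_cd d] hyp_dom_facts(1) _ g S]) (rule star)
  have dil2: "set_integrable lborel {0<..<1} (\<lambda>t. hypF c d (of_real t * w) * ?g t)" if "w \<in> hyp_dom c d" for w
    by (rule holomorphic_integral_dilate(2)[OF hypF_holomorphic[OF len_cd d] hyp_dom_facts(1) _ g S that]) (rule star)
  have neg: "- z \<in> hyp_dom c d" if "u = s + 1 \<longrightarrow> z \<notin> complex_of_real ` {..-1}" for z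
  proof (cases "length c \<le> length d")
    case False
    then have "z \<notin> complex_of_real ` {..-1}" using that len_cd assms(6,7) by simp
    moreover have "z \<in> complex_of_real ` {..-1}" if "- z \<in> complex_of_real ` {1..}"
    proof -
      from that obtain x where "- z = complex_of_real x" "1 \<le> x" by auto
      then show ?thesis by (intro image_eqI[of _ _ "- x"]) (auto simp: minus_equation_iff[of z] eq_commute)
    qed
    ultimately show ?thesis using False by (auto simp: hyp_dom_def)
  qed (simp add: hyp_dom_def)
  have comm: "of_real t * - z = - z * complex_of_real t" for t z by simp
  show ?thesis
  proof (intro conjI allI impI)
    fix z assume "u = s + 1 \<longrightarrow> z \<notin> complex_of_real ` {..-1}"
    from dil2[OF neg[OF this]] show "set_integrable lborel {0<..<1} (\<lambda>t. hypF c d (- z * of_real t) * ?g t)"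
      by (simp only: comm)
  next
    assume us: "u = s + 1"
    have "(\<lambda>z. LINT t:{0<..<1}|lborel. hypF c d (of_real t * - z) * ?g t) holomorphic_on - complex_of_real ` {..-1}"
      by (rule holomorphic_on_compose_gen[OF _ dil1, unfolded o_def])
         (use neg us in \<open>auto intro!: holomorphic_intros\<close>)
    then show "(\<lambda>z. LINT t:{0<..<1}|lborel. hypF c d (- z * of_real t) * ?g t) holomorphic_on - complex_of_real ` {..-1}"
      by (simp only: comm)
  next
    fix z assume "u \<le> s \<or> Re z > - 1 / 2"
    then have z: "length c \<le> length d \<or> Re z > - 1 / 2" using assms(6,7) by simp
    define q where "q j = z ^ j * poch_vec c j / (fact j * poch_vec d j) *
        hypF (shift_vec c (of_nat j)) (shift_vec d (of_nat j)) (- z)" for j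
    note taylor = hypF_taylor[OF len_cd d z, folded q_def]
    have "(\<lambda>j. LINT t:{0<..<1}|lborel. q j * of_real (1 - t) ^ j * ?g t) sums
        (LINT t:{0<..<1}|lborel. hypF c d (- z * of_real t) * ?g t)"
    proof (rule sums_set_integral_bounded(2)[OF g S(1) _ _ taylor(1)])
      show "norm (q j * of_real (1 - t) ^ j) \<le> norm (q j)" if "t \<in> {0<..<1}" for t j
        using that by (auto simp: norm_mult norm_power power_le_one intro!: mult_right_le_one_le simp del: of_real_diff)
      show "(\<lambda>j. q j * of_real (1 - t) ^ j) sums hypF c d (- z * of_real t)" if "t \<in> {0<..<1}" for t
        by (rule taylor(2)) (use that in auto)
    qed (auto intro!: continuous_intros)
    moreover have "(LINT t:{0<..<1}|lborel. q j * of_real (1 - t) ^ j * ?g t) =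
        z ^ j * poch_vec c j / (fact (n + j) * poch_vec d j) *
        hypF (shift_vec c (of_nat j)) (shift_vec d (of_nat j)) (- z) * reg_term_hypF (n + j) a b" for j
    proof -
      have "(LINT t:{0<..<1}|lborel. q j * of_real (1 - t) ^ j * ?g t) =
          q j * (LINT t:{0<..<1}|lborel. of_real (1 - t) ^ j * ?g t)"
        unfolding mult.assoc by (rule set_integral_mult_right)
      also have "\<dots> = q j * (fact j / fact (n + j) * reg_term_hypF (n + j) a b)"
        unfolding Ghat_div_Gamma_moments(2) ..
      also have "\<dots> = z ^ j * poch_vec c j / (fact (n + j) * poch_vec d j) *
        hypF (shift_vec c (of_nat j)) (shift_vec d (of_nat j)) (- z) * reg_term_hypF (n + j) a b"
        by (simp add: q_def mult_ac)
      finally show ?thesis .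
    qed
    ultimately show "(\<lambda>j. z ^ j * poch_vec c j / (fact (n + j) * poch_vec d j) *
                 hypF (shift_vec c (of_nat j)) (shift_vec d (of_nat j)) (- z) * reg_term_hypF (n + j) a b)
            sums (LINT t:{0<..<1}|lborel. hypF c d (- z * of_real t) * ?g t)" by simp
  qed
qed

end
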